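(* Let $(X,d,\mu)$ be a complete geodesic metric measure space, with $\mu$ doubling, supporting a $p$-Poincaré inequality for some $1<p<\infty$. Let $0<t<p$, let $\Omega\subset X$ be a domain with $\partial\Omega\neq\emptyset$, and let $c_0>0$ be such that for all $w\in\partial\Omega$ and all $0<\rho<\operatorname{diam}(\Omega)$, $$\mathcal{H}^{-t}_{\rho}(B(w,\rho)\cap\partial\Omega)\ \ge\ c_0\,\frac{\mu(B(w,\rho))}{\rho^t}.$$ Then there exist constants $c\ge 1$ and $c_1>0$ such that for each $z_0\in\Omega$ the following hold. (i) There are a compact set $P_\infty\subset F:=B(z_0,3d_\Omega(z_0))\cap\partial\Omega_{z_0}(c)\cap\partial\Omega$, a probability measure $\nu_F$ supported on $P_\infty$, and a constant $c_2>0$ such that for every $\zeta\in P_\infty$ and every $0<r<3d_\Omega(z_0)$, $$\nu_F(B(\zeta,r))\ \le\ c_2\,\frac{\mu(B(\zeta,r)\cap\Omega)}{r^p}.$$ (ii) Moreover, $$\mathcal{H}^{-p}_{d_\Omega(z_0)}\big(B(z_0,3d_\Omega(z_0))\cap\partial\Omega_{z_0}(c)\cap\partial\Omega\big)\ \ge\ c_1\,\frac{\mu(B(z_0,d_\Omega(z_0)))}{d_\Omega(z_0)^p}.$$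
   Context: Metric measure space: all balls of positive finite radius satisfy $0<\mu(B)<\infty$. A domain is an open connected set. $\mu$ is doubling if there is $C_d\ge1$ with $\mu(B(x,2r))\le C_d\,\mu(B(x,r))$ for all $x\in X$, $r>0$. $p$-Poincaré inequality: there are $C>0$, $\kappa\ge 1$ such that for all $x\in X$, $r>0$ and all locally Lipschitz $u$ on $X$, $$\frac{1}{\mu(B(x,r))}\int_{B(x,r)}|u-u_{B(x,r)}|\,d\mu\le C\,r\Big(\frac{1}{\mu(B(x,\kappa r))}\int_{B(x,\kappa r)}\operatorname{Lip}(u)^p\,d\mu\Big)^{1/p},$$ where $u_B$ is the mean value of $u$ on $B$ and $\operatorname{Lip}(u)(x)=\limsup_{r\to0^+}\sup_{y\in B(x,r)}\frac{|u(x)-u(y)|}{d(x,y)}$. Codimensional Hausdorff content: for $t\ge0$, $R>0$, $A\subset X$, $$\mathcal{H}^{-t}_R(A)=\inf\Big\{\sum_i \frac{\mu(B(x_i,r_i))}{r_i^t}: A\subset\bigcup_i B(x_i,r_i),\ r_i\le R\Big\},$$ the infimum being over countable covers by balls. $d_\Omega(z)=\operatorname{dist}(z,X\setminus\Omega)$, which for $z\in\Omega$ equals $\operatorname{dist}(z,\partial\Omega)$. A domain $\Omega'$ is $c$-John ($c\ge 1$) with center $z_0\in\Omega'$ if for each $y\in\Omega'$, $y\ne z_0$, there is a curve $\gamma$ with end points $z_0$ and $y$ such that $\ell(\gamma_{z,y})\le c\,d_{\Omega'}(z)$ for all $z$ on $\gamma$, where $\gamma_{z,y}$ is the subcurve of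 $\gamma$ from $z$ to $y$ and $\ell$ denotes length. For $z_0\in\Omega$, $\Omega_{z_0}(c)$ is the largest subdomain of $\Omega$ that is $c$-John with center $z_0$ (the union of all such subdomains). *)

theory Defs
  imports "HOL-Probability.Probability"
begin

text \<open>All balls are open. The metric space is the carrier of a type of class \<^class>\<open>metric_space\<close>,
  and the measure is a Borel measure on it.\<close>

definition metric_measure_space :: "'a::metric_space measure \<Rightarrow> bool" where
  "metric_measure_space M \<longleftrightarrow> sets M = sets borel \<and>
     (\<forall>x r. 0 < r \<longrightarrow> 0 < emeasure M (ball x r) \<and> emeasure M (ball x r) < \<infinity>)"

definition doubling :: "'a::metric_space measure \<Rightarrow> bool" where
  "doubling M \<longleftrightarrow> (\<exists>C\<ge>1. \<forall>x r. 0 < r \<longrightarrow>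
     emeasure M (ball x (2 * r)) \<le> ennreal C * emeasure M (ball x r))"

definition locally_lipschitz :: "('a::metric_space \<Rightarrow> real) \<Rightarrow> bool" where
  "locally_lipschitz u \<longleftrightarrow> (\<forall>x. \<exists>e>0. \<exists>L. L-lipschitz_on (ball x e) u)"

text \<open>The term \<open>y = x\<close> contributes \<open>0 / 0 = 0\<close> to the supremum.\<close>

definition Lip :: "('a::metric_space \<Rightarrow> real) \<Rightarrow> 'a \<Rightarrow> ennreal" where
  "Lip u x = Limsup (at_right 0) (\<lambda>r. SUP y\<in>ball x r. ennreal (\<bar>u x - u y\<bar> / dist x y))"

text \<open>Real powers on \<^typ>\<open>ennreal\<close>, intended for positive exponents only.\<close>

definition ennpowr :: "ennreal \<Rightarrow> real \<Rightarrow> ennreal" where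
  "ennpowr a s = (if a = \<infinity> then \<infinity> else ennreal (enn2real a powr s))"

definition mean_value :: "'a measure \<Rightarrow> 'a set \<Rightarrow> ('a \<Rightarrow> real) \<Rightarrow> real" where
  "mean_value M B u = set_lebesgue_integral M B u / measure M B"

definition poincare :: "real \<Rightarrow> 'a::metric_space measure \<Rightarrow> bool" where
  "poincare p M \<longleftrightarrow> (\<exists>C>0. \<exists>\<kappa>\<ge>1. \<forall>x r u. 0 < r \<longrightarrow> locally_lipschitz u \<longrightarrow>
     (\<integral>\<^sup>+y\<in>ball x r. ennreal \<bar>u y - mean_value M (ball x r) u\<bar> \<partial>M) / emeasure M (ball x r)
       \<le> ennreal (C * r) *
         ennpowr ((\<integral>\<^sup>+y\<in>ball x (\<kappa> * r). ennpowr (Lip u y) p \<partial>M) / emeasure M (ball x (\<kappa> * r)))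
                 (1 / p))"

text \<open>A countable cover is indexed by an arbitrary set of natural numbers, so finite covers
  (and the empty cover of the empty set) are included.\<close>

definition codim_content :: "'a::metric_space measure \<Rightarrow> real \<Rightarrow> real \<Rightarrow> 'a set \<Rightarrow> ennreal" where
  "codim_content M t R A =
     Inf {(\<Sum>i. if i \<in> I then emeasure M (ball (x i) (r i)) / ennreal (r i powr t) else 0) |
            (I :: nat set) (x :: nat \<Rightarrow> 'a) (r :: nat \<Rightarrow> real).
            (\<forall>i\<in>I. 0 < r i \<and> r i \<le> R) \<and> A \<subseteq> (\<Union>i\<in>I. ball (x i) (r i))}"

definition curve_length :: "(real \<Rightarrow> 'a::metric_space) \<Rightarrow> real \<Rightarrow> real \<Rightarrow> ennreal" where
  "curve_length \<gamma> a b =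
     Sup {(\<Sum>i<n. ennreal (dist (\<gamma> (s i)) (\<gamma> (s (Suc i))))) |
            (n :: nat) (s :: nat \<Rightarrow> real). mono_on {..n} s \<and> s ` {..n} \<subseteq> {a..b}}"

definition geodesic_space :: "'a::metric_space itself \<Rightarrow> bool" where
  "geodesic_space (_ :: 'a itself) \<longleftrightarrow> (\<forall>x y :: 'a. \<exists>\<gamma>. path \<gamma> \<and>
     pathstart \<gamma> = x \<and> pathfinish \<gamma> = y \<and> curve_length \<gamma> 0 1 = ennreal (dist x y))"

definition is_domain :: "'a::metric_space set \<Rightarrow> bool" where
  "is_domain S \<longleftrightarrow> open S \<and> connected S"

text \<open>Distance to the complement. It is used only for sets other than the whole space
  (\<^const>\<open>infdist\<close> to the empty set is \<open>0\<close>).\<close>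

definition compl_dist :: "'a::metric_space set \<Rightarrow> 'a \<Rightarrow> real" where
  "compl_dist S z = infdist z (- S)"

text \<open>Points \<open>z\<close> on the curve are represented by their parameters \<open>s\<close>.\<close>

definition john :: "real \<Rightarrow> 'a::metric_space \<Rightarrow> 'a set \<Rightarrow> bool" where
  "john c z0 S \<longleftrightarrow> is_domain S \<and> z0 \<in> S \<and>
     (\<forall>y\<in>S. y \<noteq> z0 \<longrightarrow> (\<exists>\<gamma>. path \<gamma> \<and> pathstart \<gamma> = z0 \<and> pathfinish \<gamma> = y \<and>
        (\<forall>s\<in>{0..1}. curve_length \<gamma> s 1 \<le> ennreal (c * compl_dist S (\<gamma> s)))))"

definition john_part :: "'a::metric_space set \<Rightarrow> 'a \<Rightarrow> real \<Rightarrow> 'a set" where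
  "john_part S z0 c = \<Union>{S'. S' \<subseteq> S \<and> john c z0 S'}"

end

theory Submission
  imports Defs
begin

text \<open>Fix \<open>z \<in> \<Omega>\<close> at distance \<open>s\<close> from the complement and let \<open>V\<close> be the set of points that can be reached
  from \<open>z\<close> without coming closer than \<open>2\<^sup>-\<^sup>k s\<close> to the boundary. A function that equals \<open>1\<close> near \<open>z\<close>,
  vanishes on the boundary and decreases in \<open>V\<close> like the logarithm of the distance to the complement has
  \<open>p\<close>-energy at least \<open>c \<mu>(B(z, s)) / s\<^sup>p\<close>, by the Poincare inequality and the content condition with
  \<open>t < p\<close>. Its slope is about \<open>1 / (k d)\<close>, so as \<open>p > 1\<close> a large \<open>k\<close> gives a scale \<open>\<sigma>\<close>
  with \<open>2\<^sup>-\<^sup>k s \<le> \<sigma> \<le> s / 2\<close> at which separated points \<open>y \<in> V\<close> with \<open>d(y)\<close> comparable to \<open>\<sigma>\<close> have total weight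
  \<open>\<Sum> \<mu>(B(y, d(y))) / d(y)\<^sup>p \<ge> \<mu>(B(z, s)) / s\<^sup>p\<close>. There is no loss of a constant, hence the step can be iterated.
  The limit points of the resulting tree are ends of John curves, and mass transported down the tree in proportion to the
  weights is a Frostman measure of codimension \<open>p\<close>, which also bounds the content from below.\<close>

section \<open>Length of curves and John domains\<close>

text \<open>The weight \<open>q y\<close>, that is \<mu>(B(y, d(y))) / d(y)^p, is the price of a
  Whitney ball in the content of codimension p. If the children of a node weigh at least as much as
  the node, then the branch through \<open>y\<close> receives at most the share
  \<open>q y / q z\<close> of the mass of the root \<open>z\<close>. A factor below 1 in this
  comparison would enter once per generation, so the gain from a large k has to absorb all constants
  of doubling, Poincare inequality and content condition at once. All children of a node live on one
  scale \<sigma> and are 5 \<Lambda> \<sigma> apart, where \<Lambda> = 4 \<kappa>. Descendants of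
  \<open>y\<close> stray from it by at most 2 \<Lambda> d(y), so limit sets of different branches
  stay \<Lambda> \<sigma> apart and a small ball sees only one branch. As \<Lambda> is at least 4,
  this stray bound does not keep a tree rooted at z inside B(z, 3 d(z)). Its root is therefore a
  point closer to the boundary, joined to z by a geodesic. The John constant does not deteriorate
  along a branch: d at least halves from node to child, and the connecting curves have length at
  most L d and keep a distance of at least \<delta> d from the complement.\<close>

lemma curve_length_upper:
  assumes "mono_on {..n} s" "s ` {..n} \<subseteq> {a..b}"
  shows "(\<Sum>i<n. ennreal (dist (\<gamma> (s i)) (\<gamma> (s (Suc i))))) \<le> curve_length \<gamma> a b"
  unfolding curve_length_def using assms by (intro Sup_upper) blast

lemma curve_length_least:
  assumes "\<And>n s. mono_on {..n::nat} s \<Longrightarrow> s ` {..n} \<subseteq> {a..b} \<Longrightarrow>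
     (\<Sum>i<n. ennreal (dist (\<gamma> (s i)) (\<gamma> (s (Suc i))))) \<le> L"
  shows "curve_length \<gamma> a b \<le> L"
  unfolding curve_length_def using assms by (intro Sup_least) blast

lemma dist_le_curve_length:
  assumes "a \<le> s" "s \<le> s'" "s' \<le> b"
  shows "ennreal (dist (\<gamma> s) (\<gamma> s')) \<le> curve_length \<gamma> a b"
proof -
  have "(\<Sum>i<1. ennreal (dist (\<gamma> ((\<lambda>i::nat. if i = 0 then s else s') i))
      (\<gamma> ((\<lambda>i::nat. if i = 0 then s else s') (Suc i))))) \<le> curve_length \<gamma> a b"
    using assms by (intro curve_length_upper) (auto simp: mono_on_def)
  then show ?thesis by simp
qed

text \<open>Composition with \<open>f\<close> turns partitions for \<open>\<gamma>\<close> into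
  partitions for \<open>\<gamma>'\<close>. One inequality suffices, as only upper bounds for pieces
  of joined paths are wanted.\<close>

lemma curve_length_reparam:
  assumes "mono_on {a..b} f" "f ` {a..b} \<subseteq> {a'..b'}" "\<And>x. x \<in> {a..b} \<Longrightarrow> \<gamma> x = \<gamma>' (f x)"
  shows "curve_length \<gamma> a b \<le> curve_length \<gamma>' a' b'"
proof (rule curve_length_least)
  fix n :: nat and s :: "nat \<Rightarrow> real"
  assume s: "mono_on {..n} s" "s ` {..n} \<subseteq> {a..b}"
  have "(\<Sum>i<n. ennreal (dist (\<gamma> (s i)) (\<gamma> (s (Suc i)))))
      = (\<Sum>i<n. ennreal (dist (\<gamma>' ((f \<circ> s) i)) (\<gamma>' ((f \<circ> s) (Suc i)))))"
  proof (rule sum.cong)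
    fix i assume "i \<in> {..<n}"
    then have "s i \<in> {a..b}" "s (Suc i) \<in> {a..b}"
      using s(2) by (auto simp: image_subset_iff)
    then show "ennreal (dist (\<gamma> (s i)) (\<gamma> (s (Suc i)))) = ennreal (dist (\<gamma>' ((f \<circ> s) i)) (\<gamma>' ((f \<circ> s) (Suc i))))"
      using assms(3) by simp
  qed simp
  also have "\<dots> \<le> curve_length \<gamma>' a' b'"
  proof (rule curve_length_upper)
    show "mono_on {..n} (f \<circ> s)"
      using s assms(1) by (force simp: mono_on_def image_subset_iff)
    show "(f \<circ> s) ` {..n} \<subseteq> {a'..b'}"
      using s(2) assms(2) by (auto simp: image_subset_iff)
  qed
  finally show "(\<Sum>i<n. ennreal (dist (\<gamma> (s i)) (\<gamma> (s (Suc i))))) \<le> curve_length \<gamma>' a' b'" .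
qed

lemma curve_length_split_le:
  assumes "a \<le> b" "b \<le> c"
  shows "curve_length \<gamma> a c \<le> curve_length \<gamma> a b + curve_length \<gamma> b c"
proof (rule curve_length_least)
  fix n :: nat and s :: "nat \<Rightarrow> real"
  assume s: "mono_on {..n} s" "s ` {..n} \<subseteq> {a..c}"
  \<comment> \<open>Clamping the partition at \<open>b\<close> from either side gives partitions of
    the two halves; the edge that straddles \<open>b\<close> is split by the triangle inequality
    through \<open>\<gamma> b\<close>.\<close>
  define s1 where "s1 = (\<lambda>i. min (s i) b)"
  define s2 where "s2 = (\<lambda>i. max (s i) b)"
  have *: "dist (\<gamma> (s i)) (\<gamma> (s (Suc i))) \<le>
      dist (\<gamma> (s1 i)) (\<gamma> (s1 (Suc i))) + dist (\<gamma> (s2 i)) (\<gamma> (s2 (Suc i)))" if "i < n" for i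
  proof -
    have "s i \<le> s (Suc i)" using s(1) that by (auto simp: mono_on_def)
    then show ?thesis
      using dist_triangle[of "\<gamma> (s i)" "\<gamma> (s (Suc i))" "\<gamma> b"]
      by (auto simp: s1_def s2_def min_def max_def)
  qed
  have "(\<Sum>i<n. ennreal (dist (\<gamma> (s i)) (\<gamma> (s (Suc i))))) \<le>
     (\<Sum>i<n. ennreal (dist (\<gamma> (s1 i)) (\<gamma> (s1 (Suc i))))) + (\<Sum>i<n. ennreal (dist (\<gamma> (s2 i)) (\<gamma> (s2 (Suc i)))))"
    using * by (subst sum.distrib[symmetric], intro sum_mono) (simp flip: ennreal_plus)
  also have "\<dots> \<le> curve_length \<gamma> a b + curve_length \<gamma> b c"
  proof (intro add_mono curve_length_upper)
    show "mono_on {..n} s1" "mono_on {..n} s2"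
      using s(1) unfolding s1_def s2_def mono_on_def by (meson min.mono max.mono order_refl)+
    show "s1 ` {..n} \<subseteq> {a..b}" "s2 ` {..n} \<subseteq> {b..c}"
      using s(2) assms by (auto simp: s1_def s2_def image_subset_iff)
  qed
  finally show "(\<Sum>i<n. ennreal (dist (\<gamma> (s i)) (\<gamma> (s (Suc i))))) \<le>
     curve_length \<gamma> a b + curve_length \<gamma> b c" .
qed

text \<open>Partitions of the tail are prefixed by \<open>a\<close> and \<open>b\<close>. This weak
  additivity is what forces a curve as long as the distance of its ends to be geodesic at every
  parameter.\<close>

lemma dist_add_curve_length_le:
  assumes "a \<le> b" "b \<le> c"
  shows "ennreal (dist (\<gamma> a) (\<gamma> b)) + curve_length \<gamma> b c \<le> curve_length \<gamma> a c"
proof -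
  have "curve_length \<gamma> b c \<le> curve_length \<gamma> a c - ennreal (dist (\<gamma> a) (\<gamma> b))"
  proof (rule curve_length_least)
    fix n :: nat and s :: "nat \<Rightarrow> real"
    assume s: "mono_on {..n} s" "s ` {..n} \<subseteq> {b..c}"
    define s' where "s' = (\<lambda>i. case i of 0 \<Rightarrow> a | Suc i \<Rightarrow> (case i of 0 \<Rightarrow> b | Suc i \<Rightarrow> s i))"
    have sm: "b \<le> s i" "s i \<le> c" if "i \<le> n" for i using s(2) that by auto
    have "mono_on {..Suc (Suc n)} s'"
      using s(1) sm assms by (auto simp: s'_def mono_on_def split: nat.split intro: order_trans)
    moreover have "s' ` {..Suc (Suc n)} \<subseteq> {a..c}"
      using sm assms by (force simp: s'_def split: nat.split)
    ultimately have "(\<Sum>i<Suc (Suc n). ennreal (dist (\<gamma> (s' i)) (\<gamma> (s' (Suc i))))) \<le> curve_length \<gamma> a c"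
      by (rule curve_length_upper)
    moreover have "(\<Sum>i<Suc (Suc n). ennreal (dist (\<gamma> (s' i)) (\<gamma> (s' (Suc i))))) =
       ennreal (dist (\<gamma> a) (\<gamma> b)) + (ennreal (dist (\<gamma> b) (\<gamma> (s 0))) + (\<Sum>i<n. ennreal (dist (\<gamma> (s i)) (\<gamma> (s (Suc i))))))"
      unfolding sum.lessThan_Suc_shift by (simp add: s'_def)
    ultimately have *: "ennreal (dist (\<gamma> a) (\<gamma> b)) + (ennreal (dist (\<gamma> b) (\<gamma> (s 0))) + (\<Sum>i<n. ennreal (dist (\<gamma> (s i)) (\<gamma> (s (Suc i)))))) \<le> curve_length \<gamma> a c"
      by simp
    have "ennreal (dist (\<gamma> a) (\<gamma> b)) + (\<Sum>i<n. ennreal (dist (\<gamma> (s i)) (\<gamma> (s (Suc i))))) \<le> curve_length \<gamma> a c"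
      by (rule order_trans[OF _ *]) (auto intro!: add_left_mono)
    then show "(\<Sum>i<n. ennreal (dist (\<gamma> (s i)) (\<gamma> (s (Suc i))))) \<le> curve_length \<gamma> a c - ennreal (dist (\<gamma> a) (\<gamma> b))"
      by (simp add: ennreal_le_minus_iff add.commute)
  qed
  then have "ennreal (dist (\<gamma> a) (\<gamma> b)) + curve_length \<gamma> b c \<le>
     ennreal (dist (\<gamma> a) (\<gamma> b)) + (curve_length \<gamma> a c - ennreal (dist (\<gamma> a) (\<gamma> b)))"
    by (intro add_left_mono)
  also have "\<dots> = curve_length \<gamma> a c"
    using dist_le_curve_length[of a a b c \<gamma>] assms by (simp add: ennreal_minus_cancel_iff add_diff_eq_ennreal)
  finally show ?thesis .
qed

section \<open>Geodesics and the distance to the complement\<close>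

lemma geodesicE:
  assumes "geodesic_space TYPE('a::metric_space)"
  obtains \<gamma> where "path \<gamma>" "pathstart \<gamma> = x" "pathfinish \<gamma> = (y::'a)"
    "\<And>s. s \<in> {0..1} \<Longrightarrow> dist x (\<gamma> s) + dist (\<gamma> s) y = dist x y"
    "\<And>s. s \<in> {0..1} \<Longrightarrow> curve_length \<gamma> s 1 \<le> ennreal (dist (\<gamma> s) y)"
proof -
  obtain \<gamma> where g: "path \<gamma>" "pathstart \<gamma> = x" "pathfinish \<gamma> = y"
    and l: "curve_length \<gamma> 0 1 = ennreal (dist x y)"
    using assms unfolding geodesic_space_def by blast
  have l1: "ennreal (dist x (\<gamma> s)) + curve_length \<gamma> s 1 \<le> ennreal (dist x y)" if "s \<in> {0..1}" for s
    using dist_add_curve_length_le[of 0 s 1 \<gamma>] that l g(2) by (auto simp: pathstart_def)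
  have eq: "dist x (\<gamma> s) + dist (\<gamma> s) y = dist x y" if s: "s \<in> {0..1}" for s
  proof -
    have "ennreal (dist (\<gamma> s) y) \<le> curve_length \<gamma> s 1"
      using dist_le_curve_length[of s s 1 1 \<gamma>] s g(3) by (auto simp: pathfinish_def)
    then have "ennreal (dist x (\<gamma> s)) + ennreal (dist (\<gamma> s) y) \<le> ennreal (dist x y)"
      using l1[OF s] by (meson add_left_mono order_trans)
    then have "dist x (\<gamma> s) + dist (\<gamma> s) y \<le> dist x y"
      by (simp flip: ennreal_plus)
    then show ?thesis using dist_triangle[of x y "\<gamma> s"] by linarith
  qed
  have "curve_length \<gamma> s 1 \<le> ennreal (dist (\<gamma> s) y)" if s: "s \<in> {0..1}" for s
  proof -
    have "ennreal (dist x (\<gamma> s)) + curve_length \<gamma> s 1 \<le> ennreal (dist x (\<gamma> s)) + ennreal (dist (\<gamma> s) y)"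
      using l1[OF s] eq[OF s] by (simp flip: ennreal_plus)
    then show ?thesis by (simp add: ennreal_add_left_cancel_le)
  qed
  with g eq show ?thesis by (intro that)
qed

lemma compl_dist_pos:
  assumes "open S" "S \<noteq> UNIV" "x \<in> S"
  shows "0 < compl_dist S x"
  using assms infdist_pos_not_in_closed[of "- S" x]
  unfolding compl_dist_def by auto

lemma compl_dist_nonneg [simp]: "0 \<le> compl_dist S x"
  unfolding compl_dist_def by (rule infdist_nonneg)

lemma compl_dist_pos_mem: "0 < compl_dist S x \<Longrightarrow> x \<in> S"
  unfolding compl_dist_def by (rule ccontr) simp

lemma compl_dist_lipschitz: "\<bar>compl_dist S x - compl_dist S y\<bar> \<le> dist x y"
  unfolding compl_dist_def by (rule infdist_triangle_abs)

lemma compl_dist_ball_le: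
  assumes "ball x r \<subseteq> S" "S \<noteq> UNIV"
  shows "r \<le> compl_dist S x"
proof -
  have "r \<le> dist x a" if "a \<in> - S" for a
    using assms(1) that by (force simp: subset_eq not_less[symmetric])
  then show ?thesis
    unfolding compl_dist_def using assms(2) by (subst infdist_notempty) (auto intro!: cINF_greatest)
qed

lemma ball_compl_dist_subset: "ball x (compl_dist S x) \<subseteq> S"
  unfolding compl_dist_def using infdist_le[of _ "- S" x] by fastforce

lemma connected_ball_geodesic:
  assumes "geodesic_space TYPE('a::metric_space)"
  shows "connected (ball (x::'a) r)"
proof (cases "r > 0")
  case True
  show ?thesis
  proof (rule path_connected_imp_connected)
    have "path_component (ball x r) x y" if "y \<in> ball x r" for y
    proof -
      obtain \<gamma> where g: "path \<gamma>" "pathstart \<gamma> = x" "pathfinish \<gamma> = y"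
        "\<And>s. s \<in> {0..1} \<Longrightarrow> dist x (\<gamma> s) + dist (\<gamma> s) y = dist x y"
        using geodesicE[OF assms] by metis
      have "dist x (\<gamma> s) < r" if "s \<in> {0..1}" for s
        using g(4)[OF that] \<open>y \<in> ball x r\<close> by (smt (verit) mem_ball zero_le_dist)
      then show ?thesis
        using g unfolding path_component_def by (intro exI[of _ \<gamma>]) (auto simp: path_image_def)
    qed
    then show "path_connected (ball x r)"
      unfolding path_connected_component by (meson path_component_sym path_component_trans)
  qed
qed (auto simp: ball_empty)

text \<open>A curve satisfying the carrot condition in \<open>\<Omega>\<close> is thickened to a John domain by the balls
  of half the distance to the complement.\<close>

lemma carrot_endpoint_in_john_part:
  fixes \<gamma> :: "real \<Rightarrow> 'a::metric_space"
  assumes geo: "geodesic_space TYPE('a)" and \<Omega>: "\<Omega> \<noteq> UNIV" and c: "0 \<le> c"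
    and g: "path \<gamma>" "pathstart \<gamma> = z0" "pathfinish \<gamma> = y"
    and pos: "\<And>s. s \<in> {0..1} \<Longrightarrow> 0 < compl_dist \<Omega> (\<gamma> s)"
    and len: "\<And>s. s \<in> {0..1} \<Longrightarrow> curve_length \<gamma> s 1 \<le> ennreal (c * compl_dist \<Omega> (\<gamma> s))"
  shows "y \<in> john_part \<Omega> z0 (3 * c + 1)"
proof -
  let ?d = "compl_dist \<Omega>"
  define S where "S = (\<Union>s\<in>{0..1}. ball (\<gamma> s) (?d (\<gamma> s) / 2))"
  have S\<Omega>: "S \<subseteq> \<Omega>"
  proof
    fix x assume "x \<in> S"
    then obtain s where "s \<in> {0..1}" "dist (\<gamma> s) x < ?d (\<gamma> s) / 2" by (auto simp: S_def)
    then have "x \<in> ball (\<gamma> s) (?d (\<gamma> s))" using zero_le_dist[of "\<gamma> s" x] by (simp del: zero_le_dist)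
    then show "x \<in> \<Omega>" using ball_compl_dist_subset by blast
  qed
  then have SU: "S \<noteq> UNIV" using \<Omega> by auto
  have dS: "?d (\<gamma> s) / 2 \<le> compl_dist S (\<gamma> s)" if "s \<in> {0..1}" for s
    using that SU by (intro compl_dist_ball_le) (auto simp: S_def)
  have "open S" by (auto simp: S_def)
  have pS: "\<gamma> s \<in> S" if "s \<in> {0..1}" for s
    using pos[OF that] that unfolding S_def by (intro UN_I[of s]) auto
  have z0: "z0 = \<gamma> 0" and y: "y = \<gamma> 1" using g by (auto simp: pathstart_def pathfinish_def)
  have "connected S"
  proof -
    \<comment> \<open>Adding the whole path to each ball gives connected sets with a common
      point.\<close>
    have "S = (\<Union>s\<in>{0..1}. path_image \<gamma> \<union> ball (\<gamma> s) (?d (\<gamma> s) / 2))"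
      using pS by (auto simp: S_def path_image_def)
    also have "connected \<dots>"
    proof (rule connected_Union)
      fix T assume "T \<in> (\<lambda>s. path_image \<gamma> \<union> ball (\<gamma> s) (?d (\<gamma> s) / 2)) ` {0..1}"
      then obtain s where s: "s \<in> {0..1}" "T = path_image \<gamma> \<union> ball (\<gamma> s) (?d (\<gamma> s) / 2)" by auto
      have "\<gamma> s \<in> path_image \<gamma> \<inter> ball (\<gamma> s) (?d (\<gamma> s) / 2)"
        using pos[OF s(1)] s(1) by (auto simp: path_image_def)
      then show "connected T"
        unfolding s(2) using connected_path_image[OF g(1)] connected_ball_geodesic[OF geo]
        by (intro connected_Un) auto
    next
      have "\<gamma> 0 \<in> \<Inter> ((\<lambda>s. path_image \<gamma> \<union> ball (\<gamma> s) (?d (\<gamma> s) / 2)) ` {0..1})"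
        by (auto simp: path_image_def)
      then show "\<Inter> ((\<lambda>s. path_image \<gamma> \<union> ball (\<gamma> s) (?d (\<gamma> s) / 2)) ` {0..1}) \<noteq> {}" by blast
    qed
    finally show ?thesis .
  qed
  have "\<exists>\<beta>. path \<beta> \<and> pathstart \<beta> = z0 \<and> pathfinish \<beta> = x \<and>
        (\<forall>s\<in>{0..1}. curve_length \<beta> s 1 \<le> ennreal ((3 * c + 1) * compl_dist S (\<beta> s)))"
    if xS: "x \<in> S" for x
  proof -
    obtain s where s: "s \<in> {0..1}" and xs: "dist (\<gamma> s) x < ?d (\<gamma> s) / 2"
      using xS by (auto simp: S_def)
    obtain \<alpha> where a: "path \<alpha>" "pathstart \<alpha> = \<gamma> s" "pathfinish \<alpha> = x"
        "\<And>\<tau>. \<tau> \<in> {0..1} \<Longrightarrow> dist (\<gamma> s) (\<alpha> \<tau>) + dist (\<alpha> \<tau>) x = dist (\<gamma> s) x"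
        "\<And>\<tau>. \<tau> \<in> {0..1} \<Longrightarrow> curve_length \<alpha> \<tau> 1 \<le> ennreal (dist (\<alpha> \<tau>) x)"
      using geodesicE[OF geo] by metis
    \<comment> \<open>The John curve to \<open>x\<close> follows \<open>\<gamma>\<close> up to the
      centre of a ball containing \<open>x\<close> and then the geodesic \<open>\<alpha>\<close>
      inside that ball.\<close>
    define \<gamma>1 where "\<gamma>1 = (\<lambda>\<tau>. \<gamma> (s * \<tau>))"
    have s01: "s * \<tau> \<in> {0..1}" if "\<tau> \<in> {0..1}" for \<tau>
      using s that by (auto simp: mult_le_one)
    have "continuous_on {0..1} (\<lambda>\<tau>. s * \<tau>)" by (intro continuous_intros)
    then have "path \<gamma>1" unfolding \<gamma>1_def path_def
      using continuous_on_compose2[OF g(1)[unfolded path_def], of "{0..1}" "\<lambda>\<tau>. s * \<tau>"] s01 by blast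
    have ends: "pathstart \<gamma>1 = z0" "pathfinish \<gamma>1 = \<gamma> s"
      by (auto simp: \<gamma>1_def pathstart_def pathfinish_def z0)
    have "curve_length (\<gamma>1 +++ \<alpha>) \<tau> 1 \<le> ennreal ((3 * c + 1) * compl_dist S ((\<gamma>1 +++ \<alpha>) \<tau>))"
      if t: "\<tau> \<in> {0..1}" for \<tau>
    proof (cases "\<tau> \<le> 1/2")
      case True
      define \<sigma> where "\<sigma> = s * (2 * \<tau>)"
      have \<sigma>: "\<sigma> \<in> {0..1}" unfolding \<sigma>_def using t True by (intro s01) simp
      have \<sigma>s: "\<sigma> \<le> s" unfolding \<sigma>_def using t True s by (intro mult_left_le) simp_all
      have "curve_length (\<gamma>1 +++ \<alpha>) \<tau> 1 \<le> curve_length (\<gamma>1 +++ \<alpha>) \<tau> (1/2) + curve_length (\<gamma>1 +++ \<alpha>) (1/2) 1"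
        using t True by (intro curve_length_split_le) auto
      also have "curve_length (\<gamma>1 +++ \<alpha>) \<tau> (1/2) \<le> curve_length \<gamma> \<sigma> 1"
      proof (rule curve_length_reparam[where f = "\<lambda>x. s * (2 * x)"])
        show "mono_on {\<tau>..1/2} (\<lambda>x. s * (2 * x))"
          using s unfolding mono_on_def by (simp add: mult_left_mono)
        show "(\<lambda>x. s * (2 * x)) ` {\<tau>..1 / 2} \<subseteq> {\<sigma>..1}"
        proof safe
          fix x assume x: "x \<in> {\<tau>..1/2}"
          have "\<sigma> \<le> s * (2 * x)" unfolding \<sigma>_def using s x by (intro mult_left_mono) auto
          moreover have "s * (2 * x) \<le> 1" using s01[of "2 * x"] x t by simp
          ultimately show "s * (2 * x) \<in> {\<sigma>..1}" by simp
        qed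
      qed (auto simp: joinpaths_def \<gamma>1_def)
      also have "\<dots> \<le> ennreal (c * ?d (\<gamma> \<sigma>))" by (rule len[OF \<sigma>])
      also have "curve_length (\<gamma>1 +++ \<alpha>) (1/2) 1 \<le> curve_length \<alpha> 0 1"
      proof (rule curve_length_reparam[where f = "\<lambda>x. 2 * x - 1"])
        show "(\<gamma>1 +++ \<alpha>) x = \<alpha> (2 * x - 1)" if "x \<in> {1/2..1}" for x
        proof (cases "x = 1/2")
          case True
          show ?thesis using ends a(2) unfolding True by (simp add: joinpaths_def pathstart_def pathfinish_def)
        qed (use that in \<open>auto simp: joinpaths_def\<close>)
      qed (auto simp: mono_on_def)
      also have "\<dots> \<le> ennreal (dist (\<gamma> s) x)" using a(5)[of 0] a(2) by (simp add: pathstart_def)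
      also have "ennreal (c * ?d (\<gamma> \<sigma>)) + ennreal (dist (\<gamma> s) x) = ennreal (c * ?d (\<gamma> \<sigma>) + dist (\<gamma> s) x)"
        using c by (simp add: ennreal_plus)
      also have "\<dots> \<le> ennreal ((3 * c + 1) * compl_dist S ((\<gamma>1 +++ \<alpha>) \<tau>))"
      proof (rule ennreal_leI)
        \<comment> \<open>Origin of \<open>3 * c + 1\<close>: the carrot condition at
          \<open>\<sigma>\<close> gives
          \<open>?d (\<gamma> s) \<le> (1 + c) * ?d (\<gamma> \<sigma>)\<close>, so the remaining
          length is at most c + (1 + c) / 2 times \<open>?d (\<gamma> \<sigma>)\<close>, while only
          half of \<open>?d (\<gamma> \<sigma>)\<close> is available in \<open>S\<close>.\<close>
        have "ennreal (dist (\<gamma> \<sigma>) (\<gamma> s)) \<le> ennreal (c * ?d (\<gamma> \<sigma>))"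
          using dist_le_curve_length[of \<sigma> \<sigma> s 1 \<gamma>] \<sigma>s s len[OF \<sigma>] by (meson atLeastAtMost_iff order_refl order_trans)
        then have "dist (\<gamma> \<sigma>) (\<gamma> s) \<le> c * ?d (\<gamma> \<sigma>)"
          using c by simp
        then have "?d (\<gamma> s) \<le> (1 + c) * ?d (\<gamma> \<sigma>)"
          using compl_dist_lipschitz[of \<Omega> "\<gamma> s" "\<gamma> \<sigma>"] by (auto simp: dist_commute algebra_simps)
        then have "c * ?d (\<gamma> \<sigma>) + dist (\<gamma> s) x \<le> (3 * c + 1) * (?d (\<gamma> \<sigma>) / 2)"
          using xs by (simp add: algebra_simps)
        also have "\<dots> \<le> (3 * c + 1) * compl_dist S (\<gamma> \<sigma>)"
          using dS[OF \<sigma>] c by (intro mult_left_mono) auto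
        finally show "c * ?d (\<gamma> \<sigma>) + dist (\<gamma> s) x \<le> (3 * c + 1) * compl_dist S ((\<gamma>1 +++ \<alpha>) \<tau>)"
          using True by (simp add: joinpaths_def \<gamma>1_def \<sigma>_def)
      qed
      finally show ?thesis by (simp add: add_mono)
    next
      case False
      let ?\<tau> = "2 * \<tau> - 1"
      have t': "?\<tau> \<in> {0..1}" using False t by auto
      have "curve_length (\<gamma>1 +++ \<alpha>) \<tau> 1 \<le> curve_length \<alpha> ?\<tau> 1"
        by (rule curve_length_reparam[where f = "\<lambda>x. 2 * x - 1"])
           (use False in \<open>auto simp: mono_on_def joinpaths_def\<close>)
      also have "\<dots> \<le> ennreal (dist (\<alpha> ?\<tau>) x)" by (rule a(5)[OF t'])
      also have "\<dots> \<le> ennreal ((3 * c + 1) * compl_dist S ((\<gamma>1 +++ \<alpha>) \<tau>))"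
      proof (rule ennreal_leI)
        have "ball (\<alpha> ?\<tau>) (dist (\<alpha> ?\<tau>) x) \<subseteq> ball (\<gamma> s) (?d (\<gamma> s) / 2)"
        proof
          fix v assume "v \<in> ball (\<alpha> ?\<tau>) (dist (\<alpha> ?\<tau>) x)"
          then show "v \<in> ball (\<gamma> s) (?d (\<gamma> s) / 2)"
            using a(4)[OF t'] xs dist_triangle[of "\<gamma> s" v "\<alpha> ?\<tau>"] by simp
        qed
        also have "\<dots> \<subseteq> S" using s by (auto simp: S_def)
        finally have "dist (\<alpha> ?\<tau>) x \<le> compl_dist S (\<alpha> ?\<tau>)"
          using SU by (rule compl_dist_ball_le)
        also have "\<dots> \<le> (3 * c + 1) * compl_dist S (\<alpha> ?\<tau>)"
          using c by (simp add: algebra_simps)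
        finally show "dist (\<alpha> ?\<tau>) x \<le> (3 * c + 1) * compl_dist S ((\<gamma>1 +++ \<alpha>) \<tau>)"
          using False by (simp add: joinpaths_def)
      qed
      finally show ?thesis .
    qed
    moreover have "path (\<gamma>1 +++ \<alpha>)" using \<open>path \<gamma>1\<close> a ends by (intro path_join_imp) auto
    ultimately show ?thesis
      using ends a by (intro exI[of _ "\<gamma>1 +++ \<alpha>"]) auto
  qed
  then have "john (3 * c + 1) z0 S"
    using \<open>open S\<close> \<open>connected S\<close> pS[of 0] z0 by (auto simp: john_def is_domain_def)
  moreover have "y \<in> S" using pS[of 1] y by simp
  ultimately show ?thesis using S\<Omega> unfolding john_part_def by blast
qed

section \<open>Concatenation of curves with quantitative bounds\<close>

definition reaches :: "('a::metric_space \<Rightarrow> real) \<Rightarrow> real \<Rightarrow> real \<Rightarrow> 'a \<Rightarrow> 'a \<Rightarrow> bool" where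
  "reaches d L \<delta> x y \<longleftrightarrow> (\<exists>\<gamma>. path \<gamma> \<and> pathstart \<gamma> = x \<and> pathfinish \<gamma> = y \<and>
     curve_length \<gamma> 0 1 \<le> ennreal L \<and> (\<forall>s\<in>{0..1}. \<delta> \<le> d (\<gamma> s)))"

lemma curve_length_join_left:
  assumes "pathfinish \<gamma>1 = pathstart \<gamma>2" "0 \<le> \<tau>" "\<tau> \<le> 1/2"
  shows "curve_length (\<gamma>1 +++ \<gamma>2) \<tau> 1 \<le> curve_length \<gamma>1 0 1 + curve_length \<gamma>2 0 1"
proof -
  have "curve_length (\<gamma>1 +++ \<gamma>2) \<tau> 1 \<le> curve_length (\<gamma>1 +++ \<gamma>2) \<tau> (1/2) + curve_length (\<gamma>1 +++ \<gamma>2) (1/2) 1"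
    using assms by (intro curve_length_split_le) auto
  also have "curve_length (\<gamma>1 +++ \<gamma>2) \<tau> (1/2) \<le> curve_length \<gamma>1 0 1"
    by (rule curve_length_reparam[where f = "\<lambda>x. 2 * x"])
       (use assms in \<open>auto simp: mono_on_def joinpaths_def\<close>)
  also have "curve_length (\<gamma>1 +++ \<gamma>2) (1/2) 1 \<le> curve_length \<gamma>2 0 1"
  proof (rule curve_length_reparam[where f = "\<lambda>x. 2 * x - 1"])
    show "(\<gamma>1 +++ \<gamma>2) x = \<gamma>2 (2 * x - 1)" if "x \<in> {1/2..1}" for x
    proof (cases "x = 1/2")
      case True
      show ?thesis using assms(1) unfolding True by (simp add: joinpaths_def pathstart_def pathfinish_def)
    qed (use that in \<open>auto simp: joinpaths_def\<close>)
  qed (auto simp: mono_on_def)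
  finally show ?thesis by (simp add: add_mono)
qed

lemma curve_length_join_right:
  assumes "1/2 < \<tau>"
  shows "curve_length (\<gamma>1 +++ \<gamma>2) \<tau> 1 \<le> curve_length \<gamma>2 (2 * \<tau> - 1) 1"
  by (rule curve_length_reparam[where f = "\<lambda>x. 2 * x - 1"])
     (use assms in \<open>auto simp: mono_on_def joinpaths_def\<close>)

lemma reaches_trans:
  assumes "reaches d L1 \<delta> x y" "reaches d L2 \<delta> y w" "0 \<le> L1" "0 \<le> L2"
  shows "reaches d (L1 + L2) \<delta> x w"
proof -
  obtain \<gamma>1 \<gamma>2 where 1: "path \<gamma>1" "pathstart \<gamma>1 = x" "pathfinish \<gamma>1 = y"
     "curve_length \<gamma>1 0 1 \<le> ennreal L1" "\<And>s. s\<in>{0..1} \<Longrightarrow> \<delta> \<le> d (\<gamma>1 s)"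
    and 2: "path \<gamma>2" "pathstart \<gamma>2 = y" "pathfinish \<gamma>2 = w"
     "curve_length \<gamma>2 0 1 \<le> ennreal L2" "\<And>s. s\<in>{0..1} \<Longrightarrow> \<delta> \<le> d (\<gamma>2 s)"
    using assms(1,2) unfolding reaches_def by blast
  have "curve_length (\<gamma>1 +++ \<gamma>2) 0 1 \<le> ennreal L1 + ennreal L2"
    using curve_length_join_left[of \<gamma>1 \<gamma>2 0] 1 2 by (auto intro: order_trans add_mono)
  moreover have "\<delta> \<le> d ((\<gamma>1 +++ \<gamma>2) s)" if "s \<in> {0..1}" for s
    using that 1(5) 2(5) by (auto simp: joinpaths_def)
  ultimately show ?thesis unfolding reaches_def
    using 1 2 assms by (intro exI[of _ "\<gamma>1 +++ \<gamma>2"]) (auto intro: path_join_imp simp: ennreal_plus)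
qed

lemma reaches_geodesic:
  assumes "geodesic_space TYPE('a::metric_space)" "\<And>v. dist x v \<le> dist x y \<Longrightarrow> \<delta> \<le> d v"
  shows "reaches d (dist x y) \<delta> x (y::'a)"
proof -
  obtain \<gamma> where a: "path \<gamma>" "pathstart \<gamma> = x" "pathfinish \<gamma> = y"
        "\<And>\<tau>. \<tau> \<in> {0..1} \<Longrightarrow> dist x (\<gamma> \<tau>) + dist (\<gamma> \<tau>) y = dist x y"
        "\<And>\<tau>. \<tau> \<in> {0..1} \<Longrightarrow> curve_length \<gamma> \<tau> 1 \<le> ennreal (dist (\<gamma> \<tau>) y)"
      using geodesicE[OF assms(1)] by metis
  have "dist x (\<gamma> \<tau>) \<le> dist x y" if "\<tau> \<in> {0..1}" for \<tau>
    using a(4)[OF that] by (smt (verit) zero_le_dist)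
  then show ?thesis unfolding reaches_def using a a(5)[of 0] assms(2)
    by (intro exI[of _ \<gamma>]) (auto simp: pathstart_def)
qed

text \<open>The total length is recorded separately in \<open>L\<close>: this bound is what permits
  a further piece to be prepended without enlarging \<open>c\<close>.\<close>

definition carrot :: "('a::metric_space \<Rightarrow> real) \<Rightarrow> real \<Rightarrow> real \<Rightarrow> 'a \<Rightarrow> 'a \<Rightarrow> bool" where
  "carrot d L c x y \<longleftrightarrow> (\<exists>\<gamma>. path \<gamma> \<and> pathstart \<gamma> = x \<and> pathfinish \<gamma> = y \<and>
     curve_length \<gamma> 0 1 \<le> ennreal L \<and>
     (\<forall>s\<in>{0..1}. 0 < d (\<gamma> s) \<and> curve_length \<gamma> s 1 \<le> ennreal (c * d (\<gamma> s))))"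

lemma carrot_refl:
  assumes "0 < d x"
  shows "carrot d 0 c x x"
proof -
  have "curve_length (\<lambda>_. x) s 1 = 0" for s
    using curve_length_least[of s 1 "\<lambda>_. x" 0] by simp
  then show ?thesis
    unfolding carrot_def using assms
    by (intro exI[of _ "\<lambda>_. x"]) (auto simp: path_def pathstart_def pathfinish_def)
qed

text \<open>On the new piece the remaining length never exceeds \<open>L1 + L2\<close>, which is at
  most c times the distance kept there; on the old piece the remaining length is unchanged.\<close>

lemma reaches_carrot:
  assumes "reaches d L1 \<delta> x y" "carrot d L2 c y w" "0 \<le> L1" "0 \<le> L2" "0 < \<delta>" "L1 + L2 \<le> c * \<delta>" "0 \<le> c"
  shows "carrot d (L1 + L2) c x w"
proof -
  obtain \<gamma>1 \<gamma>2 where 1: "path \<gamma>1" "pathstart \<gamma>1 = x" "pathfinish \<gamma>1 = y"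
     "curve_length \<gamma>1 0 1 \<le> ennreal L1" "\<And>s. s\<in>{0..1} \<Longrightarrow> \<delta> \<le> d (\<gamma>1 s)"
    and 2: "path \<gamma>2" "pathstart \<gamma>2 = y" "pathfinish \<gamma>2 = w"
     "curve_length \<gamma>2 0 1 \<le> ennreal L2" "\<And>s. s\<in>{0..1} \<Longrightarrow> 0 < d (\<gamma>2 s)"
     "\<And>s. s\<in>{0..1} \<Longrightarrow> curve_length \<gamma>2 s 1 \<le> ennreal (c * d (\<gamma>2 s))"
    using assms(1,2) unfolding reaches_def carrot_def by metis
  have left: "curve_length (\<gamma>1 +++ \<gamma>2) \<tau> 1 \<le> ennreal (L1 + L2)" if "\<tau> \<in> {0..1/2}" for \<tau>
    using curve_length_join_left[of \<gamma>1 \<gamma>2 \<tau>] 1 2 that assms(3,4)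
    by (auto intro: order_trans add_mono simp: ennreal_plus)
  have "0 < d ((\<gamma>1 +++ \<gamma>2) s) \<and> curve_length (\<gamma>1 +++ \<gamma>2) s 1 \<le> ennreal (c * d ((\<gamma>1 +++ \<gamma>2) s))"
    if s: "s \<in> {0..1}" for s
  proof (cases "s \<le> 1/2")
    case True
    then have d: "\<delta> \<le> d ((\<gamma>1 +++ \<gamma>2) s)" using s 1(5) by (auto simp: joinpaths_def)
    have "curve_length (\<gamma>1 +++ \<gamma>2) s 1 \<le> ennreal (L1 + L2)" using s True by (intro left) auto
    also have "\<dots> \<le> ennreal (c * d ((\<gamma>1 +++ \<gamma>2) s))"
      using d assms(6,7) by (intro ennreal_leI) (meson mult_left_mono order_trans)
    finally show ?thesis using d assms by auto
  next
    case False
    then show ?thesis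
      using curve_length_join_right[of s \<gamma>1 \<gamma>2] s 2(5,6)[of "2 * s - 1"]
      by (auto simp: joinpaths_def intro: order_trans)
  qed
  then show ?thesis unfolding carrot_def
    using 1 2 left[of 0] by (intro exI[of _ "\<gamma>1 +++ \<gamma>2"]) (auto intro: path_join_imp)
qed

lemma carrot_john_part:
  assumes "geodesic_space TYPE('a::metric_space)" "\<Omega> \<noteq> (UNIV :: 'a set)" "0 \<le> c"
    and "carrot (compl_dist \<Omega>) L c z0 y"
  shows "y \<in> john_part \<Omega> z0 (3 * c + 1)"
  using assms carrot_endpoint_in_john_part unfolding carrot_def by metis

section \<open>Doubling measures and the Poincare inequality\<close>

text \<open>Covers arise later as finite families, one for each scale. The pairing function merges
  them into the single indexed cover that the content asks for.\<close>

lemma codim_content_le_suminf: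
  fixes N :: "nat \<Rightarrow> 'a::metric_space set"
  assumes fin: "\<And>j. finite (N j)" and r: "\<And>j. 0 < r j" "\<And>j. r j \<le> R"
    and cov: "A \<subseteq> (\<Union>j. \<Union>x\<in>N j. ball x (r j))"
  shows "codim_content M t R A \<le> (\<Sum>j. \<Sum>x\<in>N j. emeasure M (ball x (r j)) / ennreal (r j powr t))"
proof -
  have "\<forall>j. \<exists>f. bij_betw f {..<card (N j)} (N j)"
    using fin ex_bij_betw_nat_finite by (metis atLeast0LessThan)
  then obtain f where f: "\<And>j. bij_betw (f j) {..<card (N j)} (N j)" by metis
  define I where "I = {i. snd (prod_decode i) < card (N (fst (prod_decode i)))}"
  define x where "x = (\<lambda>i. f (fst (prod_decode i)) (snd (prod_decode i)))"
  define \<rho> where "\<rho> = (\<lambda>i. r (fst (prod_decode i)))"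
  define h where "h = (\<lambda>(j, l). if l < card (N j) then emeasure M (ball (f j l) (r j)) / ennreal (r j powr t) else 0)"
  have "A \<subseteq> (\<Union>i\<in>I. ball (x i) (\<rho> i))"
  proof
    fix a assume "a \<in> A"
    then obtain j y where j: "y \<in> N j" "a \<in> ball y (r j)" using cov by blast
    then obtain l where "l < card (N j)" "y = f j l"
      using f[of j] by (auto simp: bij_betw_def)
    then have "prod_encode (j, l) \<in> I" "a \<in> ball (x (prod_encode (j, l))) (\<rho> (prod_encode (j, l)))"
      using j by (auto simp: I_def x_def \<rho>_def)
    then show "a \<in> (\<Union>i\<in>I. ball (x i) (\<rho> i))" by blast
  qed
  then have "codim_content M t R A \<le>
     (\<Sum>i. if i \<in> I then emeasure M (ball (x i) (\<rho> i)) / ennreal (\<rho> i powr t) else 0)"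
    unfolding codim_content_def using r
    by (intro Inf_lower CollectI exI[of _ I] exI[of _ x] exI[of _ \<rho>]) (auto simp: \<rho>_def)
  also have "\<dots> = (\<Sum>i. h (prod_decode i))"
    by (intro suminf_cong) (auto simp: h_def I_def x_def \<rho>_def split: prod.split)
  also have "\<dots> = (\<Sum>j. \<Sum>l. h (j, l))"
    by (rule suminf_ennreal_2dimen) simp
  also have "\<dots> = (\<Sum>j. \<Sum>x\<in>N j. emeasure M (ball x (r j)) / ennreal (r j powr t))"
  proof (rule suminf_cong)
    fix j
    have "(\<Sum>l. h (j, l)) = (\<Sum>l<card (N j). h (j, l))"
      by (intro suminf_finite) (auto simp: h_def)
    also have "\<dots> = (\<Sum>x\<in>N j. emeasure M (ball x (r j)) / ennreal (r j powr t))"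
      by (subst sum.reindex_bij_betw[OF f[of j], symmetric]) (auto simp: h_def)
    finally show "(\<Sum>l. h (j, l)) = (\<Sum>x\<in>N j. emeasure M (ball x (r j)) / ennreal (r j powr t))" .
  qed
  finally show ?thesis .
qed

lemma ennpowr_ennreal: "0 \<le> x \<Longrightarrow> ennpowr (ennreal x) s = ennreal (x powr s)"
  by (simp add: ennpowr_def)

lemma ennpowr_mono:
  assumes "a \<le> b" "0 \<le> s"
  shows "ennpowr a s \<le> ennpowr b s"
proof (cases "b = \<infinity>")
  case False
  then have "a \<noteq> \<infinity>" using assms(1) by (auto simp: top_unique)
  then show ?thesis using assms False
    by (auto simp: ennpowr_def less_top enn2real_mono intro!: ennreal_leI powr_mono2)
qed (auto simp: ennpowr_def)

lemma locally_lipschitz_imp_continuous: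
  assumes "locally_lipschitz u"
  shows "continuous_on UNIV u"
proof -
  have "isCont u x" for x
  proof -
    obtain e L where "e > 0" "L-lipschitz_on (ball x e) u"
      using assms unfolding locally_lipschitz_def by blast
    then have "continuous_on (ball x e) u" by (intro lipschitz_on_continuous_on)
    then show ?thesis using \<open>e > 0\<close> by (simp add: continuous_on_eq_continuous_at)
  qed
  then show ?thesis by (simp add: continuous_on_eq_continuous_at)
qed

lemma ball_subset_ballI: "dist z x + r \<le> R \<Longrightarrow> ball x r \<subseteq> ball z (R :: real)"
  by (smt (verit, ccfv_SIG) dist_triangle mem_ball subsetI)

section \<open>Doubling and separated nets\<close>

definition separated :: "real \<Rightarrow> 'a::metric_space set \<Rightarrow> bool" where
  "separated r S \<longleftrightarrow> (\<forall>x\<in>S. \<forall>y\<in>S. x \<noteq> y \<longrightarrow> r \<le> dist x y)"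

lemma separated_disjoint_balls:
  assumes "separated (2 * r) S"
  shows "disjoint_family_on (\<lambda>x. ball x r) S"
proof -
  have "dist x y < 2 * r" if "v \<in> ball x r" "v \<in> ball y r" for x y v :: 'a
    using that dist_triangle2[of x y v] by (auto simp: dist_commute)
  then show ?thesis
    using assms unfolding separated_def disjoint_family_on_def by (force simp: not_less[symmetric])
qed

locale doubling_measure =
  fixes M :: "'a::metric_space measure" and D :: real
  assumes sets_M: "sets M = sets borel"
    and measure_ball_pos: "\<And>x r. 0 < r \<Longrightarrow> 0 < measure M (ball x r)"
    and emeasure_ball_finite: "\<And>x r. emeasure M (ball x r) < \<infinity>"
    and D_ge_1: "1 \<le> D"
    and measure_ball_double: "\<And>x r. 0 < r \<Longrightarrow> measure M (ball x (2 * r)) \<le> D * measure M (ball x r)"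
begin

lemma ball_sets [measurable, simp]: "ball x r \<in> sets M"
  by (simp add: sets_M)

lemma space_M [simp]: "space M = UNIV"
  using sets_eq_imp_space_eq[OF sets_M] by simp

lemma emeasure_ball: "emeasure M (ball x r) = ennreal (measure M (ball x r))"
  using emeasure_ball_finite[of x r] by (intro emeasure_eq_ennreal_measure) auto

lemma ball_fmeasurable: "ball x r \<in> fmeasurable M"
  using emeasure_ball_finite by (intro fmeasurableI) auto

lemma D_pow_ge_1: "1 \<le> D ^ n"
  using D_ge_1 by (rule one_le_power)

lemma measure_ball_power:
  assumes "0 < r"
  shows "measure M (ball x (2 ^ n * r)) \<le> D ^ n * measure M (ball x r)"
proof (induction n)
  case (Suc n)
  have "measure M (ball x (2 ^ Suc n * r)) \<le> D * measure M (ball x (2 ^ n * r))"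
    using measure_ball_double[of "2 ^ n * r" x] assms by (simp add: mult.assoc)
  also have "\<dots> \<le> D * (D ^ n * measure M (ball x r))"
    using Suc D_ge_1 by (intro mult_left_mono) auto
  finally show ?case by (simp add: mult.assoc)
qed simp

lemma measure_ball_compare:
  assumes "0 < r" "dist x y + R \<le> 2 ^ n * r"
  shows "measure M (ball y R) \<le> D ^ n * measure M (ball x r)"
proof -
  have "ball y R \<subseteq> ball x (2 ^ n * r)"
  proof
    fix v assume "v \<in> ball y R"
    then show "v \<in> ball x (2 ^ n * r)" using assms(2) dist_triangle[of x v y] by simp
  qed
  then have "measure M (ball y R) \<le> measure M (ball x (2 ^ n * r))"
    by (intro measure_mono_fmeasurable ball_fmeasurable) auto
  with measure_ball_power[OF assms(1), of x n] show ?thesis by linarith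
qed

text \<open>Packing: the balls of radius \<open>r / 2\<close> are disjoint inside
  \<open>B(z, R + r / 2)\<close>, and each carries at least the fraction \<open>1 / D ^ n\<close> of
  its measure. The numerical premise is twice 2 R + r / 2 \<le> 2^n r / 2.\<close>

lemma finite_separated_card_le:
  assumes "finite N" "N \<subseteq> ball (z :: 'a) R" "separated r N" "0 < r" "0 < R" "4 * R + r \<le> 2 ^ n * r"
  shows "real (card N) \<le> D ^ n"
proof -
  let ?B = "measure M (ball z (R + r / 2))"
  have disj: "disjoint_family_on (\<lambda>x. ball x (r / 2)) N"
    using separated_disjoint_balls[of "r / 2" N] assms(3) by simp
  have "real (card N) * (?B / D ^ n) = (\<Sum>x\<in>N. ?B / D ^ n)" by simp
  also have "\<dots> \<le> (\<Sum>x\<in>N. measure M (ball x (r / 2)))"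
  proof (rule sum_mono)
    fix x assume "x \<in> N"
    then have "dist x z < R" using assms(2) by (auto simp: dist_commute)
    then have "?B \<le> D ^ n * measure M (ball x (r / 2))"
      using assms by (intro measure_ball_compare) auto
    then show "?B / D ^ n \<le> measure M (ball x (r / 2))"
      using D_ge_1 by (simp add: divide_le_eq mult.commute)
  qed
  also have "\<dots> = measure M (\<Union>x\<in>N. ball x (r / 2))"
    using disj assms(1) by (intro measure_finite_Union[symmetric]) (auto simp: emeasure_ball)
  also have "\<dots> \<le> ?B"
  proof (intro measure_mono_fmeasurable ball_fmeasurable)
    show "(\<Union>x\<in>N. ball x (r / 2)) \<subseteq> ball z (R + r / 2)"
    proof safe
      fix x v assume "x \<in> N" "v \<in> ball x (r / 2)"
      then show "v \<in> ball z (R + r / 2)" using assms(2) dist_triangle[of z v x] by force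
    qed
  qed (use assms(1) in \<open>auto simp: sets_M\<close>)
  finally have "real (card N) * (?B / D ^ n) \<le> ?B" .
  moreover have "0 < ?B" using assms by (intro measure_ball_pos) auto
  ultimately show ?thesis using D_pow_ge_1[of n] by (simp add: field_simps)
qed

text \<open>The packing bound provides a separated subset of largest cardinality, and by maximality
  it is a net.\<close>

lemma ex_separated_net:
  assumes "S \<subseteq> ball (z :: 'a) R" "0 < r" "0 < R" "4 * R + r \<le> 2 ^ n * r"
  obtains N where "finite N" "N \<subseteq> S" "separated r N" "S \<subseteq> (\<Union>x\<in>N. ball x r)" "real (card N) \<le> D ^ n"
proof -
  let ?P = "\<lambda>N. finite N \<and> N \<subseteq> S \<and> separated r N"
  have bd: "card N \<le> nat \<lfloor>D ^ n\<rfloor>" if "?P N" for N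
  proof -
    have "real (card N) \<le> D ^ n"
      using that assms by (intro finite_separated_card_le[of N z R r n]) auto
    then show ?thesis by (simp add: le_nat_floor)
  qed
  have "?P {}" by (simp add: separated_def)
  then obtain N where N: "?P N" "\<And>N'. ?P N' \<Longrightarrow> card N' \<le> card N"
    using ex_has_greatest_nat[of ?P "{}" card "Suc (nat \<lfloor>D ^ n\<rfloor>)"] bd by (metis less_Suc_eq_le)
  have "S \<subseteq> (\<Union>x\<in>N. ball x r)"
  proof (rule ccontr)
    assume "\<not> ?thesis"
    then obtain y where y: "y \<in> S" "\<And>x. x \<in> N \<Longrightarrow> r \<le> dist x y" by fastforce
    then have "y \<notin> N" using assms(2) by force
    have "?P (insert y N)"
      using N(1) y by (auto simp: separated_def dist_commute)
    from N(2)[OF this] show False using \<open>y \<notin> N\<close> N(1) by simp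
  qed
  with N(1) show ?thesis
    using finite_separated_card_le[of N z R r n] assms that by (meson order_trans)
qed

lemma borel_measurable_M: "borel_measurable M = (borel_measurable borel :: ('a \<Rightarrow> real) set)"
  using measurable_cong_sets[OF sets_M refl] .

lemma set_integrable_bounded:
  assumes "u \<in> borel_measurable borel" "\<And>x. \<bar>u x\<bar> \<le> K"
  shows "set_integrable M (ball x r) (u :: 'a \<Rightarrow> real)"
proof -
  have "integrable M (\<lambda>y. indicator (ball x r) y *\<^sub>R u y)"
  proof (rule integrableI_bounded_set_indicator)
    show "u \<in> borel_measurable M" using assms(1) by (simp add: borel_measurable_M)
    show "AE y in M. y \<in> ball x r \<longrightarrow> norm (u y) \<le> K" using assms(2) by simp
  qed (use emeasure_ball_finite[of x r] in auto)
  then show ?thesis by (simp add: set_integrable_def)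
qed

lemma mean_value_diff_le:
  assumes "u \<in> borel_measurable borel" "\<And>x. \<bar>u x\<bar> \<le> K" "0 < r"
  shows "\<bar>mean_value M (ball x r) u - m\<bar> \<le> (LINT y:ball x r|M. \<bar>u y - m\<bar>) / measure M (ball x r)"
proof -
  have int: "set_integrable M (ball x r) u" "set_integrable M (ball x r) (\<lambda>_. m)"
    using set_integrable_bounded[of u K] set_integrable_bounded[of "\<lambda>_. m" "\<bar>m\<bar>"] assms by auto
  have pos: "0 < measure M (ball x r)" using assms(3) by (rule measure_ball_pos)
  have "(LINT y:ball x r|M. u y - m) = (LINT y:ball x r|M. u y) - m * measure M (ball x r)"
    using int by (subst set_integral_diff) (auto simp: set_integral_const emeasure_ball)
  then have "mean_value M (ball x r) u - m = (LINT y:ball x r|M. u y - m) / measure M (ball x r)"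
    using pos by (simp add: mean_value_def field_simps)
  moreover have "\<bar>LINT y:ball x r|M. u y - m\<bar> \<le> (LINT y:ball x r|M. \<bar>u y - m\<bar>)"
    unfolding set_lebesgue_integral_def
    using integral_abs_bound[of M "\<lambda>y. indicator (ball x r) y *\<^sub>R (u y - m)"] by (simp add: abs_mult)
  ultimately show ?thesis using pos by (simp add: divide_right_mono)
qed

lemma mean_value_near:
  assumes "u \<in> borel_measurable borel" "\<And>x. \<bar>u x\<bar> \<le> K" "0 < r"
    and "\<And>y. y \<in> ball x r \<Longrightarrow> \<bar>u y - m\<bar> \<le> e"
  shows "\<bar>mean_value M (ball x r) u - m\<bar> \<le> e"
proof -
  have pos: "0 < measure M (ball x r)" using assms(3) by (rule measure_ball_pos)
  have "(LINT y:ball x r|M. \<bar>u y - m\<bar>) \<le> (LINT y:ball x r|M. e)"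
  proof (rule set_integral_mono)
    have "\<bar>u y - m\<bar> \<le> K + \<bar>m\<bar>" for y using assms(2)[of y] by linarith
    then show "set_integrable M (ball x r) (\<lambda>y. \<bar>u y - m\<bar>)"
      using assms(1) by (intro set_integrable_bounded[where K = "K + \<bar>m\<bar>"]) auto
    show "set_integrable M (ball x r) (\<lambda>_. e)"
      by (rule set_integrable_bounded[where K = "\<bar>e\<bar>"]) auto
  qed (rule assms(4))
  also have "\<dots> = e * measure M (ball x r)" by (simp add: set_integral_const emeasure_ball)
  finally have "(LINT y:ball x r|M. \<bar>u y - m\<bar>) / measure M (ball x r) \<le> e"
    using pos by (simp add: divide_le_eq)
  with mean_value_diff_le[OF assms(1-3), of x m] show ?thesis by linarith
qed

end

locale poincare_measure = doubling_measure M D for M :: "'a::metric_space measure" and D +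
  fixes C \<kappa> p :: real
  assumes C_pos: "0 < C" and \<kappa>_ge_1: "1 \<le> \<kappa>" and p_gt_1: "1 < p"
    and poincare_ineq: "\<And>x r u. 0 < r \<Longrightarrow> locally_lipschitz u \<Longrightarrow>
     (\<integral>\<^sup>+y\<in>ball x r. ennreal \<bar>u y - mean_value M (ball x r) u\<bar> \<partial>M) / emeasure M (ball x r)
       \<le> ennreal (C * r) *
         ennpowr ((\<integral>\<^sup>+y\<in>ball x (\<kappa> * r). ennpowr (Lip u y) p \<partial>M) / emeasure M (ball x (\<kappa> * r))) (1 / p)"
begin

text \<open>The quotient of measures is the cost of restricting the mean oscillation to a smaller
  ball. The energy of \<open>u\<close> enters only through an upper bound \<open>e\<close>, so that
  the mass of a dominating measure can take its place.\<close>

lemma mean_value_sub_ball: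
  assumes u: "locally_lipschitz u" "\<And>x. \<bar>u x\<bar> \<le> K"
    and r: "0 < r" "0 < r'" "ball y r' \<subseteq> ball x r"
    and e: "0 \<le> e" "(\<integral>\<^sup>+y\<in>ball x (\<kappa> * r). ennpowr (Lip u y) p \<partial>M) \<le> ennreal e"
  shows "\<bar>mean_value M (ball y r') u - mean_value M (ball x r) u\<bar> \<le>
    measure M (ball x r) / measure M (ball y r') * (C * r * (e / measure M (ball x (\<kappa> * r))) powr (1 / p))"
proof -
  let ?m = "mean_value M (ball x r) u"
  let ?X = "C * r * (e / measure M (ball x (\<kappa> * r))) powr (1 / p)"
  let ?I = "\<lambda>S. LINT v:S|M. \<bar>u v - ?m\<bar>"
  have um: "u \<in> borel_measurable borel"
    using locally_lipschitz_imp_continuous[OF u(1)] by (rule borel_measurable_continuous_onI)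
  have pos: "0 < measure M (ball x r)" "0 < measure M (ball y r')" "0 < measure M (ball x (\<kappa> * r))"
    using r \<kappa>_ge_1 by (auto intro!: measure_ball_pos)
  have "\<bar>u v - ?m\<bar> \<le> K + \<bar>?m\<bar>" for v using u(2)[of v] by linarith
  then have int: "set_integrable M (ball v \<rho>) (\<lambda>v. \<bar>u v - ?m\<bar>)" for v \<rho>
    using um by (intro set_integrable_bounded[where K = "K + \<bar>?m\<bar>"]) auto
  have "(\<integral>\<^sup>+v\<in>ball x r. ennreal \<bar>u v - ?m\<bar> \<partial>M) = (\<integral>\<^sup>+v. ennreal (indicator (ball x r) v *\<^sub>R \<bar>u v - ?m\<bar>) \<partial>M)"
    by (intro nn_integral_cong) (auto split: split_indicator)
  also have "\<dots> = ennreal (?I (ball x r))"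
    unfolding set_lebesgue_integral_def using int[of x r]
    by (intro nn_integral_eq_integral) (auto simp: set_integrable_def)
  finally have nn: "(\<integral>\<^sup>+v\<in>ball x r. ennreal \<bar>u v - ?m\<bar> \<partial>M) = ennreal (?I (ball x r))" .
  have I0: "0 \<le> ?I (ball x r)"
    unfolding set_lebesgue_integral_def by (intro integral_nonneg_AE) auto
  have "ennreal (?I (ball x r) / measure M (ball x r)) =
      (\<integral>\<^sup>+v\<in>ball x r. ennreal \<bar>u v - ?m\<bar> \<partial>M) / emeasure M (ball x r)"
    unfolding nn emeasure_ball using pos I0 by (simp add: divide_ennreal)
  also have "\<dots> \<le> ennreal (C * r) *
         ennpowr ((\<integral>\<^sup>+y\<in>ball x (\<kappa> * r). ennpowr (Lip u y) p \<partial>M) / emeasure M (ball x (\<kappa> * r))) (1 / p)"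
    using r(1) u(1) by (rule poincare_ineq)
  also have "\<dots> \<le> ennreal (C * r) * ennpowr (ennreal e / emeasure M (ball x (\<kappa> * r))) (1 / p)"
    using p_gt_1 e(2) by (intro mult_left_mono ennpowr_mono divide_right_mono_ennreal) auto
  also have "\<dots> = ennreal ?X"
    unfolding emeasure_ball using pos e(1) C_pos r(1)
    by (simp add: divide_ennreal ennpowr_ennreal ennreal_mult)
  finally have "?I (ball x r) / measure M (ball x r) \<le> ?X"
    using C_pos r(1) by (subst (asm) ennreal_le_iff) auto
  then have I: "?I (ball x r) \<le> measure M (ball x r) * ?X"
    using pos by (simp add: divide_le_eq mult.commute)
  have "?I (ball y r') \<le> ?I (ball x r)"
    unfolding set_lebesgue_integral_def using int[unfolded set_integrable_def] r(3)
    by (intro integral_mono) (auto split: split_indicator)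
  then have "?I (ball y r') / measure M (ball y r') \<le> measure M (ball x r) * ?X / measure M (ball y r')"
    using I pos by (intro divide_right_mono) auto
  with mean_value_diff_le[OF um u(2) r(2), of y ?m] show ?thesis by simp
qed

end

section \<open>A lower bound for the capacity\<close>

context poincare_measure
begin

text \<open>Otherwise the dyadic mean values would change by less than 1/4 altogether, because the
  bounds \<open>\<theta> ^ j * (1 - \<theta>) / 4\<close> sum to 1/4. But they start above 1/2 and
  end below 1/4, as \<open>u\<close> is continuous with \<open>u x = 0\<close>.\<close>

lemma telescoping_level:
  assumes u: "locally_lipschitz u" "\<And>x. \<bar>u x\<bar> \<le> 1" "u x = 0"
    and r: "0 < r" and \<theta>: "0 < \<theta>" "\<theta> < 1" and m0: "1 / 2 < mean_value M (ball x r) u"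
    and e: "\<And>j. 0 \<le> e j" "\<And>j. (\<integral>\<^sup>+y\<in>ball x (\<kappa> * (r / 2 ^ j)). ennpowr (Lip u y) p \<partial>M) \<le> ennreal (e j)"
  shows "\<exists>j. \<theta> ^ j * (1 - \<theta>) / 4 \<le>
    D * (C * (r / 2 ^ j) * (e j / measure M (ball x (\<kappa> * (r / 2 ^ j)))) powr (1 / p))"
proof (rule ccontr)
  assume "\<not> ?thesis"
  then have less: "D * (C * (r / 2 ^ j) * (e j / measure M (ball x (\<kappa> * (r / 2 ^ j)))) powr (1 / p))
      \<le> \<theta> ^ j * (1 - \<theta>) / 4" for j by (meson not_le order_less_imp_le)
  define m where "m = (\<lambda>j. mean_value M (ball x (r / 2 ^ j)) u)"
  have step: "\<bar>m (Suc j) - m j\<bar> \<le> \<theta> ^ j * (1 - \<theta>) / 4" for j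
  proof -
    let ?r = "r / 2 ^ j"
    let ?X = "C * ?r * (e j / measure M (ball x (\<kappa> * ?r))) powr (1 / p)"
    have pos: "0 < ?r / 2" using r by simp
    have "\<bar>m (Suc j) - m j\<bar> \<le> measure M (ball x ?r) / measure M (ball x (?r / 2)) * ?X"
      unfolding m_def using mean_value_sub_ball[OF u(1,2), of ?r "?r / 2" x x "e j"] r e pos
      by (simp add: field_simps subset_ball)
    also have "\<dots> \<le> D * ?X"
    proof (rule mult_right_mono)
      show "measure M (ball x ?r) / measure M (ball x (?r / 2)) \<le> D"
        using measure_ball_double[OF pos, of x] measure_ball_pos[OF pos, of x] by (simp add: divide_le_eq)
    qed (use C_pos r in simp)
    finally show ?thesis using less[of j] by linarith
  qed
  have sum: "\<bar>m n - m 0\<bar> \<le> (1 - \<theta> ^ n) / 4" for n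
  proof (induction n)
    case (Suc n)
    have "\<bar>m (Suc n) - m 0\<bar> \<le> \<bar>m (Suc n) - m n\<bar> + \<bar>m n - m 0\<bar>" by linarith
    also have "\<dots> \<le> \<theta> ^ n * (1 - \<theta>) / 4 + (1 - \<theta> ^ n) / 4" using Suc step[of n] by linarith
    finally show ?case by (simp add: field_simps)
  qed simp
  have "isCont u x"
    using locally_lipschitz_imp_continuous[OF u(1)] by (simp add: continuous_on_eq_continuous_at)
  then obtain \<rho> where \<rho>: "0 < \<rho>" "\<And>y. dist y x < \<rho> \<Longrightarrow> dist (u y) (u x) < 1 / 4"
    unfolding continuous_at_eps_delta by (meson zero_less_divide_1_iff zero_less_numeral)
  obtain n where n: "r / \<rho> < 2 ^ n" using real_arch_pow[of 2 "r / \<rho>"] by auto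
  then have n: "r / 2 ^ n < \<rho>" using \<rho> r by (simp add: field_simps)
  have "\<bar>m n - 0\<bar> \<le> 1 / 4" unfolding m_def
  proof (rule mean_value_near)
    show "u \<in> borel_measurable borel"
      using locally_lipschitz_imp_continuous[OF u(1)] by (rule borel_measurable_continuous_onI)
    show "\<bar>u y - 0\<bar> \<le> 1 / 4" if "y \<in> ball x (r / 2 ^ n)" for y
      using \<rho>(2)[of y] that n u(3) by (simp add: dist_commute)
  qed (use u r in auto)
  moreover have "1 / 2 < m 0" using m0 by (simp add: m_def)
  moreover have "0 < \<theta> ^ n" using \<theta> by simp
  ultimately show False using sum[of n] by (simp add: field_simps)
qed

text \<open>The telescoping sums leave slack: since \<open>t < p\<close>, at each boundary point some scale \<open>r\<^sub>j\<close> carries energy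
  at least \<open>2\<^sup>-\<^sup>j\<^sup>\<delta>\<close> times the critical amount. The sum over the scales is then geometric,
  and disjoint balls at each single scale suffice instead of a Vitali covering.\<close>

lemma capacity_lower_bound:
  assumes t: "0 < t" "t < p" and c0: "0 < c0"
  shows "\<exists>c>0. \<forall>z s w F u N. 0 < s \<longrightarrow> dist z w < 2 * s \<longrightarrow> locally_lipschitz u \<longrightarrow>
    (\<forall>x. 0 \<le> u x \<and> u x \<le> 1) \<longrightarrow> (\<forall>x\<in>ball z (s / 2). u x = 1) \<longrightarrow> (\<forall>x\<in>F. u x = 0) \<longrightarrow>
    ennreal c0 * emeasure M (ball w (s / 2)) / ennreal ((s / 2) powr t)
      \<le> codim_content M t (s / 2) (ball w (s / 2) \<inter> F) \<longrightarrow>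
    sets N = sets borel \<longrightarrow> emeasure N (ball z (4 * \<kappa> * s)) < \<infinity> \<longrightarrow>
    (\<forall>y r. ball y r \<subseteq> ball z (4 * \<kappa> * s) \<longrightarrow>
       (\<integral>\<^sup>+x\<in>ball y r. ennpowr (Lip u x) p \<partial>M) \<le> emeasure N (ball y r)) \<longrightarrow>
    c * measure M (ball z s) / s powr p \<le> measure N (ball z (4 * \<kappa> * s))"
proof -
  \<comment> \<open>The gap p - t is split in two halves: one pays for the geometric weights
    \<open>\<theta> ^ j\<close> of the telescoping (\<open>\<theta> powr p = \<phi>\<close>), the
    other survives as the decay \<open>\<phi> ^ j\<close> between scales.\<close>
  define \<delta> where "\<delta> = (p - t) / 2"
  define \<phi> where "\<phi> = (2::real) powr (- \<delta>)"
  define \<theta> where "\<theta> = \<phi> powr (1 / p)"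
  define b where "b = (1 - \<theta>) / (4 * D * C)"
  have \<delta>: "0 < \<delta>" "p - t = 2 * \<delta>" using t by (auto simp: \<delta>_def)
  have \<phi>: "0 < \<phi>" "\<phi> < 1" unfolding \<phi>_def using \<delta> by (auto intro: powr_less_one)
  have \<theta>: "0 < \<theta>" "\<theta> < 1" "\<theta> powr p = \<phi>"
    unfolding \<theta>_def using \<phi> p_gt_1 by (auto simp: powr_powr powr01_less_one)
  have b: "0 < b" using \<theta> D_ge_1 C_pos by (auto simp: b_def)
  \<comment> \<open>Since \<open>r0\<close> below is \<open>s / (4 * \<kappa>)\<close>, this
    exponent yields 8 s \<le> 2^n1 r0, enough to compare \<open>B(z, 4 s)\<close> with
    \<open>B(x, r0)\<close> at boundary points x.\<close>
  obtain n1 where "32 * \<kappa> < 2 ^ n1" using real_arch_pow[of 2 "32 * \<kappa>"] by auto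
  then have n1: "32 * \<kappa> \<le> 2 ^ n1" by simp
  have n13: "D ^ 3 \<le> D ^ n1"
  proof (rule power_increasing[OF _ D_ge_1])
    have "(2::real) ^ 3 \<le> 2 ^ n1" using n1 \<kappa>_ge_1 by simp
    then show "3 \<le> n1" by (rule power_le_imp_le_exp[rotated]) simp
  qed
  define ca where "ca = (1 / (16 * C * D ^ n1)) powr p"
  \<comment> \<open>\<open>D ^ 4\<close> collects one doubling for the covering balls and three for
    comparing \<open>B(z, s)\<close> with \<open>B(w, s / 2)\<close>; \<open>1 - \<phi>\<close>
    comes from the geometric series.\<close>
  define cb where "cb = c0 * (1 - \<phi>) * b powr p / D ^ 4"
  have D0: "0 < D" using D_ge_1 by simp
  have ca: "0 < ca" and cb: "0 < cb"
    using C_pos D0 c0 \<phi> b by (auto simp: ca_def cb_def)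
  show ?thesis
  proof (intro exI[of _ "min ca cb"] conjI allI impI)
    fix z w :: 'a and s :: real and F :: "'a set" and u :: "'a \<Rightarrow> real" and N :: "'a measure"
    assume s: "0 < s" and zw: "dist z w < 2 * s" and u: "locally_lipschitz u"
      and u01: "\<forall>x. 0 \<le> u x \<and> u x \<le> 1" and u1: "\<forall>x\<in>ball z (s / 2). u x = 1"
      and u0: "\<forall>x\<in>F. u x = 0"
      and content: "ennreal c0 * emeasure M (ball w (s / 2)) / ennreal ((s / 2) powr t)
          \<le> codim_content M t (s / 2) (ball w (s / 2) \<inter> F)"
      and setsN: "sets N = sets borel" and finN: "emeasure N (ball z (4 * \<kappa> * s)) < \<infinity>"
      and energy: "\<forall>y r. ball y r \<subseteq> ball z (4 * \<kappa> * s) \<longrightarrow>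
           (\<integral>\<^sup>+x\<in>ball y r. ennpowr (Lip u x) p \<partial>M) \<le> emeasure N (ball y r)"
    let ?B = "ball z (4 * \<kappa> * s)"
    let ?e = "measure N ?B"
    let ?\<mu> = "measure M (ball z s)"
    have \<mu>: "0 < ?\<mu>" using s by (rule measure_ball_pos)
    have uabs: "\<bar>u x\<bar> \<le> 1" for x using u01 by simp
    have um: "u \<in> borel_measurable borel"
      using locally_lipschitz_imp_continuous[OF u] by (rule borel_measurable_continuous_onI)
    have Nball: "emeasure N (ball y r) = ennreal (measure N (ball y r)) \<and> measure N (ball y r) \<le> ?e"
      if "ball y r \<subseteq> ?B" for y r
    proof -
      have "?B \<in> fmeasurable N" using finN setsN by (intro fmeasurableI) auto
      then have "ball y r \<in> fmeasurable N" using that setsN by (elim fmeasurableI2) auto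
      with \<open>?B \<in> fmeasurable N\<close> show ?thesis
        using that by (auto intro: measure_mono_fmeasurable emeasure_eq_measure2 fmeasurableD)
    qed
    have \<kappa>s: "4 * s \<le> 4 * \<kappa> * s" using \<kappa>_ge_1 s by simp
    \<comment> \<open>With \<kappa> r0 = s / 4 even the enlarged balls around points of
      \<open>E\<close> remain in \<open>?B\<close>, where the energy is controlled.\<close>
    define r0 where "r0 = s / (4 * \<kappa>)"
    define r where "r = (\<lambda>j::nat. r0 / 2 ^ j)"
    have r0: "0 < r0" "\<kappa> * r0 = s / 4" "r0 \<le> s"
      using s \<kappa>_ge_1 by (auto simp: r0_def field_simps)
    have r: "0 < r j" "r j \<le> r0" for j using r0 by (auto simp: r_def divide_le_eq)
    define E where "E = ball w (s / 2) \<inter> F"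
    have Ez: "dist z x < 5 / 2 * s" if "x \<in> E" for x
      using that zw dist_triangle[of z x w] by (auto simp: E_def)
    have sub: "ball x (\<kappa> * r j) \<subseteq> ?B" if "x \<in> E" for x j
    proof -
      have "\<kappa> * r j \<le> s / 4" using r(2)[of j] r0(2) \<kappa>_ge_1 by (metis mult_left_mono order_trans zero_le_one)
      then show ?thesis using Ez[OF that] \<kappa>s s by (intro ball_subset_ballI) linarith
    qed
    define Y where "Y = C * (4 * s) * (?e / ?\<mu>) powr (1 / p)"
    have Y0: "0 \<le> Y" using C_pos s by (simp add: Y_def)
    let ?m = "mean_value M (ball z (4 * s)) u"
    have mean: "\<bar>mean_value M (ball y r') u - ?m\<bar> \<le> D ^ n1 * Y"
      if "0 < r'" "ball y r' \<subseteq> ball z (4 * s)" "dist y z + 4 * s \<le> 2 ^ n * r'" "D ^ n \<le> D ^ n1" for y r' n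
    proof -
      have "\<bar>mean_value M (ball y r') u - ?m\<bar> \<le> measure M (ball z (4 * s)) / measure M (ball y r') *
          (C * (4 * s) * (?e / measure M (ball z (\<kappa> * (4 * s)))) powr (1 / p))"
        using energy[rule_format, of z "4 * \<kappa> * s"] Nball[of z "4 * \<kappa> * s"] s that
        by (intro mean_value_sub_ball[where K = 1] u uabs) (auto simp: mult_ac)
      also have "\<dots> \<le> D ^ n1 * Y"
      proof (rule mult_mono)
        have "measure M (ball z (4 * s)) \<le> D ^ n * measure M (ball y r')"
          using that by (intro measure_ball_compare)
        also have "\<dots> \<le> D ^ n1 * measure M (ball y r')"
          using that(4) by (intro mult_right_mono) auto
        finally show "measure M (ball z (4 * s)) / measure M (ball y r') \<le> D ^ n1"
          using measure_ball_pos[OF that(1)] by (simp add: divide_le_eq)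
        have "?\<mu> \<le> measure M (ball z (\<kappa> * (4 * s)))"
          using \<kappa>s s by (intro measure_mono_fmeasurable ball_fmeasurable subset_ball) auto
        then show "C * (4 * s) * (?e / measure M (ball z (\<kappa> * (4 * s)))) powr (1 / p) \<le> Y"
          unfolding Y_def using C_pos s p_gt_1 \<mu>
          by (intro mult_left_mono powr_mono2 divide_left_mono) auto
      qed (use D0 C_pos s in auto)
      finally show ?thesis .
    qed
    have "\<bar>mean_value M (ball z (s / 2)) u - 1\<bar> \<le> 0"
      using u1 s by (intro mean_value_near[OF um uabs]) auto
    then have mz: "\<bar>1 - ?m\<bar> \<le> D ^ n1 * Y"
      using mean[of "s / 2" z 3] n13 s by (auto simp: subset_ball)
    show "min ca cb * ?\<mu> / s powr p \<le> ?e"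
    proof (cases "1 / 4 \<le> D ^ n1 * Y")
      \<comment> \<open>A large oscillation already bounds the energy from below by a single use of
        the Poincare inequality; solving for \<open>?e\<close> gives \<open>ca\<close>.\<close>
      case True
      then have "1 / (16 * C * D ^ n1) / s \<le> (?e / ?\<mu>) powr (1 / p)"
        using s C_pos D0 by (simp add: Y_def field_simps)
      then have "(1 / (16 * C * D ^ n1) / s) powr p \<le> ((?e / ?\<mu>) powr (1 / p)) powr p"
        using p_gt_1 s C_pos D0 by (intro powr_mono2) auto
      also have "\<dots> = ?e / ?\<mu>" using p_gt_1 by (simp add: powr_powr)
      also have "(1 / (16 * C * D ^ n1) / s) powr p = ca / s powr p"
        unfolding ca_def using s C_pos D0 by (subst powr_divide) auto
      finally have "ca * ?\<mu> / s powr p \<le> ?e" using \<mu> by (simp add: field_simps)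
      moreover have "min ca cb * ?\<mu> / s powr p \<le> ca * ?\<mu> / s powr p"
        using \<mu> by (intro divide_right_mono mult_right_mono) auto
      ultimately show ?thesis by linarith
    next
      case False
      \<comment> \<open>The mean over \<open>B(z, s / 2)\<close> is 1, and both it and the mean at
        \<open>x\<close> differ from \<open>?m\<close> by less than 1/4.\<close>
      have big: "1 / 2 < mean_value M (ball x r0) u" if "x \<in> E" for x
      proof -
        have "\<bar>mean_value M (ball x r0) u - ?m\<bar> \<le> D ^ n1 * Y"
        proof (rule mean)
          show "ball x r0 \<subseteq> ball z (4 * s)" using Ez[OF that] r0 s by (intro ball_subset_ballI) linarith
          have "8 * s \<le> 2 ^ n1 * r0" using n1 s \<kappa>_ge_1 by (simp add: r0_def field_simps)
          then show "dist x z + 4 * s \<le> 2 ^ n1 * r0" using Ez[OF that] s by (simp add: dist_commute)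
        qed (use r0 in auto)
        then show ?thesis using False mz by linarith
      qed
      \<comment> \<open>At a good scale the energy pays for the ball's contribution to the content
        of codimension t, and the rate improves geometrically with \<open>j\<close>.\<close>
      let ?good = "\<lambda>x j. measure M (ball x (\<kappa> * r j)) / r j powr t
           \<le> s powr (p - t) / b powr p * \<phi> ^ j * measure N (ball x (\<kappa> * r j))"
      have ex: "\<exists>j. ?good x j" if x: "x \<in> E" for x
      proof -
        let ?N = "\<lambda>j. measure N (ball x (\<kappa> * r j))"
        let ?M = "\<lambda>j. measure M (ball x (\<kappa> * r j))"
        have "\<exists>j. \<theta> ^ j * (1 - \<theta>) / 4 \<le> D * (C * (r0 / 2 ^ j) * (?N j / measure M (ball x (\<kappa> * (r0 / 2 ^ j)))) powr (1 / p))"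
        proof (rule telescoping_level[OF u uabs _ r0(1) \<theta>(1,2) big[OF x]])
          show "u x = 0" using u0 x by (auto simp: E_def)
          show "(\<integral>\<^sup>+y\<in>ball x (\<kappa> * (r0 / 2 ^ j)). ennpowr (Lip u y) p \<partial>M) \<le> ennreal (?N j)" for j
            using energy[rule_format, OF sub[OF x, of j]] Nball[OF sub[OF x, of j]] by (simp add: r_def)
        qed auto
        then obtain j where j: "\<theta> ^ j * (1 - \<theta>) / 4 \<le> D * (C * r j * (?N j / ?M j) powr (1 / p))"
          unfolding r_def by blast
        have Mj: "0 < ?M j" using r \<kappa>_ge_1 by (intro measure_ball_pos) auto
        have "\<theta> ^ j * b / r j \<le> (?N j / ?M j) powr (1 / p)"
          using j D0 C_pos r(1)[of j] by (simp add: b_def field_simps)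
        then have "(\<theta> ^ j * b / r j) powr p \<le> ((?N j / ?M j) powr (1 / p)) powr p"
          using \<theta> b r(1)[of j] p_gt_1 by (intro powr_mono2) auto
        also have "\<dots> = ?N j / ?M j" using p_gt_1 by (simp add: powr_powr)
        also have "(\<theta> ^ j * b / r j) powr p = \<phi> ^ j * b powr p / r j powr p"
        proof -
          have "(\<theta> ^ j) powr p = (\<theta> powr p) ^ j"
            using \<theta> \<phi> by (metis powr_powr powr_realpow mult.commute)
          then show ?thesis using \<theta> b r(1)[of j] by (simp add: powr_divide powr_mult)
        qed
        finally have 1: "?M j * (\<phi> ^ j * b powr p / r j powr p) \<le> ?N j"
          using Mj by (simp add: field_simps)
        \<comment> \<open>The full gap p - t gives two factors \<open>\<phi> ^ j\<close>; one of
          them cancels the loss from the telescoping.\<close>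
        have "r j powr (p - t) \<le> s powr (p - t) * (\<phi> ^ j) ^ 2"
        proof -
          have "r j powr (p - t) = r0 powr (p - t) / (2 ^ j) powr (2 * \<delta>)"
            using r0 \<delta> by (simp add: r_def powr_divide)
          also have "(2 ^ j) powr (2 * \<delta>) = 1 / (\<phi> ^ j) ^ 2"
            by (simp add: \<phi>_def powr_powr powr_minus field_simps flip: powr_realpow powr_add)
          also have "r0 powr (p - t) / (1 / (\<phi> ^ j) ^ 2) = r0 powr (p - t) * (\<phi> ^ j) ^ 2" by simp
          also have "\<dots> \<le> s powr (p - t) * (\<phi> ^ j) ^ 2"
            using r0 t by (intro mult_right_mono powr_mono2) auto
          finally show ?thesis .
        qed
        then have 2: "r j powr (p - t) / \<phi> ^ j \<le> s powr (p - t) * \<phi> ^ j"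
          using \<phi> by (simp add: divide_le_eq power2_eq_square mult.assoc)
        have "?M j / r j powr t = (?M j * (\<phi> ^ j * b powr p / r j powr p)) * (r j powr (p - t) / \<phi> ^ j) / b powr p"
          using \<phi> b r(1)[of j] by (simp add: powr_diff)
        also have "\<dots> \<le> ?N j * (s powr (p - t) * \<phi> ^ j) / b powr p"
          using 1 2 \<phi> by (intro divide_right_mono mult_mono) auto
        finally have "?good x j" by (simp add: mult_ac)
        then show ?thesis ..
      qed
      define Ej where "Ej = (\<lambda>j. {x \<in> E. ?good x j})"
      \<comment> \<open>This separation keeps the balls of radius \<kappa> r_j disjoint, so their
        energies add up to at most \<open>?e\<close>, while the balls of twice that radius cover
        \<open>Ej j\<close>.\<close>
      have "\<exists>A. finite A \<and> A \<subseteq> Ej j \<and> separated (2 * (\<kappa> * r j)) A \<and> Ej j \<subseteq> (\<Union>x\<in>A. ball x (2 * (\<kappa> * r j)))" for j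
      proof -
        have pos: "0 < 2 * (\<kappa> * r j)" using r \<kappa>_ge_1 by simp
        obtain n where "(4 * s + 2 * (\<kappa> * r j)) / (2 * (\<kappa> * r j)) < 2 ^ n"
          using real_arch_pow[of 2] by auto
        then have n: "4 * s + 2 * (\<kappa> * r j) \<le> 2 ^ n * (2 * (\<kappa> * r j))"
          using pos by (simp add: divide_less_eq mult_ac)
        have "Ej j \<subseteq> ball w s" using s by (auto simp: Ej_def E_def)
        then show ?thesis using ex_separated_net[OF _ pos s n] by metis
      qed
      then obtain A where A: "\<And>j. finite (A j)" "\<And>j. A j \<subseteq> Ej j" "\<And>j. separated (2 * (\<kappa> * r j)) (A j)"
        "\<And>j. Ej j \<subseteq> (\<Union>x\<in>A j. ball x (2 * (\<kappa> * r j)))" by metis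
      let ?\<rho> = "\<lambda>j. 2 * (\<kappa> * r j)"
      let ?K = "D * s powr (p - t) / b powr p * ?e"
      have \<rho>: "0 < ?\<rho> j" "?\<rho> j \<le> s / 2" "r j \<le> ?\<rho> j" for j
      proof -
        show "0 < ?\<rho> j" using r[of j] \<kappa>_ge_1 by simp
        have "\<kappa> * r j \<le> \<kappa> * r0" using r(2) \<kappa>_ge_1 by (intro mult_left_mono) auto
        then show "?\<rho> j \<le> s / 2" using r0(2) by simp
        have "1 * r j \<le> (2 * \<kappa>) * r j" using r(1)[of j] \<kappa>_ge_1 by (intro mult_right_mono) auto
        then show "r j \<le> ?\<rho> j" by simp
      qed
      have level: "(\<Sum>x\<in>A j. measure M (ball x (?\<rho> j)) / ?\<rho> j powr t) \<le> ?K * \<phi> ^ j" for j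
      proof -
        have "(\<Sum>x\<in>A j. measure M (ball x (?\<rho> j)) / ?\<rho> j powr t)
            \<le> (\<Sum>x\<in>A j. D * s powr (p - t) / b powr p * \<phi> ^ j * measure N (ball x (\<kappa> * r j)))"
        proof (rule sum_mono)
          fix x assume x: "x \<in> A j"
          have "measure M (ball x (?\<rho> j)) / ?\<rho> j powr t \<le> (D * measure M (ball x (\<kappa> * r j))) / r j powr t"
            using \<rho>[of j] r(1)[of j] t \<kappa>_ge_1
            by (intro frac_le powr_mono2 measure_ball_double) (auto simp: D0 less_imp_le)
          also have "\<dots> = D * (measure M (ball x (\<kappa> * r j)) / r j powr t)" by simp
          also have "\<dots> \<le> D * (s powr (p - t) / b powr p * \<phi> ^ j * measure N (ball x (\<kappa> * r j)))"
            using x A(2) D0 by (intro mult_left_mono) (auto simp: Ej_def)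
          finally show "measure M (ball x (?\<rho> j)) / ?\<rho> j powr t
            \<le> D * s powr (p - t) / b powr p * \<phi> ^ j * measure N (ball x (\<kappa> * r j))" by (simp add: mult_ac)
        qed
        also have "\<dots> = D * s powr (p - t) / b powr p * \<phi> ^ j * (\<Sum>x\<in>A j. measure N (ball x (\<kappa> * r j)))"
          by (simp add: sum_distrib_left)
        also have "(\<Sum>x\<in>A j. measure N (ball x (\<kappa> * r j))) = measure N (\<Union>x\<in>A j. ball x (\<kappa> * r j))"
        proof (rule measure_finite_Union[symmetric])
          show "disjoint_family_on (\<lambda>x. ball x (\<kappa> * r j)) (A j)"
            by (rule separated_disjoint_balls) (rule A(3))
          fix x assume "x \<in> A j"
          then have "x \<in> E" using A(2) by (auto simp: Ej_def)
          then show "emeasure N (ball x (\<kappa> * r j)) \<noteq> \<infinity>" using Nball[OF sub] by simp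
        qed (use A(1) setsN in auto)
        finally have le: "(\<Sum>x\<in>A j. measure M (ball x (?\<rho> j)) / ?\<rho> j powr t)
            \<le> D * s powr (p - t) / b powr p * \<phi> ^ j * measure N (\<Union>x\<in>A j. ball x (\<kappa> * r j))" .
        have "measure N (\<Union>x\<in>A j. ball x (\<kappa> * r j)) \<le> ?e"
        proof (rule measure_mono_fmeasurable)
          show "(\<Union>x\<in>A j. ball x (\<kappa> * r j)) \<subseteq> ?B" using sub A(2) by (fastforce simp: Ej_def)
        qed (use A(1) setsN finN in \<open>auto intro!: fmeasurableI\<close>)
        then have "D * s powr (p - t) / b powr p * \<phi> ^ j * measure N (\<Union>x\<in>A j. ball x (\<kappa> * r j))
            \<le> D * s powr (p - t) / b powr p * \<phi> ^ j * ?e"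
          using D0 \<phi> by (intro mult_left_mono) auto
        also have "\<dots> = ?K * \<phi> ^ j" by simp
        finally show ?thesis using le by linarith
      qed
      have "codim_content M t (s / 2) E \<le> (\<Sum>j. \<Sum>x\<in>A j. emeasure M (ball x (?\<rho> j)) / ennreal (?\<rho> j powr t))"
      proof (rule codim_content_le_suminf)
        show "E \<subseteq> (\<Union>j. \<Union>x\<in>A j. ball x (?\<rho> j))" using A(4) ex by (fastforce simp: Ej_def)
      qed (use A(1) \<rho> in auto)
      also have "\<dots> \<le> (\<Sum>j. ennreal (?K * \<phi> ^ j))"
      proof (rule suminf_le)
        fix j
        have "(\<Sum>x\<in>A j. emeasure M (ball x (?\<rho> j)) / ennreal (?\<rho> j powr t)) =
            ennreal (\<Sum>x\<in>A j. measure M (ball x (?\<rho> j)) / ?\<rho> j powr t)"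
        proof (subst sum_ennreal[symmetric])
          show "(\<Sum>x\<in>A j. emeasure M (ball x (?\<rho> j)) / ennreal (?\<rho> j powr t)) =
            (\<Sum>x\<in>A j. ennreal (measure M (ball x (?\<rho> j)) / ?\<rho> j powr t))"
            using \<rho>(1)[of j] unfolding emeasure_ball by (intro sum.cong divide_ennreal) auto
        qed auto
        also have "\<dots> \<le> ennreal (?K * \<phi> ^ j)" by (intro ennreal_leI level)
        finally show "(\<Sum>x\<in>A j. emeasure M (ball x (?\<rho> j)) / ennreal (?\<rho> j powr t)) \<le> ennreal (?K * \<phi> ^ j)" .
      qed auto
      also have "\<dots> = ennreal (?K * (1 / (1 - \<phi>)))"
        using \<phi> D0 geometric_sums[of \<phi>] by (intro suminf_ennreal_eq sums_mult) auto
      finally have cont: "codim_content M t (s / 2) E \<le> ennreal (?K * (1 / (1 - \<phi>)))" .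
      have "ennreal (c0 * measure M (ball w (s / 2)) / (s / 2) powr t)
          = ennreal c0 * emeasure M (ball w (s / 2)) / ennreal ((s / 2) powr t)"
        using c0 s by (simp add: emeasure_ball divide_ennreal flip: ennreal_mult)
      also have "\<dots> \<le> ennreal (?K * (1 / (1 - \<phi>)))"
        using content cont by (simp add: E_def)
      finally have "c0 * measure M (ball w (s / 2)) / (s / 2) powr t \<le> ?K * (1 / (1 - \<phi>))"
        by (subst (asm) ennreal_le_iff) (use D0 \<phi> in auto)
      moreover have "c0 * ?\<mu> / D ^ 3 / s powr t \<le> c0 * measure M (ball w (s / 2)) / (s / 2) powr t"
      proof (rule frac_le)
        have "?\<mu> \<le> D ^ 3 * measure M (ball w (s / 2))"
          using s zw by (intro measure_ball_compare) (auto simp: dist_commute)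
        then show "c0 * ?\<mu> / D ^ 3 \<le> c0 * measure M (ball w (s / 2))"
          using c0 D0 by (simp add: divide_le_eq mult_ac)
      qed (use s c0 t in \<open>auto intro!: powr_mono2\<close>)
      ultimately have "c0 * ?\<mu> / D ^ 3 / s powr t \<le> D * s powr (p - t) / b powr p * ?e / (1 - \<phi>)" by simp
      also have "\<dots> = (D * s powr p / b powr p * ?e / (1 - \<phi>)) / s powr t"
        by (simp add: powr_diff)
      finally have "c0 * ?\<mu> / D ^ 3 \<le> D * s powr p / b powr p * ?e / (1 - \<phi>)"
        using s by (subst (asm) divide_le_cancel) auto
      then have "cb * ?\<mu> / s powr p \<le> ?e"
        using s D0 \<phi> b by (simp add: cb_def powr_diff field_simps power_Suc numeral_eq_Suc)
      moreover have "min ca cb * ?\<mu> / s powr p \<le> cb * ?\<mu> / s powr p"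
        using \<mu> by (intro divide_right_mono mult_right_mono) auto
      ultimately show ?thesis by linarith
    qed
  qed (use ca cb in simp)
qed

end

section \<open>Branching\<close>

lemma Lip_le:
  assumes "0 < e" "\<And>y. dist x y < e \<Longrightarrow> \<bar>u x - u y\<bar> \<le> K * dist x y" "0 \<le> K"
  shows "Lip u x \<le> ennreal K"
  unfolding Lip_def
proof (rule Limsup_bounded)
  have "(SUP y\<in>ball x r. ennreal (\<bar>u x - u y\<bar> / dist x y)) \<le> ennreal K" if "0 < r" "r < e" for r
  proof (rule SUP_least)
    fix y assume "y \<in> ball x r"
    then have "\<bar>u x - u y\<bar> \<le> K * dist x y" using that assms(2)[of y] by simp
    then show "ennreal (\<bar>u x - u y\<bar> / dist x y) \<le> ennreal K"
      using assms(3) by (intro ennreal_leI) (cases "x = y"; simp add: divide_le_eq)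
  qed
  then show "\<forall>\<^sub>F r in at_right 0. (SUP y\<in>ball x r. ennreal (\<bar>u x - u y\<bar> / dist x y)) \<le> ennreal K"
    unfolding eventually_at_right_field using assms(1) by blast
qed

lemma geodesic_point:
  assumes "geodesic_space TYPE('a::metric_space)" "0 \<le> \<rho>" "\<rho> \<le> dist x (y::'a)"
  obtains v where "dist x v = \<rho>" "dist v y = dist x y - \<rho>"
proof -
  obtain \<gamma> where g: "path \<gamma>" "pathstart \<gamma> = x" "pathfinish \<gamma> = y"
     "\<And>\<tau>. \<tau> \<in> {0..1} \<Longrightarrow> dist x (\<gamma> \<tau>) + dist (\<gamma> \<tau>) y = dist x y"
    using geodesicE[OF assms(1)] by metis
  have "continuous_on {0..1} (\<lambda>\<tau>. dist x (\<gamma> \<tau>))"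
    using g(1) unfolding path_def by (intro continuous_intros)
  then obtain \<tau> where "\<tau> \<in> {0..1}" "dist x (\<gamma> \<tau>) = \<rho>"
    using IVT'[of "\<lambda>\<tau>. dist x (\<gamma> \<tau>)" 0 \<rho> 1] assms g(2,3)
    by (auto simp: pathstart_def pathfinish_def)
  then show ?thesis using g(4)[of \<tau>] by (intro that[of "\<gamma> \<tau>"]) auto
qed

lemma near_frontier_point:
  assumes "geodesic_space TYPE('a::metric_space)" "\<Omega> \<noteq> UNIV" "(z::'a) \<in> \<Omega>" "compl_dist \<Omega> z < \<rho>"
  obtains w where "w \<in> frontier \<Omega>" "dist z w < \<rho>"
proof -
  obtain a where a: "a \<in> - \<Omega>" "dist z a < \<rho>"
    using assms(2,4) cInf_lessD[of "dist z ` (- \<Omega>)" \<rho>]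
    unfolding compl_dist_def by (subst (asm) infdist_notempty) auto
  obtain \<gamma> where g: "path \<gamma>" "pathstart \<gamma> = z" "pathfinish \<gamma> = a"
     "\<And>\<tau>. \<tau> \<in> {0..1} \<Longrightarrow> dist z (\<gamma> \<tau>) + dist (\<gamma> \<tau>) a = dist z a"
    using geodesicE[OF assms(1)] by metis
  have "z \<in> path_image \<gamma>" "a \<in> path_image \<gamma>"
    using pathstart_in_path_image[of \<gamma>] pathfinish_in_path_image[of \<gamma>] g(2,3) by auto
  then have "path_image \<gamma> \<inter> frontier \<Omega> \<noteq> {}"
    using connected_path_image[OF g(1)] a(1) assms(3) by (intro connected_Int_frontier) auto
  then obtain \<tau> where "\<tau> \<in> {0..1}" "\<gamma> \<tau> \<in> frontier \<Omega>" unfolding path_image_def by blast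
  then show ?thesis using g(4)[of \<tau>] a(2) zero_le_dist[of "\<gamma> \<tau>" a]
    by (intro that[of "\<gamma> \<tau>"]) linarith+
qed

lemma compl_dist_frontier:
  assumes "open \<Omega>" "w \<in> frontier \<Omega>"
  shows "compl_dist \<Omega> w = 0"
  using assms unfolding compl_dist_def by (auto simp: frontier_def interior_open)

text \<open>It makes the content condition applicable at radius
  \<open>compl_dist \<Omega> z / 2\<close> when \<Omega> is bounded. A geodesic towards the frontier
  still lies in \<Omega> at 3/4 of that distance, which leaves the strict inequality.\<close>

lemma half_compl_dist_less_diameter:
  assumes "geodesic_space TYPE('a::metric_space)" "open \<Omega>" "\<Omega> \<noteq> UNIV" "(z::'a) \<in> \<Omega>" "bounded \<Omega>"
  shows "compl_dist \<Omega> z / 2 < diameter \<Omega>"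
proof -
  let ?s = "compl_dist \<Omega> z"
  have s: "0 < ?s" using assms by (intro compl_dist_pos)
  obtain w where w: "w \<in> frontier \<Omega>" using near_frontier_point[OF assms(1,3,4), of "?s + 1"] by auto
  have "?s \<le> dist z w"
    using compl_dist_lipschitz[of \<Omega> z w] compl_dist_frontier[OF assms(2) w] by simp
  then obtain v where v: "dist z v = 3 / 4 * ?s"
    using geodesic_point[OF assms(1), of "3 / 4 * ?s" z w] s by auto
  then have "v \<in> \<Omega>" using ball_compl_dist_subset[of z \<Omega>] s by auto
  then have "dist z v \<le> diameter \<Omega>" using assms by (intro diameter_bounded_bound) auto
  then show ?thesis using v s by linarith
qed

lemma ln_lipschitz:
  assumes "0 < K" "K \<le> \<alpha>" "K \<le> \<beta>"
  shows "\<bar>ln \<alpha> - ln \<beta>\<bar> \<le> \<bar>\<alpha> - \<beta>\<bar> / (K::real)"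
proof -
  have *: "ln \<alpha> - ln \<beta> \<le> \<bar>\<alpha> - \<beta>\<bar> / K" if "K \<le> \<alpha>" "K \<le> \<beta>" for \<alpha> \<beta> :: real
  proof -
    have "ln \<alpha> - ln \<beta> = ln (\<alpha> / \<beta>)" using that assms(1) by (simp add: ln_div)
    also have "\<dots> \<le> \<alpha> / \<beta> - 1" using that assms(1) by (intro ln_le_minus_one) simp
    also have "\<dots> = (\<alpha> - \<beta>) / \<beta>" using that assms(1) by (simp add: field_simps)
    also have "\<dots> \<le> \<bar>\<alpha> - \<beta>\<bar> / K" using that assms(1) by (intro frac_le) auto
    finally show ?thesis .
  qed
  from *[OF assms(2,3)] *[OF assms(3,2)] show ?thesis by (simp add: abs_minus_commute abs_le_iff)
qed

text \<open>Cutting off outside \<open>V\<close> creates no jump: within distance \<eta> of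
  \<open>V\<close> every point outside \<open>V\<close> is a zero of \<open>\<psi>\<close>.\<close>

lemma locally_lipschitz_cut:
  assumes V: "\<And>x y. x \<in> V \<Longrightarrow> \<psi> y \<noteq> 0 \<Longrightarrow> dist x y < \<eta> \<Longrightarrow> y \<in> V" and \<eta>: "0 < \<eta>"
    and \<psi>: "\<And>x y. \<bar>\<psi> x - \<psi> y\<bar> \<le> L * dist x y" and L: "0 \<le> L"
  shows "locally_lipschitz (\<lambda>x. if x \<in> V then \<psi> x else 0)" (is "locally_lipschitz ?u")
  unfolding locally_lipschitz_def
proof (intro allI exI conjI)
  fix x
  show "0 < \<eta> / 2" using \<eta> by simp
  show "L-lipschitz_on (ball x (\<eta> / 2)) ?u"
  proof (rule lipschitz_onI)
    fix y y' assume y: "y \<in> ball x (\<eta> / 2)" "y' \<in> ball x (\<eta> / 2)"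
    have "dist y y' < \<eta>" using y dist_triangle_less_add[of y x "\<eta> / 2" y' "\<eta> / 2"] by (simp add: dist_commute)
    then have "\<bar>?u y - ?u y'\<bar> \<le> L * dist y y'"
      using V[of y y'] V[of y' y] \<psi>[of y y'] L
      by (cases "\<psi> y = 0"; cases "\<psi> y' = 0") (auto simp: dist_commute)
    then show "dist (?u y) (?u y') \<le> L * dist y y'" by (simp add: dist_real_def)
  qed (rule L)
qed

lemma reaches_mono: "reaches d L \<delta> x y \<Longrightarrow> L \<le> L' \<Longrightarrow> reaches d L' \<delta> x y"
  unfolding reaches_def by (blast intro: ennreal_leI order_trans)

lemma reaches_relpow:
  assumes step: "\<And>a b. (a, b) \<in> E \<Longrightarrow> reaches d L \<delta> a b" and refl: "reaches d 0 \<delta> a a"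
    and L: "0 \<le> L" and ab: "(a, b) \<in> E ^^ i"
  shows "reaches d (real i * L) \<delta> a b"
  using ab
proof (induction i arbitrary: b)
  case (Suc i)
  then obtain c where "(a, c) \<in> E ^^ i" "(c, b) \<in> E" by auto
  then show ?case
    using reaches_trans[OF Suc.IH step, of c b] L by (simp add: algebra_simps)
qed (use refl in simp)

context poincare_measure
begin

text \<open>The left side is of order k^(1 - p), which tends to zero because p > 1. The denominator
  has k - 1 since the logarithm climbs only from s / 2^k to s / 2.\<close>

lemma branch_scale_exists:
  assumes "0 < c" "0 \<le> K"
  obtains k where "2 \<le> k" "K * real k * (1 / (real (k - 1) * ln 2)) powr p < c"
proof -
  define X where "X = 2 * K / ((ln 2) powr p * c)"
  have X: "0 \<le> X" using assms by (simp add: X_def)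
  obtain n :: nat where n: "X powr (1 / (p - 1)) < real n" using reals_Archimedean2 by blast
  then have n1: "1 \<le> n" by (metis not_less_eq_eq le0 le_antisym less_le_not_le of_nat_0 One_nat_def powr_ge_zero)
  have "X = (X powr (1 / (p - 1))) powr (p - 1)" using X p_gt_1 by (simp add: powr_powr)
  also have "\<dots> < real n powr (p - 1)" using n p_gt_1 by (intro powr_less_mono2) auto
  finally have "X < real n powr p / real n" using n1 by (simp add: powr_diff)
  then have 1: "2 * K * real n < c * ((ln 2) powr p * real n powr p)"
    using n1 assms by (simp add: X_def field_simps)
  have "K * real (Suc n) \<le> K * (2 * real n)" using n1 assms by (intro mult_left_mono) auto
  with 1 have "K * real (Suc n) < c * ((ln 2) powr p * real n powr p)" by simp
  then have "K * real (Suc n) * (1 / (real (Suc n - 1) * ln 2)) powr p < c"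
    using n1 by (simp add: powr_divide powr_mult field_simps)
  then show ?thesis using n1 by (intro that[of "Suc n"]) auto
qed

end

text \<open>The energy of the logarithmic cutoff spreads over \<open>k\<close> dyadic scales with a factor \<open>k\<^sup>-\<^sup>p\<close> at each,
  so one scale must beat the capacity bound by a factor of order \<open>k\<^sup>p\<^sup>-\<^sup>1\<close>. This replaces the
  self-improvement of the Poincare inequality.\<close>

lemma (in poincare_measure) branching:
  fixes \<Omega> :: "'a set"
  defines "d \<equiv> compl_dist \<Omega>"
  defines "q \<equiv> \<lambda>z. measure M (ball z (d z)) / d z powr p"
  assumes geo: "geodesic_space TYPE('a)" and \<Omega>: "open \<Omega>" "\<Omega> \<noteq> UNIV"
    and t: "0 < t" "t < p" and c0: "0 < c0"
    and content: "\<And>w \<rho>. w \<in> frontier \<Omega> \<Longrightarrow> 0 < \<rho> \<Longrightarrow> (bounded \<Omega> \<Longrightarrow> \<rho> < diameter \<Omega>) \<Longrightarrow>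
           codim_content M t \<rho> (ball w \<rho> \<inter> frontier \<Omega>)
             \<ge> ennreal c0 * emeasure M (ball w \<rho>) / ennreal (\<rho> powr t)"
  shows "\<exists>L>0. \<exists>\<delta>>0. \<forall>z\<in>\<Omega>. \<exists>Y \<sigma>. finite Y \<and> \<delta> * d z \<le> \<sigma> \<and> \<sigma> \<le> d z / 2 \<and>
    (\<forall>y\<in>Y. \<sigma> / 2 < d y \<and> d y \<le> \<sigma> \<and> dist z y \<le> 4 * \<kappa> * d z \<and> reaches d (L * d z) (\<delta> * d z) z y) \<and>
    separated (5 * (4 * \<kappa>) * \<sigma>) Y \<and> q z \<le> (\<Sum>y\<in>Y. q y)"
proof -
  obtain c where c: "0 < c" and cap: "\<And>z s w F u N. 0 < s \<Longrightarrow> dist z w < 2 * s \<Longrightarrow> locally_lipschitz u \<Longrightarrow>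
    (\<forall>x. 0 \<le> u x \<and> u x \<le> 1) \<Longrightarrow> (\<forall>x\<in>ball z (s / 2). u x = 1) \<Longrightarrow> (\<forall>x\<in>F. u x = 0) \<Longrightarrow>
    ennreal c0 * emeasure M (ball w (s / 2)) / ennreal ((s / 2) powr t)
      \<le> codim_content M t (s / 2) (ball w (s / 2) \<inter> F) \<Longrightarrow>
    sets N = sets borel \<Longrightarrow> emeasure N (ball z (4 * \<kappa> * s)) < \<infinity> \<Longrightarrow>
    (\<forall>y r. ball y r \<subseteq> ball z (4 * \<kappa> * s) \<longrightarrow>
       (\<integral>\<^sup>+x\<in>ball y r. ennpowr (Lip u x) p \<partial>M) \<le> emeasure N (ball y r)) \<Longrightarrow>
    c * measure M (ball z s) / s powr p \<le> measure N (ball z (4 * \<kappa> * s))"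
    using capacity_lower_bound[OF t c0] by blast
  define \<Lambda> where "\<Lambda> = 4 * \<kappa>"
  have \<Lambda>: "4 \<le> \<Lambda>" using \<kappa>_ge_1 by (simp add: \<Lambda>_def)
  \<comment> \<open>Net balls at scale j have radius at most 10 \<Lambda> d(y). \<open>K\<close> is
    the price of such a ball relative to \<open>q y\<close>, up to the slope factor
    \<open>a powr p\<close>.\<close>
  obtain nA where "10 * \<Lambda> < 2 ^ nA" using real_arch_pow[of 2 "10 * \<Lambda>"] by auto
  then have nA: "10 * \<Lambda> \<le> 2 ^ nA" by simp
  have D0: "0 < D" using D_ge_1 by simp
  define K where "K = 4 powr p * D ^ nA"
  have K: "0 \<le> K" using D0 by (simp add: K_def)
  obtain k where k: "2 \<le> k" and kc: "K * real k * (1 / (real (k - 1) * ln 2)) powr p < c"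
    using branch_scale_exists[OF c K] .
  define a where "a = 1 / (real (k - 1) * ln 2)"
  have a: "0 < a" using k by (simp add: a_def)
  \<comment> \<open>\<open>D ^ n\<close> will bound the cardinality of an \<eta>-net of
    \<open>B(z, 2 R)\<close>. A chain in the net then needs at most \<open>D ^ n * D ^ n\<close>
    edges and two end pieces, which explains \<open>L\<close>; the curves keep distance m / 4 = s /
    (4 * 2^k), which explains \<open>\<delta>\<close>.\<close>
  obtain n where "96 * \<Lambda> * 2 ^ k + 1 < 2 ^ n" using real_arch_pow[of 2 "96 * \<Lambda> * 2 ^ k + 1"] by auto
  then have n: "96 * \<Lambda> * 2 ^ k + 1 \<le> 2 ^ n" by simp
  define L where "L = D ^ n * D ^ n + 2"
  define \<delta> where "\<delta> = 1 / (4 * 2 ^ k :: real)"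
  have L\<delta>: "0 < L" "0 < \<delta>" using D0 by (auto simp: L_def \<delta>_def add_pos_pos)
  have "\<exists>Y \<sigma>. finite Y \<and> \<delta> * d z \<le> \<sigma> \<and> \<sigma> \<le> d z / 2 \<and>
      (\<forall>y\<in>Y. \<sigma> / 2 < d y \<and> d y \<le> \<sigma> \<and> dist z y \<le> 4 * \<kappa> * d z \<and> reaches d (L * d z) (\<delta> * d z) z y) \<and>
      separated (5 * (4 * \<kappa>) * \<sigma>) Y \<and> q z \<le> (\<Sum>y\<in>Y. q y)" if z: "z \<in> \<Omega>" for z
  proof -
    define s where "s = d z"
    define R where "R = \<Lambda> * s"
    define m where "m = s / 2 ^ k"
    define \<eta> where "\<eta> = m / 12"
    have s: "0 < s" unfolding s_def d_def using \<Omega> z by (intro compl_dist_pos)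
    have R: "0 < R" "4 * s \<le> R" using s \<Lambda> by (auto simp: R_def)
    have m: "0 < m" using s by (simp add: m_def)
    have "(2::real) ^ 2 \<le> 2 ^ k" using k by (intro power_increasing) auto
    then have m4: "m \<le> s / 4" using s unfolding m_def by (intro divide_left_mono) auto
    have \<eta>: "0 < \<eta>" using m by (simp add: \<eta>_def)
    have dlip: "\<bar>d x - d y\<bar> \<le> dist x y" for x y unfolding d_def by (rule compl_dist_lipschitz)
    have d0: "0 \<le> d x" for x by (simp add: d_def)
    \<comment> \<open>The threshold is m / 2, although the cutoff will vanish wherever d \<le> m:
      this margin lets a neighbour of the support still belong to \<open>W\<close>.\<close>
    define W where "W = {x. m / 2 < d x \<and> dist x z < 2 * R}"
    have "4 * (2 * R) + \<eta> = \<eta> * (96 * \<Lambda> * 2 ^ k + 1)"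
      using s by (simp add: \<eta>_def m_def R_def field_simps)
    also have "\<dots> \<le> \<eta> * 2 ^ n" using n \<eta> by (intro mult_left_mono) auto
    finally have nn: "4 * (2 * R) + \<eta> \<le> 2 ^ n * \<eta>" by (simp add: mult.commute)
    have "W \<subseteq> ball z (2 * R)" by (auto simp: W_def dist_commute)
    then obtain A where A: "finite A" "A \<subseteq> W" "W \<subseteq> (\<Union>x\<in>A. ball x \<eta>)" "real (card A) \<le> D ^ n"
    proof (rule ex_separated_net[OF _ \<eta> _ nn])
      show "0 < 2 * R" using R by simp
    qed
    define E where "E = {(a, b). a \<in> A \<and> b \<in> A \<and> dist a b < 3 * \<eta>}"
    have EA: "E \<subseteq> A \<times> A" by (auto simp: E_def)
    have "z \<in> W" using m m4 s R by (auto simp: W_def s_def)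
    then obtain a0 where a0: "a0 \<in> A" "dist a0 z < \<eta>" using A(3) by fastforce
    \<comment> \<open>Reachability is discretised by the finite graph \<open>E\<close> on the net. A
      connected component alone would not bound the length of connecting curves uniformly in
      \<open>z\<close>.\<close>
    define V where "V = {x \<in> W. \<exists>b\<in>A. dist b x < \<eta> \<and> (a0, b) \<in> E\<^sup>*}"
    have zV: "z \<in> V" using \<open>z \<in> W\<close> a0 by (auto simp: V_def)
    have VW: "V \<subseteq> W" by (auto simp: V_def)
    have V_closed: "y \<in> V" if xV: "x \<in> V" and yW: "y \<in> W" and xy: "dist x y < \<eta>" for x y
    proof -
      obtain b where b: "b \<in> A" "dist b x < \<eta>" "(a0, b) \<in> E\<^sup>*" using xV by (auto simp: V_def)
      obtain b' where b': "b' \<in> A" "dist b' y < \<eta>" using A(3) yW by fastforce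
      have "dist b b' < 3 * \<eta>"
        using b b' xy dist_triangle[of b b' x] dist_triangle[of x b' y] by (simp add: dist_commute)
      then have "(b, b') \<in> E" using b b' by (auto simp: E_def)
      then show ?thesis using b b' yW by (auto simp: V_def intro: rtrancl_into_rtrancl)
    qed
    have step: "reaches d (3 * \<eta>) (m / 4) x y" if "x \<in> W" "dist x y < 3 * \<eta>" for x y
    proof -
      have "reaches d (dist x y) (m / 4) x y"
      proof (rule reaches_geodesic[OF geo])
        fix v assume "dist x v \<le> dist x y"
        then show "m / 4 \<le> d v" using that dlip[of x v] by (auto simp: W_def \<eta>_def)
      qed
      then show ?thesis using that(2) by (elim reaches_mono) simp
    qed
    have reach: "reaches d (L * s) (\<delta> * s) z y" if y: "y \<in> V" for y
    proof -
      obtain b where b: "b \<in> A" "dist b y < \<eta>" "(a0, b) \<in> E\<^sup>*" using y by (auto simp: V_def)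
      have finE: "finite E" using EA A(1) finite_subset by auto
      then obtain i where i: "i \<le> card E" "(a0, b) \<in> E ^^ i"
        using b(3) by (auto simp: rtrancl_finite_eq_relpow)
      have W: "a0 \<in> W" "b \<in> W" using a0 b A(2) by auto
      have "reaches d (real i * (3 * \<eta>)) (m / 4) a0 b"
      proof (rule reaches_relpow[OF _ _ _ i(2)])
        show "reaches d (3 * \<eta>) (m / 4) x x'" if "(x, x') \<in> E" for x x'
          using that A(2) by (intro step) (auto simp: E_def)
        show "reaches d 0 (m / 4) a0 a0"
          using reaches_geodesic[OF geo, of a0 a0 "m / 4" d] W m by (auto simp: W_def)
      qed (use \<eta> in simp)
      then have "reaches d (3 * \<eta> + real i * (3 * \<eta>)) (m / 4) z b"
        using a0 \<open>z \<in> W\<close> \<eta> by (intro reaches_trans[OF step]) (auto simp: dist_commute)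
      then have r: "reaches d (3 * \<eta> + real i * (3 * \<eta>) + 3 * \<eta>) (m / 4) z y"
        using b W \<eta> by (elim reaches_trans[OF _ step]) auto
      have "real i \<le> real (card A) * real (card A)"
        using i(1) card_mono[OF _ EA] A(1) by (simp add: card_cartesian_product flip: of_nat_mult)
      also have "\<dots> \<le> D ^ n * D ^ n" using A(4) D0 by (intro mult_mono) auto
      finally have "(real i + 2) * (3 * \<eta>) \<le> L * s"
        using \<eta> m4 m s D0 by (intro mult_mono) (auto simp: L_def \<eta>_def)
      with r show ?thesis by (elim reaches_mono[where L' = "L * s", rotated])
        (simp add: \<delta>_def m_def algebra_simps)
    qed
    define l where "l = (\<lambda>x. ln (max (d x) m) - ln m)"
    \<comment> \<open>The second argument of the minimum confines the support to
      \<open>B(z, 2 R)\<close>, where the net lives. It is at least 1 in \<open>B(z, R)\<close>, so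
      only the logarithm contributes to the energy there.\<close>
    define \<psi> where "\<psi> = (\<lambda>x. max 0 (min 1 (min (a * l x) ((2 * R - dist x z) / R))))"
    define u where "u = (\<lambda>x. if x \<in> V then \<psi> x else 0)"
    have l_lip: "\<bar>l x - l y\<bar> \<le> dist x y / \<tau>" if "0 < \<tau>" "\<tau> \<le> max (d x) m" "\<tau> \<le> max (d y) m" for x y \<tau>
    proof -
      have "\<bar>l x - l y\<bar> \<le> \<bar>max (d x) m - max (d y) m\<bar> / \<tau>"
        unfolding l_def using ln_lipschitz[OF that] by simp
      also have "\<dots> \<le> dist x y / \<tau>"
        using dlip[of x y] that(1) by (intro divide_right_mono) auto
      finally show ?thesis .
    qed
    have \<psi>lip: "\<bar>\<psi> x - \<psi> y\<bar> \<le> (a / m + 1 / R) * dist x y" for x y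
    proof -
      have "\<bar>a * l x - a * l y\<bar> = a * \<bar>l x - l y\<bar>"
        using a by (simp add: abs_mult flip: right_diff_distrib)
      also have "\<dots> \<le> a * (dist x y / m)"
        using l_lip[of m x y] m a by (intro mult_left_mono) auto
      finally have "\<bar>a * l x - a * l y\<bar> \<le> a * (dist x y / m)" .
      moreover have "\<bar>(2 * R - dist x z) / R - (2 * R - dist y z) / R\<bar> \<le> dist x y / R"
      proof -
        have "\<bar>dist y z - dist x z\<bar> \<le> dist x y"
          using dist_triangle[of x z y] dist_triangle[of y z x] by (simp add: dist_commute abs_le_iff)
        then show ?thesis using R by (simp add: divide_right_mono flip: diff_divide_distrib)
      qed
      moreover have "0 \<le> a * (dist x y / m)" "0 \<le> dist x y / R" using a m R by auto
      ultimately have "\<bar>\<psi> x - \<psi> y\<bar> \<le> a * (dist x y / m) + dist x y / R"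
        unfolding \<psi>_def by linarith
      then show ?thesis by (simp add: algebra_simps)
    qed
    have \<psi>W: "x \<in> W \<and> m < d x" if "\<psi> x \<noteq> 0" for x
    proof -
      have "0 < a * l x" "0 < (2 * R - dist x z) / R" using that unfolding \<psi>_def by linarith+
      then have "0 < l x" "dist x z < 2 * R" using a R by (auto simp: zero_less_mult_iff zero_less_divide_iff)
      then show ?thesis using m by (auto simp: W_def l_def max_def split: if_splits)
    qed
    have u_lip: "locally_lipschitz u" unfolding u_def
    proof (rule locally_lipschitz_cut[OF _ \<eta> \<psi>lip])
      show "y \<in> V" if "x \<in> V" "\<psi> y \<noteq> 0" "dist x y < \<eta>" for x y
        using V_closed[of x y] \<psi>W[of y] that by blast
    qed (use a m R in simp)
    have u01: "\<forall>x. 0 \<le> u x \<and> u x \<le> 1" by (auto simp: u_def \<psi>_def)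
    have ball_W: "ball z (s / 2) \<subseteq> W"
    proof
      fix x assume "x \<in> ball z (s / 2)"
      then show "x \<in> W" using dlip[of z x] m4 m R s by (auto simp: W_def s_def dist_commute)
    qed
    have ball_V: "ball z (s / 2) \<subseteq> V"
    proof (rule ccontr)
      assume "\<not> ?thesis"
      then obtain v where v: "v \<in> ball z (s / 2)" "v \<notin> V" by blast
      \<comment> \<open>By \<open>V_closed\<close> the neighbourhoods of the two parts are disjoint
        open sets, against connectedness of the ball.\<close>
      define e1 where "e1 = (\<Union>x\<in>ball z (s / 2) \<inter> V. ball x (\<eta> / 2))"
      define e2 where "e2 = (\<Union>x\<in>ball z (s / 2) - V. ball x (\<eta> / 2))"
      have "e1 \<inter> e2 = {}"
      proof (rule ccontr)
        assume "e1 \<inter> e2 \<noteq> {}"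
        then obtain x y b where "x \<in> V" "b \<in> ball x (\<eta> / 2)" "y \<in> ball z (s / 2)" "y \<notin> V" "b \<in> ball y (\<eta> / 2)"
          unfolding e1_def e2_def by blast
        then show False using V_closed[of x y] dist_triangle2[of x y b] ball_W by auto
      qed
      moreover have "open e1" "open e2" by (auto simp: e1_def e2_def)
      moreover have self: "x \<in> ball x (\<eta> / 2)" for x :: 'a using \<eta> by simp
      then have "ball z (s / 2) \<subseteq> e1 \<union> e2" unfolding e1_def e2_def by blast
      moreover have "z \<in> ball z (s / 2)" using s by simp
      then have "z \<in> e1 \<inter> ball z (s / 2)" using zV self[of z] unfolding e1_def by blast
      moreover have "v \<in> e2 \<inter> ball z (s / 2)" using v self[of v] unfolding e2_def by blast
      ultimately show False
        using connected_ball_geodesic[OF geo, of z "s / 2"] unfolding connected_def by blast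
    qed
    have \<psi>1: "\<psi> x = 1" if "s / 2 \<le> d x" "dist x z \<le> R" for x
    proof -
      \<comment> \<open>From d = m to d = s / 2 the distance doubles k - 1 times; \<open>a\<close>
        normalises this logarithm to 1.\<close>
      have "s / 2 / m = 2 ^ (k - 1)" using s k by (cases k) (auto simp: m_def)
      then have "ln (s / 2 / m) = real (k - 1) * ln 2" by (simp add: ln_realpow)
      moreover have "ln (s / 2 / m) = ln (s / 2) - ln m" using s m by (simp add: ln_div del: divide_divide_eq_left)
      ultimately have "ln (s / 2) - ln m = real (k - 1) * ln 2" by simp
      then have "a * (ln (s / 2) - ln m) = 1" using k by (simp add: a_def)
      moreover have "a * (ln (s / 2) - ln m) \<le> a * l x"
        unfolding l_def using that(1) s m4 a by (intro mult_left_mono) (auto simp: max_def)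
      moreover have "1 \<le> (2 * R - dist x z) / R" using that(2) R by (simp add: field_simps)
      ultimately show ?thesis unfolding \<psi>_def by linarith
    qed
    have u1: "\<forall>x\<in>ball z (s / 2). u x = 1"
    proof
      fix x assume x: "x \<in> ball z (s / 2)"
      then show "u x = 1" using ball_V dlip[of z x] R s
        by (auto simp: u_def s_def dist_commute intro!: \<psi>1)
    qed
    have u0: "\<forall>x\<in>frontier \<Omega>. u x = 0"
      using compl_dist_frontier[OF \<Omega>(1)] \<psi>W m by (force simp: u_def d_def)
    obtain w where w: "w \<in> frontier \<Omega>" "dist z w < 2 * s"
      using near_frontier_point[OF geo \<Omega>(2) z, of "2 * s"] s by (auto simp: s_def d_def)
    have cont: "ennreal c0 * emeasure M (ball w (s / 2)) / ennreal ((s / 2) powr t)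
      \<le> codim_content M t (s / 2) (ball w (s / 2) \<inter> frontier \<Omega>)"
      using w(1) s half_compl_dist_less_diameter[OF geo \<Omega> z] by (intro content) (auto simp: s_def d_def)
    define Vj where "Vj = (\<lambda>j. {x \<in> V. dist x z < R \<and> s / 2 ^ j / 2 < d x \<and> d x \<le> s / 2 ^ j})"
    \<comment> \<open>This is the separation required of children at scale \<sigma> = s / 2^j, so
      the same net bounds the energy and later serves as the set of children.\<close>
    define \<rho> where "\<rho> = (\<lambda>j::nat. 5 * \<Lambda> * (s / 2 ^ j))"
    have \<rho>: "0 < \<rho> j" for j using s \<Lambda> by (simp add: \<rho>_def)
    have "\<exists>Y. finite Y \<and> Y \<subseteq> Vj j \<and> separated (\<rho> j) Y \<and> Vj j \<subseteq> (\<Union>x\<in>Y. ball x (\<rho> j))" for j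
    proof -
      obtain n where "(4 * R + \<rho> j) / \<rho> j < 2 ^ n"
        using real_arch_pow[of 2] by auto
      then have n: "4 * R + \<rho> j \<le> 2 ^ n * \<rho> j" using \<rho>[of j] by (simp add: divide_less_eq)
      have "Vj j \<subseteq> ball z R" by (auto simp: Vj_def dist_commute)
      then show ?thesis using ex_separated_net[OF _ \<rho> R(1) n] by metis
    qed
    then obtain Y where Y: "\<And>j. finite (Y j)" "\<And>j. Y j \<subseteq> Vj j" "\<And>j. separated (\<rho> j) (Y j)"
      "\<And>j. Vj j \<subseteq> (\<Union>x\<in>Y j. ball x (\<rho> j))" by metis
    have slope: "Lip u x = 0 \<or> (\<exists>j\<in>{1..k}. \<exists>y\<in>Y j. x \<in> ball y (\<rho> j) \<and> Lip u x \<le> ennreal (4 * a * 2 ^ j / s))"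
      if x: "x \<in> ball z R" for x
    proof (cases "x \<in> V")
      case True
      have near: "u y = \<psi> y" if "dist x y < \<eta>" for y
        using V_closed[OF True _ that] \<psi>W[of y] by (auto simp: u_def)
      show ?thesis
      proof (cases "d x \<le> s / 2")
        case True
        have lo: "m / 2 < d x" using \<open>x \<in> V\<close> VW by (auto simp: W_def)
        \<comment> \<open>The least such j names the dyadic layer of x. It is not 0 because d(x)
          \<le> s / 2, and at most k because d(x) > m / 2.\<close>
        define j where "j = (LEAST j. s / 2 ^ j / 2 < d x)"
        have jk: "s / 2 ^ k / 2 < d x" using lo by (simp add: m_def)
        then have j: "s / 2 ^ j / 2 < d x" "j \<le> k"
          unfolding j_def by (rule LeastI, rule Least_le)
        have "\<not> s / 2 ^ 0 / 2 < d x" using True by simp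
        then have "j \<noteq> 0" using j(1) by (metis)
        then obtain i where i: "j = Suc i" by (cases j) auto
        then have "\<not> s / 2 ^ i / 2 < d x" using not_less_Least[of i "\<lambda>j. s / 2 ^ j / 2 < d x"]
          by (auto simp: j_def)
        then have "d x \<le> s / 2 ^ j" by (simp add: i mult.commute)
        then have "x \<in> Vj j" using \<open>x \<in> V\<close> x j by (auto simp: Vj_def dist_commute)
        then obtain y where y: "y \<in> Y j" "x \<in> ball y (\<rho> j)" using Y(4) by blast
        have dx: "0 < d x" using lo m by linarith
        have "Lip u x \<le> ennreal (4 * a * 2 ^ j / s)"
        proof (rule Lip_le)
          \<comment> \<open>The three bounds keep \<open>v\<close> where \<open>u\<close> equals
            \<open>\<psi>\<close>, inside \<open>B(z, R)\<close>, and at distance at least d(x) / 2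
            from the complement.\<close>
          define e where "e = min \<eta> (min (R - dist x z) (d x / 2))"
          show "0 < e" using x \<eta> dx by (simp add: e_def dist_commute)
          fix v assume v: "dist x v < e"
          have uv: "u x = \<psi> x" "u v = \<psi> v" using near[of x] near[of v] v \<eta> by (auto simp: e_def)
          have clamp: "\<psi> x' = max 0 (min 1 (a * l x'))" if "dist x' z < R" for x'
          proof -
            have "1 \<le> (2 * R - dist x' z) / R" using that R by (simp add: field_simps)
            then show ?thesis by (auto simp: \<psi>_def)
          qed
          have "dist x z < R" "dist v z < R"
            using x v dist_triangle[of v z x] by (auto simp: e_def dist_commute)
          then have "\<bar>u x - u v\<bar> \<le> \<bar>a * l x - a * l v\<bar>"
            unfolding uv using clamp[of x] clamp[of v] by linarith
          also have "\<dots> = a * \<bar>l x - l v\<bar>" using a by (simp add: abs_mult flip: right_diff_distrib)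
          also have "\<dots> \<le> a * (dist x v / (d x / 2))"
            using dlip[of x v] v dx a by (intro mult_left_mono l_lip) (auto simp: e_def)
          also have "\<dots> \<le> a * (dist x v / (s / 2 ^ j / 4))"
            using j dx s a by (intro mult_left_mono divide_left_mono) auto
          finally show "\<bar>u x - u v\<bar> \<le> 4 * a * 2 ^ j / s * dist x v" by (simp add: mult_ac)
        qed (use a s in simp)
        then show ?thesis using y j(2) \<open>j \<noteq> 0\<close> by (intro disjI2 bexI[of _ j] bexI[of _ y]) auto
      next
        case False
        have "Lip u x \<le> ennreal 0"
        proof (rule Lip_le)
          define e where "e = min \<eta> (min (R - dist x z) (d x - s / 2))"
          show "0 < e" using x \<eta> False by (simp add: e_def dist_commute)
          fix v assume v: "dist x v < e"
          have "dist v z < R" using x v dist_triangle[of v z x] by (auto simp: e_def dist_commute)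
          moreover have "s / 2 \<le> d v" using dlip[of x v] v by (auto simp: e_def)
          ultimately have "\<psi> v = 1" "\<psi> x = 1" using False x by (auto intro!: \<psi>1 simp: dist_commute)
          then show "\<bar>u x - u v\<bar> \<le> 0 * dist x v"
            using near[of x] near[of v] v \<eta> by (auto simp: e_def)
        qed simp
        then show ?thesis by simp
      qed
    next
      case False
      have "Lip u x \<le> ennreal 0"
      proof (rule Lip_le)
        show "0 < min \<eta> (m / 2)" using \<eta> m by simp
        fix v assume v: "dist x v < min \<eta> (m / 2)"
        have "u v = 0"
        proof (rule ccontr)
          assume "u v \<noteq> 0"
          then have "v \<in> V" "m < d v" using \<psi>W[of v] by (auto simp: u_def split: if_splits)
          moreover have "x \<in> W" using dlip[of v x] v \<open>m < d v\<close> x R by (auto simp: W_def dist_commute)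
          ultimately show False using V_closed[of v x] v False by (auto simp: dist_commute)
        qed
        then show "\<bar>u x - u v\<bar> \<le> 0 * dist x v" using False by (simp add: u_def)
      qed simp
      then show ?thesis by simp
    qed
    have Yd: "0 < d y" "s / 2 ^ j / 2 < d y" "d y \<le> s / 2 ^ j" if "y \<in> Y j" for y j
      using that Y(2)[of j] s by (auto simp: Vj_def intro: le_less_trans[rotated])
    have "\<exists>j\<in>{1..k}. q z \<le> (\<Sum>y\<in>Y j. q y)"
    proof (rule ccontr)
      assume "\<not> ?thesis"
      then have small: "(\<Sum>y\<in>Y j. q y) \<le> q z" if "j \<in> {1..k}" for j using that by force
      \<comment> \<open>\<open>h j\<close> is the p-th power of the slope bound in layer j, and the
        measure \<open>N\<close> built from it dominates the energy of \<open>u\<close> in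
        \<open>B(z, R)\<close>. If no layer reached the weight \<open>q z\<close>, its mass would be
        at most K k a^p \<open>q z\<close>, which by the choice of k is below the capacity bound c
        \<open>q z\<close>.\<close>
      define h where "h = (\<lambda>j. (4 * a * 2 ^ j / s) powr p)"
      define f where "f = (\<lambda>x. \<Sum>j\<in>{1..k}. \<Sum>y\<in>Y j. ennreal (h j) * indicator (ball y (\<rho> j)) x)"
      define N where "N = density M f"
      have fm [measurable]: "f \<in> borel_measurable M"
        unfolding f_def using Y(1) by measurable
      have energy: "ennpowr (Lip u x) p \<le> f x" if x: "x \<in> ball z R" for x
        using slope[OF x]
      proof
        assume "Lip u x = 0"
        then show ?thesis by (simp add: ennpowr_def)
      next
        assume "\<exists>j\<in>{1..k}. \<exists>y\<in>Y j. x \<in> ball y (\<rho> j) \<and> Lip u x \<le> ennreal (4 * a * 2 ^ j / s)"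
        then obtain j y where j: "j \<in> {1..k}" "y \<in> Y j" "x \<in> ball y (\<rho> j)"
          and Lu: "Lip u x \<le> ennreal (4 * a * 2 ^ j / s)" by blast
        have "ennpowr (Lip u x) p \<le> ennpowr (ennreal (4 * a * 2 ^ j / s)) p"
          using Lu p_gt_1 by (intro ennpowr_mono) auto
        also have "\<dots> = ennreal (h j) * indicator (ball y (\<rho> j)) x"
          using a s j(3) by (simp add: ennpowr_ennreal h_def)
        also have "\<dots> \<le> (\<Sum>y\<in>Y j. ennreal (h j) * indicator (ball y (\<rho> j)) x)"
          using Y(1) j(2) by (intro member_le_sum) auto
        also have "\<dots> \<le> f x" unfolding f_def using j(1) by (intro member_le_sum) auto
        finally show ?thesis .
      qed
      have Nball: "emeasure N (ball y r) = (\<integral>\<^sup>+x\<in>ball y r. f x \<partial>M)" for y r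
        unfolding N_def by (rule emeasure_density) auto
      have weight: "h j * measure M (ball y (\<rho> j)) \<le> a powr p * K * q y" if "y \<in> Y j" for j y
      proof -
        have "4 * a * 2 ^ j / s \<le> 4 * a / d y"
          using Yd[OF that] a s by (simp add: field_simps)
        then have "h j \<le> (4 * a / d y) powr p"
          unfolding h_def using a s p_gt_1 by (intro powr_mono2) auto
        also have "\<dots> = a powr p * 4 powr p / d y powr p"
          using a Yd[OF that] by (simp add: powr_divide powr_mult)
        finally have 1: "h j \<le> a powr p * 4 powr p / d y powr p" .
        have "\<rho> j \<le> 5 * \<Lambda> * (2 * d y)"
          unfolding \<rho>_def using \<Lambda> Yd(2)[OF that] by (intro mult_left_mono) auto
        also have "\<dots> = (10 * \<Lambda>) * d y" by simp
        also have "\<dots> \<le> 2 ^ nA * d y" using nA d0 by (intro mult_right_mono) auto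
        finally have 2: "measure M (ball y (\<rho> j)) \<le> D ^ nA * measure M (ball y (d y))"
          using Yd(1)[OF that] by (intro measure_ball_compare) auto
        have "h j * measure M (ball y (\<rho> j)) \<le> (a powr p * 4 powr p / d y powr p) * (D ^ nA * measure M (ball y (d y)))"
          using 1 2 by (intro mult_mono) auto
        then show ?thesis by (simp add: K_def q_def mult_ac)
      qed
      have "emeasure N (ball z R) \<le> (\<integral>\<^sup>+x. f x \<partial>M)"
        unfolding Nball by (intro nn_integral_mono) (auto split: split_indicator)
      also have "\<dots> = (\<Sum>j\<in>{1..k}. \<Sum>y\<in>Y j. ennreal (h j) * emeasure M (ball y (\<rho> j)))"
        unfolding f_def by (simp add: nn_integral_sum nn_integral_cmult)
      also have "\<dots> = (\<Sum>j\<in>{1..k}. \<Sum>y\<in>Y j. ennreal (h j * measure M (ball y (\<rho> j))))"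
        by (simp add: emeasure_ball h_def ennreal_mult)
      also have "\<dots> = ennreal (\<Sum>j\<in>{1..k}. \<Sum>y\<in>Y j. h j * measure M (ball y (\<rho> j)))"
        by (simp add: h_def sum_nonneg)
      finally have N1: "emeasure N (ball z R) \<le> ennreal (\<Sum>j\<in>{1..k}. \<Sum>y\<in>Y j. h j * measure M (ball y (\<rho> j)))" .
      have "(\<Sum>j\<in>{1..k}. \<Sum>y\<in>Y j. h j * measure M (ball y (\<rho> j))) \<le> (\<Sum>j\<in>{1..k}. \<Sum>y\<in>Y j. a powr p * K * q y)"
        by (intro sum_mono weight)
      also have "\<dots> \<le> (\<Sum>j\<in>{1..k}. a powr p * K * q z)"
        unfolding sum_distrib_left[symmetric] using K small by (intro sum_mono mult_left_mono) auto
      also have "\<dots> = (K * real k * a powr p) * q z" by simp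
      finally have N2: "(\<Sum>j\<in>{1..k}. \<Sum>y\<in>Y j. h j * measure M (ball y (\<rho> j))) \<le> (K * real k * a powr p) * q z" .
      have fin: "emeasure N (ball z R) < \<infinity>" using N1 by (auto intro: le_less_trans)
      have RR: "4 * \<kappa> * s = R" by (simp add: R_def \<Lambda>_def)
      have "c * measure M (ball z s) / s powr p \<le> measure N (ball z (4 * \<kappa> * s))"
      proof (rule cap[OF s w(2) u_lip u01 u1 u0 cont])
        show "sets N = sets borel" by (simp add: N_def sets_M)
        show "emeasure N (ball z (4 * \<kappa> * s)) < \<infinity>" using fin RR by simp
        show "\<forall>y r. ball y r \<subseteq> ball z (4 * \<kappa> * s) \<longrightarrow>
            (\<integral>\<^sup>+x\<in>ball y r. ennpowr (Lip u x) p \<partial>M) \<le> emeasure N (ball y r)"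
          unfolding RR Nball using energy
          by (auto intro!: nn_integral_mono split: split_indicator)
      qed
      then have "c * q z \<le> measure N (ball z R)" unfolding RR q_def s_def[symmetric] by simp
      also have "measure N (ball z R) \<le> (\<Sum>j\<in>{1..k}. \<Sum>y\<in>Y j. h j * measure M (ball y (\<rho> j)))"
        unfolding measure_def[of N] using N1 by (intro enn2real_leI) (auto simp: h_def intro!: sum_nonneg)
      finally have "c * q z \<le> (K * real k * a powr p) * q z" using N2 by linarith
      moreover have "0 < q z" unfolding q_def using s measure_ball_pos[OF s, of z] by (simp add: s_def)
      ultimately show False using kc by (simp add: a_def)
    qed
    then obtain j where j: "1 \<le> j" "j \<le> k" "q z \<le> (\<Sum>y\<in>Y j. q y)" by auto
    show "\<exists>Y \<sigma>. finite Y \<and> \<delta> * d z \<le> \<sigma> \<and> \<sigma> \<le> d z / 2 \<and>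
      (\<forall>y\<in>Y. \<sigma> / 2 < d y \<and> d y \<le> \<sigma> \<and> dist z y \<le> 4 * \<kappa> * d z \<and> reaches d (L * d z) (\<delta> * d z) z y) \<and>
      separated (5 * (4 * \<kappa>) * \<sigma>) Y \<and> q z \<le> (\<Sum>y\<in>Y. q y)"
    proof (intro exI[of _ "Y j"] exI[of _ "s / 2 ^ j"] conjI ballI)
      have "(2::real) ^ j \<le> 2 ^ k" using j by (intro power_increasing) auto
      then have "(2::real) ^ j \<le> 4 * 2 ^ k" by (smt (verit) zero_le_power)
      then have "s / (4 * 2 ^ k) \<le> s / 2 ^ j" using s by (intro divide_left_mono) auto
      then show "\<delta> * d z \<le> s / 2 ^ j" by (simp add: \<delta>_def s_def)
      have "(2::real) ^ 1 \<le> 2 ^ j" using j by (intro power_increasing) auto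
      then show "s / 2 ^ j \<le> d z / 2" using s unfolding s_def by (intro divide_left_mono) auto
      show "separated (5 * (4 * \<kappa>) * (s / 2 ^ j)) (Y j)" using Y(3)[of j] by (simp add: \<rho>_def \<Lambda>_def)
      fix y assume y: "y \<in> Y j"
      show "s / 2 ^ j / 2 < d y" "d y \<le> s / 2 ^ j" using Yd[OF y] by auto
      have "y \<in> V" "dist y z < R" using y Y(2)[of j] by (auto simp: Vj_def)
      then show "dist z y \<le> 4 * \<kappa> * d z" "reaches d (L * d z) (\<delta> * d z) z y"
        using reach[of y] by (auto simp: R_def \<Lambda>_def s_def dist_commute)
    qed (use Y(1) j(3) in auto)
  qed
  with L\<delta> show ?thesis by blast
qed

section \<open>Measures on trees\<close>

text \<open>The interval from a to a + \<open>sum v Y\<close> is cut into consecutive pieces of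
  lengths \<open>v y\<close>, and \<open>h x\<close> names the piece of x. Outside the interval
  \<open>h\<close> still takes values in \<open>Y\<close>, so that the descent in the tree is
  defined for every real.\<close>

lemma interval_selector:
  assumes "finite Y" "Y \<noteq> {}"
  shows "\<exists>h \<alpha> \<beta>. range h \<subseteq> Y \<and> h \<in> borel \<rightarrow>\<^sub>M count_space UNIV \<and>
    (\<forall>x. a \<le> x \<longrightarrow> x < a + sum v Y \<longrightarrow> \<alpha> (h x) \<le> x \<and> x < \<beta> (h x)) \<and>
    (\<forall>y\<in>Y. \<beta> y - \<alpha> y = (v y :: real))"
  using assms
proof (induction Y arbitrary: a rule: finite_ne_induct)
  case (singleton y)
  show ?case
    by (intro exI[of _ "\<lambda>_. y"] exI[of _ "\<lambda>_. a"] exI[of _ "\<lambda>_. a + v y"]) auto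
next
  case (insert y Y)
  obtain h \<alpha> \<beta> where h: "range h \<subseteq> Y" "h \<in> borel \<rightarrow>\<^sub>M count_space UNIV"
    "\<And>x. a + v y \<le> x \<Longrightarrow> x < a + v y + sum v Y \<Longrightarrow> \<alpha> (h x) \<le> x \<and> x < \<beta> (h x)"
    "\<And>y. y \<in> Y \<Longrightarrow> \<beta> y - \<alpha> y = v y"
    using insert.IH[of "a + v y"] by blast
  have ny: "h x \<noteq> y" for x using h(1) insert.hyps by auto
  show ?case
  proof (intro exI conjI)
    show "range (\<lambda>x. if x < a + v y then y else h x) \<subseteq> insert y Y" using h(1) by auto
    show "(\<lambda>x. if x < a + v y then y else h x) \<in> borel \<rightarrow>\<^sub>M count_space UNIV"
      using h(2) by measurable
    show "\<forall>x. a \<le> x \<longrightarrow> x < a + sum v (insert y Y) \<longrightarrow>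
       (\<alpha>(y := a)) (if x < a + v y then y else h x) \<le> x \<and>
       x < (\<beta>(y := a + v y)) (if x < a + v y then y else h x)"
      using h(3) insert.hyps ny by (auto simp: add.assoc)
    show "\<forall>y'\<in>insert y Y. (\<beta>(y := a + v y)) y' - (\<alpha>(y := a)) y' = v y'"
      using h(4) insert.hyps by auto
  qed
qed

text \<open>The measure is the image of Lebesgue measure on the unit interval: each node owns a subinterval, which is divided
  among its children in proportion to their weights \<open>q\<close>. In the conclusion, the first node owns the mass of the
  ball and the second one lies well inside the ball; both have size comparable to \<open>r\<close>.\<close>

lemma tree_measure:
  fixes d q \<sigma> :: "'a::complete_space \<Rightarrow> real"
  assumes root: "z0 \<in> G" and d_pos: "\<And>z. z \<in> G \<Longrightarrow> 0 < d z" and q_pos: "\<And>z. z \<in> G \<Longrightarrow> 0 < q z"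
    and \<Lambda>: "0 < \<Lambda>" and \<delta>: "0 < \<delta>"
    and Y: "\<And>z. z \<in> G \<Longrightarrow> finite (Y z)" "\<And>z. z \<in> G \<Longrightarrow> Y z \<subseteq> G"
    and \<sigma>: "\<And>z. z \<in> G \<Longrightarrow> \<delta> * d z \<le> \<sigma> z" "\<And>z. z \<in> G \<Longrightarrow> \<sigma> z \<le> d z / 2"
    and child: "\<And>z y. z \<in> G \<Longrightarrow> y \<in> Y z \<Longrightarrow> \<sigma> z / 2 < d y" "\<And>z y. z \<in> G \<Longrightarrow> y \<in> Y z \<Longrightarrow> d y \<le> \<sigma> z"
      "\<And>z y. z \<in> G \<Longrightarrow> y \<in> Y z \<Longrightarrow> dist z y \<le> \<Lambda> * d z"
    and sep: "\<And>z. z \<in> G \<Longrightarrow> separated (5 * \<Lambda> * \<sigma> z) (Y z)"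
    and weight: "\<And>z. z \<in> G \<Longrightarrow> q z \<le> (\<Sum>y\<in>Y z. q y)"
  defines "T \<equiv> {(z, y). z \<in> G \<and> y \<in> Y z}\<^sup>*"
  shows "\<exists>P \<nu>. compact P \<and> sets \<nu> = sets borel \<and> prob_space \<nu> \<and> emeasure \<nu> (- P) = 0 \<and>
    (\<forall>\<zeta>\<in>P. dist z0 \<zeta> \<le> 2 * \<Lambda> * d z0) \<and>
    (\<forall>\<zeta>\<in>P. \<forall>r>0.
      (\<exists>y. (z0, y) \<in> T \<and> emeasure \<nu> (ball \<zeta> r) \<le> ennreal (q y / q z0) \<and>
        \<Lambda> * d y \<le> 4 * r / \<delta> \<and> dist y \<zeta> \<le> 2 * \<Lambda> * d y + r / 4 \<and> (y = z0 \<or> 2 * r \<le> \<Lambda> * d y)) \<and>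
      (\<exists>y. (z0, y) \<in> T \<and> \<Lambda> * d y \<le> r / 8 \<and> dist y \<zeta> \<le> r / 2 \<and> (y = z0 \<or> \<delta> * r / 16 \<le> \<Lambda> * d y)))"
proof -
  have Yne: "Y z \<noteq> {}" if "z \<in> G" for z using weight[OF that] q_pos[OF that] by force
  define good where "good = (\<lambda>z a b h \<alpha> \<beta>. range h \<subseteq> Y z \<and> h \<in> borel \<rightarrow>\<^sub>M count_space UNIV \<and>
    (\<forall>x. a \<le> x \<longrightarrow> x < b \<longrightarrow> \<alpha> (h x) \<le> x \<and> x < \<beta> (h x)) \<and>
    (\<forall>y\<in>Y z. \<beta> y - \<alpha> y = (b - a) * (q y / sum q (Y z))))"
  have "\<exists>h \<alpha> \<beta>. z \<in> G \<longrightarrow> good z a b h \<alpha> \<beta>" for z and a b :: real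
  proof (cases "z \<in> G")
    case True
    have "0 < sum q (Y z)" using weight[OF True] q_pos[OF True] by linarith
    then have "a + (\<Sum>y\<in>Y z. (b - a) * (q y / sum q (Y z))) = b"
      by (simp flip: sum_distrib_left sum_divide_distrib)
    then show ?thesis
      using interval_selector[OF Y(1) Yne, OF True True, of a "\<lambda>y. (b - a) * (q y / sum q (Y z))"] unfolding good_def by simp
  qed blast
  then obtain h \<alpha> \<beta> where "\<And>z a b. z \<in> G \<Longrightarrow> good z a b (h z a b) (\<alpha> z a b) (\<beta> z a b)"
    by metis
  then have H: "\<And>z a b. z \<in> G \<Longrightarrow> range (h z a b) \<subseteq> Y z"
    "\<And>z a b. z \<in> G \<Longrightarrow> h z a b \<in> borel \<rightarrow>\<^sub>M count_space UNIV"
    "\<And>z a b x. z \<in> G \<Longrightarrow> a \<le> x \<Longrightarrow> x < b \<Longrightarrow> \<alpha> z a b (h z a b x) \<le> x \<and> x < \<beta> z a b (h z a b x)"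
    "\<And>z a b y. z \<in> G \<Longrightarrow> y \<in> Y z \<Longrightarrow> \<beta> z a b y - \<alpha> z a b y = (b - a) * (q y / sum q (Y z))"
    unfolding good_def by blast+
  define make where "make = (\<lambda>z a b y. (y, \<alpha> z a b y :: real, \<beta> z a b y :: real))"
  define step where "step = (\<lambda>(z, a, b) x. make z a b (h z a b x))"
  \<comment> \<open>A real x drives the descent. The state carries the interval along with the node,
    because the choice of the next child divides that interval.\<close>
  define st where "st = rec_nat (\<lambda>_. (z0, 0, 1)) (\<lambda>_ S x. step (S x) x)"
  have st_0: "st 0 x = (z0, 0, 1)" and st_Suc: "st (Suc n) x = step (st n x) x" for n x
    by (simp_all add: st_def)
  define Z where "Z = (\<lambda>n x. fst (st n x))"
  define lo where "lo = (\<lambda>n x. fst (snd (st n x)))"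
  define hi where "hi = (\<lambda>n x. snd (snd (st n x)))"
  have st_eq: "st n x = (Z n x, lo n x, hi n x)" for n x by (simp add: Z_def lo_def hi_def)
  have Z_0: "Z 0 x = z0" and lo_0: "lo 0 x = 0" and hi_0: "hi 0 x = 1" for x
    by (simp_all add: Z_def lo_def hi_def st_0)
  have Suc_eq: "Z (Suc n) x = h (Z n x) (lo n x) (hi n x) x"
    "lo (Suc n) x = \<alpha> (Z n x) (lo n x) (hi n x) (Z (Suc n) x)"
    "hi (Suc n) x = \<beta> (Z n x) (lo n x) (hi n x) (Z (Suc n) x)" for n x
    unfolding Z_def lo_def hi_def st_Suc by (simp_all add: step_def make_def case_prod_unfold)
  have ZG: "Z n x \<in> G" for n x
  proof (induction n)
    case (Suc n)
    then show ?case unfolding Suc_eq(1) using H(1)[OF Suc] Y(2)[OF Suc] by blast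
  qed (simp add: Z_0 root)
  have ZY: "Z (Suc n) x \<in> Y (Z n x)" for n x unfolding Suc_eq(1) using H(1)[OF ZG] by blast
  have ZT: "(z0, Z n x) \<in> T" for n x
  proof (induction n)
    case (Suc n)
    then show ?case using ZG[of n x] ZY[of n x] unfolding T_def by (auto intro: rtrancl_into_rtrancl)
  qed (simp add: Z_0 T_def)
  have dZ: "0 < d (Z n x)" for n x using d_pos[OF ZG] .
  have d_half: "d (Z (Suc n) x) \<le> d (Z n x) / 2" for n x
    using child(2)[OF ZG ZY, of n x] \<sigma>(2)[OF ZG, of n x] by linarith
  have d_low: "\<delta> / 2 * d (Z n x) \<le> d (Z (Suc n) x)" for n x
    using child(1)[OF ZG ZY, of n x] \<sigma>(1)[OF ZG, of n x] by simp
  have d_pow: "d (Z n x) \<le> d z0 / 2 ^ n" for n x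
  proof (induction n)
    case (Suc n)
    then show ?case using d_half[of n x] by simp
  qed (simp add: Z_0)
  have small: "\<exists>n. \<forall>x. \<Lambda> * d (Z n x) < e" if "0 < e" for e
  proof -
    obtain n where "\<Lambda> * d z0 / e < 2 ^ n" using real_arch_pow[of 2] by auto
    then have "\<Lambda> * (d z0 / 2 ^ n) < e" using that by (simp add: field_simps)
    then have "\<Lambda> * d (Z n x) < e" for x
      using mult_left_mono[OF d_pow[of n x], of \<Lambda>] \<Lambda> by linarith
    then show ?thesis by blast
  qed
  \<comment> \<open>The first generation below the level e works: its parent lies above e, and one
    generation shrinks d at most by the factor \<delta> / 2.\<close>
  have scale: "\<exists>n. \<Lambda> * d (Z n x) \<le> e \<and> (n = 0 \<or> \<delta> / 2 * e \<le> \<Lambda> * d (Z n x))" if e: "0 < e" for e x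
  proof -
    define n where "n = (LEAST n. \<Lambda> * d (Z n x) \<le> e)"
    obtain n' where "\<Lambda> * d (Z n' x) < e" using small[OF e] by blast
    then have n: "\<Lambda> * d (Z n x) \<le> e"
      unfolding n_def by (intro LeastI[of "\<lambda>n. \<Lambda> * d (Z n x) \<le> e" n']) simp
    have "\<delta> / 2 * e \<le> \<Lambda> * d (Z n x)" if "n = Suc i" for i
    proof -
      have "e < \<Lambda> * d (Z i x)" using not_less_Least[of i "\<lambda>n. \<Lambda> * d (Z n x) \<le> e"] that by (auto simp: n_def)
      then have "\<delta> / 2 * e \<le> \<delta> / 2 * (\<Lambda> * d (Z i x))" using \<delta> by (intro mult_left_mono) auto
      also have "\<dots> = \<Lambda> * (\<delta> / 2 * d (Z i x))" by simp
      also have "\<dots> \<le> \<Lambda> * d (Z n x)" unfolding that using \<Lambda> by (intro mult_left_mono d_low) auto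
      finally show ?thesis .
    qed
    then show ?thesis using n by (cases n) auto
  qed
  have dist_Z: "dist (Z n x) (Z (n + i) x) \<le> 2 * \<Lambda> * d (Z n x)" for n i x
  proof (induction i arbitrary: n)
    case (Suc i)
    have "dist (Z n x) (Z (n + Suc i) x) \<le> dist (Z n x) (Z (Suc n) x) + dist (Z (Suc n) x) (Z (Suc n + i) x)"
      using dist_triangle by simp
    also have "\<dots> \<le> \<Lambda> * d (Z n x) + 2 * \<Lambda> * d (Z (Suc n) x)"
      by (intro add_mono child(3)[OF ZG ZY] Suc)
    also have "2 * \<Lambda> * d (Z (Suc n) x) \<le> 2 * \<Lambda> * (d (Z n x) / 2)"
      using \<Lambda> d_half by (intro mult_left_mono) auto
    finally show ?case by simp
  qed (use \<Lambda> dZ[of _ x] in \<open>simp add: less_imp_le\<close>)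
  have "\<exists>l. (\<lambda>n. Z n x) \<longlonglongrightarrow> l" for x
  proof -
    have "Cauchy (\<lambda>n. Z n x)"
    proof (rule metric_CauchyI)
      fix e :: real assume "0 < e"
      then have "0 < e / 4" by simp
      from small[OF this] obtain n where n: "\<Lambda> * d (Z n x) < e / 4" by blast
      have "dist (Z i x) (Z j x) < e" if "n \<le> i" "n \<le> j" for i j
        using dist_Z[of n x "i - n"] dist_Z[of n x "j - n"] dist_triangle3[of "Z i x" "Z j x" "Z n x"] n that by simp
      then show "\<exists>M. \<forall>m\<ge>M. \<forall>n\<ge>M. dist (Z m x) (Z n x) < e" by blast
    qed
    then show ?thesis by (simp add: Cauchy_convergent_iff convergent_def)
  qed
  then obtain \<phi> where \<phi>: "\<And>x. (\<lambda>n. Z n x) \<longlonglongrightarrow> \<phi> x" by metis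
  have dist_\<phi>: "dist (Z n x) (\<phi> x) \<le> 2 * \<Lambda> * d (Z n x)" for n x
  proof (rule LIMSEQ_le_const2)
    show "(\<lambda>i. dist (Z n x) (Z (i + n) x)) \<longlonglongrightarrow> dist (Z n x) (\<phi> x)"
      using LIMSEQ_ignore_initial_segment[OF \<phi>[of x], of n] by (intro tendsto_intros)
    show "\<exists>N. \<forall>i\<ge>N. dist (Z n x) (Z (i + n) x) \<le> 2 * \<Lambda> * d (Z n x)"
      using dist_Z[of n x] by (simp add: add.commute)
  qed
  \<comment> \<open>Origin of the factor 5 in the separation: two limit points deviate from their
    own nodes by at most 2 \<Lambda> \<sigma> each and from each other by less than \<Lambda>
    \<sigma>, so distinct children would be too close.\<close>
  have same: "st n x = st n y" if "dist (\<phi> x) (\<phi> y) < \<Lambda> * d (Z n x)" for n x y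
    using that
  proof (induction n)
    case (Suc n)
    have "d (Z (Suc n) x) \<le> d (Z n x)" using d_half[of n x] dZ[of n x] by linarith
    then have "\<Lambda> * d (Z (Suc n) x) \<le> \<Lambda> * d (Z n x)" using \<Lambda> by (intro mult_left_mono) auto
    then have IH: "st n x = st n y" using Suc by linarith
    then have Zeq: "Z n y = Z n x" by (simp add: Z_def)
    have "Z (Suc n) x = Z (Suc n) y"
    proof (rule ccontr)
      assume ne: "Z (Suc n) x \<noteq> Z (Suc n) y"
      let ?s = "\<sigma> (Z n x)"
      have "5 * \<Lambda> * ?s \<le> dist (Z (Suc n) x) (Z (Suc n) y)"
        using sep[OF ZG, of n x] ne ZY[of n x] ZY[of n y] unfolding separated_def Zeq by blast
      also have "\<dots> \<le> dist (Z (Suc n) x) (\<phi> x) + dist (\<phi> x) (\<phi> y) + dist (Z (Suc n) y) (\<phi> y)"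
        using dist_triangle[of "Z (Suc n) x" "Z (Suc n) y" "\<phi> x"] dist_triangle[of "\<phi> x" "Z (Suc n) y" "\<phi> y"]
        by (simp add: dist_commute)
      also have "\<dots> < 2 * \<Lambda> * d (Z (Suc n) x) + \<Lambda> * d (Z (Suc n) x) + 2 * \<Lambda> * d (Z (Suc n) y)"
        using dist_\<phi>[of "Suc n" x] dist_\<phi>[of "Suc n" y] Suc.prems by linarith
      also have "\<dots> \<le> 2 * \<Lambda> * ?s + \<Lambda> * ?s + 2 * \<Lambda> * ?s"
        using child(2)[OF ZG ZY, of n x] child(2)[OF ZG ZY, of n y] \<Lambda> unfolding Zeq
        by (intro add_mono mult_left_mono) auto
      finally show False by simp
    qed
    then have "st (Suc n) x = st (Suc n) y"
      unfolding st_eq[of "Suc n"] Suc_eq(2,3) using IH by (simp add: Z_def lo_def hi_def)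
    then show ?case .
  qed (simp add: st_0)
  have inside: "lo n x \<le> x \<and> x < hi n x" if "x \<in> {0..<1}" for n x
  proof (induction n)
    case (Suc n)
    then show ?case using H(3)[OF ZG, of "lo n x" x "hi n x" n x] by (simp add: Suc_eq)
  qed (use that in \<open>simp add: lo_0 hi_0\<close>)
  \<comment> \<open>The share of a child is \<open>q\<close> of the child over the sum of its
    siblings and itself; replacing that sum by the smaller \<open>q\<close> of the parent makes the
    quotients telescope without any constant.\<close>
  have len: "0 \<le> hi n x - lo n x \<and> hi n x - lo n x \<le> q (Z n x) / q z0" for n x
  proof (induction n)
    case (Suc n)
    let ?S = "sum q (Y (Z n x))"
    have qp: "0 < q (Z n x)" "0 < q (Z (Suc n) x)" using q_pos[OF ZG] by auto
    have S: "q (Z n x) \<le> ?S" "0 < ?S" using weight[OF ZG, of n x] qp by auto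
    have eq: "hi (Suc n) x - lo (Suc n) x = (hi n x - lo n x) * (q (Z (Suc n) x) / ?S)"
      unfolding Suc_eq(2,3) by (rule H(4)[OF ZG ZY])
    also have "\<dots> \<le> q (Z n x) / q z0 * (q (Z (Suc n) x) / q (Z n x))"
      using Suc S qp q_pos[OF root] by (intro mult_mono divide_left_mono) auto
    finally show ?case using Suc S qp eq by simp
  qed (use q_pos[OF root] in \<open>simp add: lo_0 hi_0 Z_0\<close>)
  \<comment> \<open>Only finitely many states occur in each generation, so measurability into a
    discrete space can be checked state by state.\<close>
  have fin_meas: "finite (range (st n)) \<and> st n \<in> borel \<rightarrow>\<^sub>M count_space UNIV" for n
  proof (induction n)
    case 0
    have "st 0 = (\<lambda>_. (z0, 0, 1))" by (rule ext) (rule st_0)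
    then show ?case by simp
  next
    case (Suc n)
    have "range (st (Suc n)) \<subseteq> (\<Union>S\<in>range (st n). case S of (z, a, b) \<Rightarrow> make z a b ` Y z)"
    proof (rule image_subsetI)
      fix x
      have "st (Suc n) x \<in> (case st n x of (z, a, b) \<Rightarrow> make z a b ` Y z)"
        unfolding st_Suc step_def st_eq[of n x] prod.case
        using H(1)[OF ZG, of n x "lo n x" "hi n x"] by blast
      then show "st (Suc n) x \<in> (\<Union>S\<in>range (st n). case S of (z, a, b) \<Rightarrow> make z a b ` Y z)"
        by (rule UN_I[OF rangeI])
    qed
    moreover have "finite (\<Union>S\<in>range (st n). case S of (z, a, b) \<Rightarrow> make z a b ` Y z)"
    proof (rule finite_UN_I)
      show "finite (range (st n))" using Suc by blast
      fix S assume "S \<in> range (st n)"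
      then obtain x where "S = (Z n x, lo n x, hi n x)" using st_eq by auto
      then show "finite (case S of (z, a, b) \<Rightarrow> make z a b ` Y z)" using Y(1)[OF ZG, of n x] by simp
    qed
    ultimately have fin: "finite (range (st (Suc n)))" by (rule finite_subset)
    have "st n \<in> borel \<rightarrow>\<^sub>M count_space (range (st n))"
      using Suc by (subst measurable_count_space_eq2) (auto intro: measurable_sets[of "st n" borel "count_space UNIV", simplified])
    moreover have "step S \<in> borel \<rightarrow>\<^sub>M count_space UNIV" if S': "S \<in> range (st n)" for S
    proof -
      obtain x where S: "S = (Z n x, lo n x, hi n x)" using S' st_eq by auto
      have "(\<lambda>v. make (Z n x) (lo n x) (hi n x) (h (Z n x) (lo n x) (hi n x) v)) \<in> borel \<rightarrow>\<^sub>M count_space UNIV"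
        by (rule measurable_compose[OF H(2)[OF ZG]]) simp
      then show ?thesis by (simp add: S step_def)
    qed
    ultimately have "(\<lambda>x. step (st n x) x) \<in> borel \<rightarrow>\<^sub>M count_space UNIV"
      using Suc by (intro measurable_compose_countable'[where I = "range (st n)" and g = "st n" and f = step])
        (auto intro: countable_finite)
    then show ?case using fin by (simp add: st_Suc[abs_def])
  qed
  have Z_meas: "Z n \<in> borel_measurable borel" for n
  proof -
    have "fst \<in> count_space UNIV \<rightarrow>\<^sub>M (borel :: 'a measure)" by simp
    then show ?thesis
      unfolding Z_def using fin_meas[of n] measurable_compose by blast
  qed
  have \<phi>_meas: "\<phi> \<in> borel_measurable borel"
    by (rule borel_measurable_LIMSEQ_metric[where f = Z, OF Z_meas \<phi>])
  define U where "U = uniform_measure lborel {0..<1::real}"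
  define \<nu> where "\<nu> = distr U borel \<phi>"
  define P where "P = closure (\<phi> ` {0..<1})"
  have U: "prob_space U" unfolding U_def by (rule prob_space_uniform_measure) auto
  have \<phi>U: "\<phi> \<in> U \<rightarrow>\<^sub>M borel" using \<phi>_meas by (simp add: U_def)
  have emeasure_\<nu>: "emeasure \<nu> A = emeasure lborel ({0..<1} \<inter> \<phi> -` A)" if "A \<in> sets borel" for A
  proof -
    have "\<phi> -` A \<in> sets borel" using measurable_sets[OF \<phi>_meas that] by simp
    then show ?thesis
      unfolding \<nu>_def using that \<phi>U by (simp add: emeasure_distr) (simp add: U_def emeasure_uniform_measure divide_ennreal_def)
  qed
  \<comment> \<open>Finitely many nodes per generation with radii tending to zero make the closed
    set \<open>P\<close> totally bounded.\<close>
  have P_cover: "P \<subseteq> (\<Union>y\<in>Z n ` {0..<1}. cball y (2 * \<Lambda> * d y))" "finite (Z n ` {0..<1})" for n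
  proof -
    have "Z n ` {0..<1} \<subseteq> fst ` range (st n)" by (auto simp: Z_def)
    then show fin: "finite (Z n ` {0..<1})" using fin_meas[of n] by (meson finite_imageI finite_subset)
    show "P \<subseteq> (\<Union>y\<in>Z n ` {0..<1}. cball y (2 * \<Lambda> * d y))"
      unfolding P_def using fin dist_\<phi>[of n] by (intro closure_minimal closed_UN) auto
  qed
  show ?thesis
  proof (intro exI[of _ P] exI[of _ \<nu>] conjI ballI allI impI)
    show "compact P"
      unfolding compact_eq_totally_bounded
    proof (intro conjI allI impI)
      show "uniform_space_class.complete P" by (simp add: P_def complete_eq_closed)
      fix e :: real assume "0 < e"
      then have "0 < e / 2" by simp
      from small[OF this] obtain n where n: "\<And>x. \<Lambda> * d (Z n x) < e / 2" by blast
      have "P \<subseteq> (\<Union>y\<in>Z n ` {0..<1}. ball y e)"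
      proof
        fix v assume "v \<in> P"
        then obtain x where "x \<in> {0..<1}" "dist (Z n x) v \<le> 2 * \<Lambda> * d (Z n x)"
          using P_cover(1)[of n] by auto
        then show "v \<in> (\<Union>y\<in>Z n ` {0..<1}. ball y e)" using n[of x] by (intro UN_I[of "Z n x"]) auto
      qed
      then show "\<exists>k. finite k \<and> P \<subseteq> (\<Union>x\<in>k. ball x e)" using P_cover(2) by blast
    qed
    show "sets \<nu> = sets borel" by (simp add: \<nu>_def)
    show "prob_space \<nu>" unfolding \<nu>_def using U \<phi>U by (intro prob_space.prob_space_distr)
    have "{0..<1} \<inter> \<phi> -` (- P) = {}" using closure_subset[of "\<phi> ` {0..<1}"] unfolding P_def by blast
    moreover have "- P \<in> sets borel" by (simp add: P_def)
    ultimately show "emeasure \<nu> (- P) = 0" using emeasure_\<nu>[of "- P"] by simp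
    fix \<zeta> assume \<zeta>: "\<zeta> \<in> P"
    show "dist z0 \<zeta> \<le> 2 * \<Lambda> * d z0" using P_cover(1)[of 0] \<zeta> by (auto simp: Z_0)
    fix r :: real assume r: "0 < r"
    then obtain x0 where x0: "x0 \<in> {0..<1}" "dist (\<phi> x0) \<zeta> < r / 4"
    proof -
      have "0 < r / 4" using r by simp
      then have "\<exists>y\<in>\<phi> ` {0..<1}. dist y \<zeta> < r / 4" using \<zeta> unfolding P_def closure_approachable by blast
      then show ?thesis using that by blast
    qed
    \<comment> \<open>All parameters sent into the ball share the state of \<open>x0\<close> at
      generation n, by \<open>same\<close>, and hence lie in one interval. At n = 0 this interval is
      the whole unit interval.\<close>
    have mass: "emeasure \<nu> (ball \<zeta> r) \<le> ennreal (q (Z n x0) / q z0)" if "n = 0 \<or> 2 * r \<le> \<Lambda> * d (Z n x0)" for n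
    proof -
      have "{0..<1} \<inter> \<phi> -` ball \<zeta> r \<subseteq> {lo n x0..<hi n x0}"
      proof safe
        fix x assume x: "x \<in> {0..<1}" "\<phi> x \<in> ball \<zeta> r"
        have "dist (\<phi> x0) (\<phi> x) < 2 * r" using x(2) x0(2) dist_triangle[of "\<phi> x0" "\<phi> x" \<zeta>] r by simp
        then have "st n x0 = st n x" using same[of x0 x n] that by (auto simp: st_0)
        then show "x \<in> {lo n x0..<hi n x0}" using inside[OF x(1), of n] by (simp add: lo_def hi_def)
      qed
      then have "emeasure \<nu> (ball \<zeta> r) \<le> emeasure lborel {lo n x0..<hi n x0}"
        by (subst emeasure_\<nu>) (auto intro: emeasure_mono)
      also have "\<dots> = ennreal (hi n x0 - lo n x0)" using len[of n x0] by simp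
      also have "\<dots> \<le> ennreal (q (Z n x0) / q z0)" using len[of n x0] by (intro ennreal_leI) simp
      finally show ?thesis .
    qed
    have dist: "dist (Z n x0) \<zeta> \<le> 2 * \<Lambda> * d (Z n x0) + r / 4" for n
      using dist_\<phi>[of n x0] x0(2) dist_triangle[of "Z n x0" \<zeta> "\<phi> x0"] by linarith
    show "\<exists>y. (z0, y) \<in> T \<and> emeasure \<nu> (ball \<zeta> r) \<le> ennreal (q y / q z0) \<and>
        \<Lambda> * d y \<le> 4 * r / \<delta> \<and> dist y \<zeta> \<le> 2 * \<Lambda> * d y + r / 4 \<and> (y = z0 \<or> 2 * r \<le> \<Lambda> * d y)"
    proof -
      \<comment> \<open>The level 4 r / \<delta> turns the lower bound of \<open>scale\<close> into
        2 r, the premise of \<open>mass\<close>.\<close>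
      obtain n where n: "\<Lambda> * d (Z n x0) \<le> 4 * r / \<delta>" "n = 0 \<or> \<delta> / 2 * (4 * r / \<delta>) \<le> \<Lambda> * d (Z n x0)"
        using scale[of "4 * r / \<delta>" x0] r \<delta> by auto
      have "n = 0 \<or> 2 * r \<le> \<Lambda> * d (Z n x0)" using n(2) \<delta> by simp
      then show ?thesis using n(1) dist[of n] mass[of n] ZT[of n x0] by (intro exI[of _ "Z n x0"]) (auto simp: Z_0)
    qed
    show "\<exists>y. (z0, y) \<in> T \<and> \<Lambda> * d y \<le> r / 8 \<and> dist y \<zeta> \<le> r / 2 \<and> (y = z0 \<or> \<delta> * r / 16 \<le> \<Lambda> * d y)"
    proof -
      obtain n where n: "\<Lambda> * d (Z n x0) \<le> r / 8" "n = 0 \<or> \<delta> / 2 * (r / 8) \<le> \<Lambda> * d (Z n x0)"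
        using scale[of "r / 8" x0] r by auto
      then show ?thesis using dist[of n] ZT[of n x0] by (intro exI[of _ "Z n x0"]) (auto simp: Z_0)
    qed
  qed
qed

section \<open>The accessible boundary\<close>

lemma carrot_mono: "carrot d L c x y \<Longrightarrow> L \<le> L' \<Longrightarrow> carrot d L' c x y"
  unfolding carrot_def by (blast intro: ennreal_leI order_trans)

lemma poincare_measureI:
  fixes M :: "'a::metric_space measure"
  assumes mm: "metric_measure_space M" and dbl: "doubling M" and p: "1 < p" and poi: "poincare p M"
  shows "\<exists>D C \<kappa>. poincare_measure M D C \<kappa> p"
proof -
  have fin: "emeasure M (ball x r) < \<infinity>" for x r
    using mm by (cases "0 < r") (auto simp: metric_measure_space_def ball_empty)
  then have eq: "emeasure M (ball x r) = ennreal (measure M (ball x r))" for x r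
    by (intro emeasure_eq_ennreal_measure) (auto simp: less_top)
  obtain D where D: "1 \<le> D" "\<And>x r. 0 < r \<Longrightarrow> emeasure M (ball x (2 * r)) \<le> ennreal D * emeasure M (ball x r)"
    using dbl unfolding doubling_def by blast
  obtain C \<kappa> where C: "C > 0" "\<kappa> \<ge> 1" "\<And>x r u. 0 < r \<Longrightarrow> locally_lipschitz u \<Longrightarrow>
     (\<integral>\<^sup>+y\<in>ball x r. ennreal \<bar>u y - mean_value M (ball x r) u\<bar> \<partial>M) / emeasure M (ball x r)
       \<le> ennreal (C * r) *
         ennpowr ((\<integral>\<^sup>+y\<in>ball x (\<kappa> * r). ennpowr (Lip u y) p \<partial>M) / emeasure M (ball x (\<kappa> * r))) (1 / p)"
    using poi unfolding poincare_def by blast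
  have "poincare_measure M D C \<kappa> p"
  proof unfold_locales
    show "sets M = sets borel" using mm by (simp add: metric_measure_space_def)
    show "0 < measure M (ball x r)" if "0 < r" for x r
    proof -
      have "0 < emeasure M (ball x r)" using mm that by (simp add: metric_measure_space_def)
      then show ?thesis unfolding eq by simp
    qed
    show "measure M (ball x (2 * r)) \<le> D * measure M (ball x r)" if "0 < r" for x r
      using D(2)[OF that, of x] D(1) unfolding eq by (simp flip: ennreal_mult)
  qed (use fin D(1) C p in auto)
  then show ?thesis by blast
qed

text \<open>A covering ball that meets \<open>P\<close> lies in a ball of twice its radius centred
  in \<open>P\<close>, where the growth bound applies; this is why radii up to \<open>2 * R\<close>
  are required. Returning to the original ball costs \<open>D ^ 2\<close>, and the masses must sum
  to at least 1.\<close>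

lemma (in doubling_measure) mass_distribution:
  assumes \<nu>: "prob_space \<nu>" "sets \<nu> = sets borel" "emeasure \<nu> (- P) = 0" and PA: "P \<subseteq> A" "closed P"
    and K: "0 < K" and p: "0 \<le> p"
    and frostman: "\<And>\<zeta> r. \<zeta> \<in> P \<Longrightarrow> 0 < r \<Longrightarrow> r \<le> 2 * R \<Longrightarrow>
      emeasure \<nu> (ball \<zeta> r) \<le> ennreal (K * measure M (ball \<zeta> r) / r powr p)"
  shows "ennreal (1 / (K * D ^ 2)) \<le> codim_content M p R A"
  unfolding codim_content_def
proof (rule Inf_greatest, elim CollectE exE conjE)
  fix S I and x :: "nat \<Rightarrow> 'a" and r :: "nat \<Rightarrow> real"
  assume S: "S = (\<Sum>i. if i \<in> I then emeasure M (ball (x i) (r i)) / ennreal (r i powr p) else 0)"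
    and r: "\<forall>i\<in>I. 0 < r i \<and> r i \<le> R" and cov: "A \<subseteq> (\<Union>i\<in>I. ball (x i) (r i))"
  let ?f = "\<lambda>i. if i \<in> I then emeasure M (ball (x i) (r i)) / ennreal (r i powr p) else 0"
  interpret \<nu>: prob_space \<nu> by fact
  have sp: "space \<nu> = UNIV" using sets_eq_imp_space_eq[OF \<nu>(2)] by simp
  have ball_mass: "emeasure \<nu> (ball (x i) (r i) \<inter> P) \<le> ennreal (K * D ^ 2) * ?f i" if i: "i \<in> I" for i
  proof (cases "ball (x i) (r i) \<inter> P = {}")
    case False
    then obtain \<zeta> where \<zeta>: "\<zeta> \<in> P" "dist (x i) \<zeta> < r i" by auto
    have ri: "0 < r i" "r i \<le> R" using r i by auto
    have "ball (x i) (r i) \<inter> P \<subseteq> ball \<zeta> (2 * r i)"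
      using ball_subset_ballI[of \<zeta> "x i" "r i" "2 * r i"] \<zeta>(2) by (auto simp: dist_commute)
    then have "emeasure \<nu> (ball (x i) (r i) \<inter> P) \<le> emeasure \<nu> (ball \<zeta> (2 * r i))"
      using \<nu>(2) by (intro emeasure_mono) auto
    also have "\<dots> \<le> ennreal (K * measure M (ball \<zeta> (2 * r i)) / (2 * r i) powr p)"
      using frostman[OF \<zeta>(1), of "2 * r i"] ri by simp
    also have "\<dots> \<le> ennreal (K * D ^ 2 * (measure M (ball (x i) (r i)) / r i powr p))"
    proof (rule ennreal_leI)
      have "measure M (ball \<zeta> (2 * r i)) \<le> D ^ 2 * measure M (ball (x i) (r i))"
        using ri \<zeta>(2) by (intro measure_ball_compare) auto
      moreover have "r i powr p \<le> (2 * r i) powr p" using ri p by (intro powr_mono2) auto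
      ultimately have "K * measure M (ball \<zeta> (2 * r i)) / (2 * r i) powr p
          \<le> K * (D ^ 2 * measure M (ball (x i) (r i))) / r i powr p"
        using K D_ge_1 ri by (intro frac_le mult_left_mono) auto
      then show "K * measure M (ball \<zeta> (2 * r i)) / (2 * r i) powr p
          \<le> K * D ^ 2 * (measure M (ball (x i) (r i)) / r i powr p)" by (simp add: mult_ac)
    qed
    also have "\<dots> = ennreal (K * D ^ 2) * ?f i"
      using K D_ge_1 ri i by (simp add: emeasure_ball divide_ennreal flip: ennreal_mult)
    finally show ?thesis .
  qed simp
  have Pb: "P \<in> sets \<nu>" using PA(2) \<nu>(2) by simp
  have "1 = emeasure \<nu> UNIV" using \<nu>.emeasure_space_1 sp by simp
  also have "\<dots> \<le> emeasure \<nu> P + emeasure \<nu> (- P)"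
    using emeasure_subadditive[of P \<nu> "- P"] Pb \<nu>(2) PA(2) by (simp add: Compl_partition)
  also have "\<dots> = emeasure \<nu> P" using \<nu>(3) by simp
  also have "\<dots> \<le> emeasure \<nu> (\<Union>i. if i \<in> I then ball (x i) (r i) \<inter> P else {})"
  proof (rule emeasure_mono)
    show "P \<subseteq> (\<Union>i. if i \<in> I then ball (x i) (r i) \<inter> P else {})"
    proof
      fix v assume "v \<in> P"
      then obtain i where "i \<in> I" "v \<in> ball (x i) (r i)" using cov PA(1) by blast
      then show "v \<in> (\<Union>i. if i \<in> I then ball (x i) (r i) \<inter> P else {})"
        using \<open>v \<in> P\<close> by (intro UN_I[of i]) simp_all
    qed
    show "(\<Union>i. if i \<in> I then ball (x i) (r i) \<inter> P else {}) \<in> sets \<nu>"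
    proof (intro sets.countable_UN image_subsetI)
      show "(if i \<in> I then ball (x i) (r i) \<inter> P else {}) \<in> sets \<nu>" for i
        using Pb \<nu>(2) by (simp split: if_split)
    qed
  qed
  also have "\<dots> \<le> (\<Sum>i. emeasure \<nu> (if i \<in> I then ball (x i) (r i) \<inter> P else {}))"
  proof (intro emeasure_subadditive_countably image_subsetI)
    show "(if i \<in> I then ball (x i) (r i) \<inter> P else {}) \<in> sets \<nu>" for i
      using Pb \<nu>(2) by (simp split: if_split)
  qed
  also have "\<dots> \<le> (\<Sum>i. ennreal (K * D ^ 2) * ?f i)"
    using ball_mass by (intro suminf_le) auto
  also have "\<dots> = ennreal (K * D ^ 2) * S" unfolding S by (rule ennreal_suminf_cmult)
  finally have 1: "1 \<le> ennreal (K * D ^ 2) * S" .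
  have KD: "0 < K * D ^ 2" using K D_ge_1 by simp
  have "ennreal (1 / (K * D ^ 2)) * 1 \<le> ennreal (1 / (K * D ^ 2)) * (ennreal (K * D ^ 2) * S)"
    using 1 by (intro mult_left_mono) auto
  also have "\<dots> = ennreal (1 / (K * D ^ 2) * (K * D ^ 2)) * S"
    using K D_ge_1 by (subst ennreal_mult) (auto simp: mult.assoc)
  also have "\<dots> = S" using K D_ge_1 by auto
  finally show "ennreal (1 / (K * D ^ 2)) \<le> S" by simp
qed

theorem theorem1p1:
  fixes M :: "'a::complete_space measure"
    and \<Omega> :: "'a set"
    and p t c0 :: real
  assumes "metric_measure_space M"
    and "geodesic_space TYPE('a)"
    and "doubling M"
    and "1 < p"
    and "poincare p M"
    and "0 < t" and "t < p"
    and "is_domain \<Omega>"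
    and "frontier \<Omega> \<noteq> {}"
    and "0 < c0"
    and "\<And>w \<rho>. w \<in> frontier \<Omega> \<Longrightarrow> 0 < \<rho> \<Longrightarrow> (bounded \<Omega> \<Longrightarrow> \<rho> < diameter \<Omega>) \<Longrightarrow>
           codim_content M t \<rho> (ball w \<rho> \<inter> frontier \<Omega>)
             \<ge> ennreal c0 * emeasure M (ball w \<rho>) / ennreal (\<rho> powr t)"
  shows "\<exists>c\<ge>1. \<exists>c1>0. \<forall>z0\<in>\<Omega>.
    (let d = compl_dist \<Omega> z0;
         F = ball z0 (3 * d) \<inter> frontier (john_part \<Omega> z0 c) \<inter> frontier \<Omega>
     in
       (\<exists>P \<nu> c2. compact P \<and> P \<subseteq> F \<and> sets \<nu> = sets borel \<and> prob_space \<nu> \<and>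
          emeasure \<nu> (- P) = 0 \<and> 0 < c2 \<and>
          (\<forall>\<zeta>\<in>P. \<forall>r. 0 < r \<longrightarrow> r < 3 * d \<longrightarrow>
             emeasure \<nu> (ball \<zeta> r) \<le> ennreal c2 * emeasure M (ball \<zeta> r \<inter> \<Omega>) / ennreal (r powr p))) \<and>
       codim_content M p d F \<ge> ennreal c1 * emeasure M (ball z0 d) / ennreal (d powr p))"
proof -
  note geo = \<open>geodesic_space TYPE('a)\<close>
  obtain D C \<kappa> where "poincare_measure M D C \<kappa> p"
    using poincare_measureI[OF assms(1,3,4,5)] by blast
  then interpret poincare_measure M D C \<kappa> p .
  let ?d = "compl_dist \<Omega>"
  define q where "q = (\<lambda>z. measure M (ball z (?d z)) / ?d z powr p)"
  define \<Lambda> where "\<Lambda> = 4 * \<kappa>"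
  have \<Lambda>: "4 \<le> \<Lambda>" using \<kappa>_ge_1 by (simp add: \<Lambda>_def)
  have \<Omega>: "open \<Omega>" "\<Omega> \<noteq> UNIV" using assms(8,9) by (auto simp: is_domain_def)
  have dpos: "0 < ?d z" if "z \<in> \<Omega>" for z using compl_dist_pos \<Omega> that by blast
  have qpos: "0 < q z" if "z \<in> \<Omega>" for z
    using dpos[OF that] measure_ball_pos[OF dpos[OF that]] by (simp add: q_def)
  define good where "good = (\<lambda>L \<delta> z Y \<sigma>. finite Y \<and> \<delta> * ?d z \<le> \<sigma> \<and> \<sigma> \<le> ?d z / 2 \<and>
    (\<forall>y\<in>Y. \<sigma> / 2 < ?d y \<and> ?d y \<le> \<sigma> \<and> dist z y \<le> \<Lambda> * ?d z \<and> reaches ?d (L * ?d z) (\<delta> * ?d z) z y) \<and>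
    separated (5 * \<Lambda> * \<sigma>) Y \<and> q z \<le> (\<Sum>y\<in>Y. q y))"
  have "\<exists>L>0. \<exists>\<delta>>0. \<forall>z\<in>\<Omega>. \<exists>Y \<sigma>. good L \<delta> z Y \<sigma>"
    using branching[OF geo \<Omega> assms(6,7,10,11)] unfolding good_def q_def \<Lambda>_def by blast
  then obtain L \<delta> where L: "0 < L" and \<delta>: "0 < \<delta>" and "\<forall>z\<in>\<Omega>. \<exists>Y \<sigma>. good L \<delta> z Y \<sigma>" by blast
  then obtain Y \<sigma> where "\<And>z. z \<in> \<Omega> \<Longrightarrow> good L \<delta> z (Y z) (\<sigma> z)" by metis
  then have Y: "\<And>z. z \<in> \<Omega> \<Longrightarrow> finite (Y z)" "\<And>z. z \<in> \<Omega> \<Longrightarrow> \<delta> * ?d z \<le> \<sigma> z"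
    "\<And>z. z \<in> \<Omega> \<Longrightarrow> \<sigma> z \<le> ?d z / 2"
    and child: "\<And>z y. z \<in> \<Omega> \<Longrightarrow> y \<in> Y z \<Longrightarrow> \<sigma> z / 2 < ?d y \<and> ?d y \<le> \<sigma> z \<and> dist z y \<le> \<Lambda> * ?d z \<and>
        reaches ?d (L * ?d z) (\<delta> * ?d z) z y"
    and sep: "\<And>z. z \<in> \<Omega> \<Longrightarrow> separated (5 * \<Lambda> * \<sigma> z) (Y z)"
    and weight: "\<And>z. z \<in> \<Omega> \<Longrightarrow> q z \<le> (\<Sum>y\<in>Y z. q y)"
    unfolding good_def by blast+
  obtain a where "a \<in> \<Omega>" using assms(9) by fastforce
  then have "\<delta> * ?d a \<le> 1 / 2 * ?d a" using Y(2,3)[of a] by simp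
  then have \<delta>2: "\<delta> \<le> 1 / 2" using dpos[OF \<open>a \<in> \<Omega>\<close>] by (rule mult_right_le_imp_le)
  have Y\<Omega>: "Y z \<subseteq> \<Omega>" if z: "z \<in> \<Omega>" for z
  proof
    fix y assume "y \<in> Y z"
    then have "0 < ?d y" using child[OF z, of y] Y(2)[OF z] mult_pos_pos[OF \<delta> dpos[OF z]] by linarith
    then show "y \<in> \<Omega>" by (rule compl_dist_pos_mem)
  qed
  define T where "T = {(z, y). z \<in> \<Omega> \<and> y \<in> Y z}\<^sup>*"
  \<comment> \<open>The first summand serves the edges of the tree, of length L d at distance
    \<delta> d; the second serves the initial geodesic, which comes as close as d / (4 \<Lambda>) to
    the complement.\<close>
  define cc where "cc = 2 * L / \<delta> + 4 * \<Lambda> * (1 + L)"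
  have cc: "0 \<le> cc" "2 * L \<le> cc * \<delta>" "4 * \<Lambda> * (1 + L) \<le> cc"
    using L \<delta> \<Lambda> by (auto simp: cc_def field_simps)
  have carrot: "carrot ?d (2 * L * ?d z) cc z y" if zy: "(z, y) \<in> T" and z: "z \<in> \<Omega>" for z y
    using zy[unfolded T_def] z
  proof (induction rule: converse_rtrancl_induct)
    case base
    have "carrot ?d 0 cc y y" by (rule carrot_refl) (rule dpos[OF base])
    then show ?case by (rule carrot_mono) (use L in simp)
  next
    case (step z z')
    then have zz: "z \<in> \<Omega>" "z' \<in> Y z" by auto
    have IH: "carrot ?d (2 * L * ?d z') cc z' y" using step Y\<Omega> zz by blast
    have half: "?d z' \<le> ?d z / 2" using child[OF zz] Y(3)[OF zz(1)] by linarith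
    \<comment> \<open>Since d at least halves in each generation, the edge lengths form a series
      dominated by a geometric one, and 2 L d bounds all of them together.\<close>
    have le: "L * ?d z + 2 * L * ?d z' \<le> 2 * L * ?d z"
      using mult_left_mono[OF half, of "2 * L"] L by simp
    have "carrot ?d (L * ?d z + 2 * L * ?d z') cc z y"
    proof (rule reaches_carrot[OF _ IH])
      show "reaches ?d (L * ?d z) (\<delta> * ?d z) z z'" using child[OF zz] by blast
      have "2 * L * ?d z \<le> cc * \<delta> * ?d z" using cc(2) by (intro mult_right_mono) auto
      then show "L * ?d z + 2 * L * ?d z' \<le> cc * (\<delta> * ?d z)" using le by simp
    qed (use L \<delta> dpos[OF zz(1)] cc in auto)
    then show ?case using le by (rule carrot_mono)
  qed
  obtain n1 where "8 * \<Lambda> < 2 ^ n1" using real_arch_pow[of 2 "8 * \<Lambda>"] by auto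
  then have n1: "8 * \<Lambda> \<le> 2 ^ n1" by simp
  \<comment> \<open>This exponent compares two node balls used for the growth bound: their centres
    and radii differ by at most (1 + 12 / \<delta>) r, and the smaller one has radius at least
    \<delta> r / (16 \<Lambda>).\<close>
  obtain n where "(1 + 12 / \<delta>) * (16 * \<Lambda> / \<delta>) < 2 ^ n" using real_arch_pow[of 2] by auto
  then have n: "(1 + 12 / \<delta>) * (16 * \<Lambda> / \<delta>) \<le> 2 ^ n" by simp
  define K where "K = D ^ n1 * D ^ n * (12 * \<Lambda>) powr p"
  have K: "0 < K" using D_ge_1 \<Lambda> by (simp add: K_def)
  show ?thesis
  proof (rule exI[of _ "3 * cc + 1"], rule conjI)
    show "1 \<le> 3 * cc + 1" using cc by simp
    show "\<exists>c1>0. \<forall>z0\<in>\<Omega>.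
      (let d = compl_dist \<Omega> z0;
           F = ball z0 (3 * d) \<inter> frontier (john_part \<Omega> z0 (3 * cc + 1)) \<inter> frontier \<Omega>
       in
         (\<exists>P \<nu> c2. compact P \<and> P \<subseteq> F \<and> sets \<nu> = sets borel \<and> prob_space \<nu> \<and>
            emeasure \<nu> (- P) = 0 \<and> 0 < c2 \<and>
            (\<forall>\<zeta>\<in>P. \<forall>r. 0 < r \<longrightarrow> r < 3 * d \<longrightarrow>
               emeasure \<nu> (ball \<zeta> r) \<le> ennreal c2 * emeasure M (ball \<zeta> r \<inter> \<Omega>) / ennreal (r powr p))) \<and>
         codim_content M p d F \<ge> ennreal c1 * emeasure M (ball z0 d) / ennreal (d powr p))"
    proof (rule exI[of _ "1 / (K * D ^ 2)"], intro conjI ballI)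
      show "0 < 1 / (K * D ^ 2)" using K D_ge_1 by simp
      fix z0 assume z0: "z0 \<in> \<Omega>"
      define d where "d = ?d z0"
      define F where "F = ball z0 (3 * d) \<inter> frontier (john_part \<Omega> z0 (3 * cc + 1)) \<inter> frontier \<Omega>"
      have d: "0 < d" using dpos[OF z0] by (simp add: d_def)
      \<comment> \<open>The root \<open>z1\<close> is placed on a geodesic to an almost nearest
        boundary point so that d / (4 \<Lambda>) \<le> d(z1) \<le> d / (2 \<Lambda>). Limit points
        are then within d of \<open>z1\<close> and within 2 d of \<open>z0\<close>; the slack d / (8
        \<Lambda>) avoids a nearest point.\<close>
      obtain w where w: "w \<in> frontier \<Omega>" "dist z0 w < d + d / (8 * \<Lambda>)"
        using near_frontier_point[OF geo \<Omega>(2) z0, of "d + d / (8 * \<Lambda>)"] d \<Lambda> by (auto simp: d_def)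
      have "0 < d / (4 * \<Lambda>)" "d / (4 * \<Lambda>) \<le> d" using d \<Lambda> by (auto simp: field_simps)
      moreover have "d \<le> dist z0 w"
        using compl_dist_lipschitz[of \<Omega> z0 w] compl_dist_frontier[OF \<Omega>(1) w(1)] by (simp add: d_def)
      ultimately have "0 \<le> d - d / (4 * \<Lambda>)" "d - d / (4 * \<Lambda>) \<le> dist z0 w" by linarith+
      from geodesic_point[OF geo this] obtain z1 where z1: "dist z0 z1 = d - d / (4 * \<Lambda>)" "dist z1 w = dist z0 w - (d - d / (4 * \<Lambda>))" by blast
      have low: "d / (4 * \<Lambda>) \<le> ?d v" if "dist z0 v \<le> dist z0 z1" for v
        using compl_dist_lipschitz[of \<Omega> z0 v] that z1(1) by (simp add: d_def)
      have d1: "d / (4 * \<Lambda>) \<le> ?d z1" "?d z1 \<le> d / (2 * \<Lambda>)"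
      proof -
        show "d / (4 * \<Lambda>) \<le> ?d z1" by (rule low) simp
        have "?d z1 \<le> dist z1 w"
          using compl_dist_lipschitz[of \<Omega> z1 w] compl_dist_frontier[OF \<Omega>(1) w(1)] by simp
        also have "\<dots> \<le> d / (8 * \<Lambda>) + d / (4 * \<Lambda>)" using z1(2) w(2) by simp
        also have "\<dots> \<le> d / (2 * \<Lambda>)" using d \<Lambda> by (simp add: field_simps)
        finally show "?d z1 \<le> d / (2 * \<Lambda>)" .
      qed
      have z1\<Omega>: "z1 \<in> \<Omega>" using d1(1) d \<Lambda> by (intro compl_dist_pos_mem) (auto intro: less_le_trans[rotated])
      obtain P \<nu> where P: "compact P" "sets \<nu> = sets borel" "prob_space \<nu>" "emeasure \<nu> (- P) = 0"
        and Pdist: "\<And>\<zeta>. \<zeta> \<in> P \<Longrightarrow> dist z1 \<zeta> \<le> 2 * \<Lambda> * ?d z1"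
        and big: "\<And>\<zeta> r. \<zeta> \<in> P \<Longrightarrow> 0 < r \<Longrightarrow> \<exists>y. (z1, y) \<in> T \<and> emeasure \<nu> (ball \<zeta> r) \<le> ennreal (q y / q z1) \<and>
          \<Lambda> * ?d y \<le> 4 * r / \<delta> \<and> dist y \<zeta> \<le> 2 * \<Lambda> * ?d y + r / 4 \<and> (y = z1 \<or> 2 * r \<le> \<Lambda> * ?d y)"
        and near: "\<And>\<zeta> r. \<zeta> \<in> P \<Longrightarrow> 0 < r \<Longrightarrow> \<exists>y. (z1, y) \<in> T \<and> \<Lambda> * ?d y \<le> r / 8 \<and> dist y \<zeta> \<le> r / 2 \<and>
          (y = z1 \<or> \<delta> * r / 16 \<le> \<Lambda> * ?d y)"
      proof -
        have "0 < \<Lambda>" using \<Lambda> by simp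
        note tree_measure[of z1 \<Omega> ?d q \<Lambda> \<delta> Y \<sigma>, OF z1\<Omega> dpos qpos this \<delta> Y(1) Y\<Omega> Y(2,3) _ _ _ sep weight]
        then show ?thesis using child that unfolding T_def by blast
      qed
      have john: "y \<in> john_part \<Omega> z0 (3 * cc + 1)" if y: "(z1, y) \<in> T" for y
      proof (rule carrot_john_part[OF geo \<Omega>(2) cc(1)])
        show "carrot ?d (dist z0 z1 + 2 * L * ?d z1) cc z0 y"
        proof (rule reaches_carrot[OF reaches_geodesic[OF geo low] carrot[OF y z1\<Omega>]])
          have "dist z0 z1 \<le> d" using z1(1) d \<Lambda> by simp
          moreover have "2 * L * ?d z1 \<le> 2 * L * (d / (2 * \<Lambda>))" using d1(2) L by (intro mult_left_mono) auto
          moreover have "2 * L * (d / (2 * \<Lambda>)) \<le> L * d" using L d \<Lambda> by (simp add: field_simps)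
          ultimately have "dist z0 z1 + 2 * L * ?d z1 \<le> (1 + L) * d" by (simp add: algebra_simps)
          also have "\<dots> = 4 * \<Lambda> * (1 + L) * (d / (4 * \<Lambda>))" using \<Lambda> by simp
          also have "\<dots> \<le> cc * (d / (4 * \<Lambda>))" using cc(3) d \<Lambda> by (intro mult_right_mono) auto
          finally show "dist z0 z1 + 2 * L * ?d z1 \<le> cc * (d / (4 * \<Lambda>))" .
        qed (use L d \<Lambda> cc in auto)
      qed
      have PF: "P \<subseteq> F"
      proof
        fix \<zeta> assume \<zeta>: "\<zeta> \<in> P"
        have "2 * \<Lambda> * ?d z1 \<le> d" using d1(2) \<Lambda> by (simp add: field_simps)
        moreover have "dist z0 z1 \<le> d" using z1(1) d \<Lambda> by simp
        ultimately have "dist z0 \<zeta> < 3 * d"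
          using Pdist[OF \<zeta>] dist_triangle[of z0 \<zeta> z1] d by linarith
        moreover have sub: "john_part \<Omega> z0 (3 * cc + 1) \<subseteq> \<Omega>" by (auto simp: john_part_def)
        moreover have cl: "\<zeta> \<in> closure (john_part \<Omega> z0 (3 * cc + 1))"
          unfolding closure_approachable
        proof (intro allI impI)
          fix e :: real assume "0 < e"
          then show "\<exists>y\<in>john_part \<Omega> z0 (3 * cc + 1). dist y \<zeta> < e"
            using near[OF \<zeta>, of e] john by (metis field_sum_of_halves less_add_same_cancel1 half_gt_zero le_less_trans)
        qed
        moreover have "\<zeta> \<notin> \<Omega>"
        proof
          \<comment> \<open>Nodes near \<zeta> have small d, so d(\<zeta>) would be at most 5/8 of
            itself.\<close>
          assume "\<zeta> \<in> \<Omega>"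
          then have pos: "0 < ?d \<zeta>" by (rule dpos)
          then obtain y where "\<Lambda> * ?d y \<le> ?d \<zeta> / 8" "dist y \<zeta> \<le> ?d \<zeta> / 2" using near[OF \<zeta>, of "?d \<zeta>"] by blast
          moreover have "1 * ?d y \<le> \<Lambda> * ?d y" using \<Lambda> by (intro mult_right_mono) auto
          ultimately show False using compl_dist_lipschitz[of \<Omega> y \<zeta>] pos by simp
        qed
        ultimately show "\<zeta> \<in> F"
          unfolding F_def frontier_def using interior_subset closure_mono[OF sub] by fastforce
      qed
      \<comment> \<open>The constant of the growth bound may depend on \<open>z0\<close>. Its
        reciprocal contains \<open>q z0\<close>, precisely the normalisation on the right of (ii),
        so \<open>c1\<close> does not depend on \<open>z0\<close>.\<close>
      define c2 where "c2 = K / q z0"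
      have c2: "0 < c2" using K qpos[OF z0] by (simp add: c2_def)
      have qz1: "q z0 / D ^ n1 \<le> q z1"
      proof -
        have "2 * d = 8 * \<Lambda> * (d / (4 * \<Lambda>))" using \<Lambda> by simp
        also have "\<dots> \<le> 2 ^ n1 * ?d z1" using n1 d1(1) d \<Lambda> by (intro mult_mono) auto
        finally have "2 * d \<le> 2 ^ n1 * ?d z1" .
        moreover have "dist z1 z0 \<le> d" using z1(1) d \<Lambda> by (simp add: dist_commute)
        ultimately have "measure M (ball z0 d) \<le> D ^ n1 * measure M (ball z1 (?d z1))"
          using dpos[OF z1\<Omega>] by (intro measure_ball_compare) auto
        then have "measure M (ball z0 d) / D ^ n1 \<le> measure M (ball z1 (?d z1))"
          using D_ge_1 by (simp add: divide_le_eq mult.commute)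
        moreover have "?d z1 powr p \<le> d powr p"
        proof -
          have "d / (2 * \<Lambda>) \<le> d" using d \<Lambda> by (simp add: field_simps)
          then show ?thesis using d1(2) p_gt_1 by (intro powr_mono2) auto
        qed
        ultimately have "measure M (ball z0 d) / D ^ n1 / d powr p \<le> measure M (ball z1 (?d z1)) / ?d z1 powr p"
          using dpos[OF z1\<Omega>] by (intro frac_le) auto
        then show ?thesis by (simp add: q_def d_def mult.commute)
      qed
      have frostman: "emeasure \<nu> (ball \<zeta> r) \<le> ennreal (c2 * measure M (ball \<zeta> r \<inter> \<Omega>) / r powr p)"
        if \<zeta>: "\<zeta> \<in> P" and r: "0 < r" "r < 3 * d" for \<zeta> r
      proof -
        \<comment> \<open>Two nodes play different roles: \<open>y\<close> bounds the mass of the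
          ball through \<open>q y\<close>, while \<open>v\<close> supplies a ball inside
          \<open>ball \<zeta> r \<inter> \<Omega>\<close> of comparable measure. If either is the
          root, r < 3 d still makes its size comparable to r.\<close>
        obtain y where y: "emeasure \<nu> (ball \<zeta> r) \<le> ennreal (q y / q z1)" "\<Lambda> * ?d y \<le> 4 * r / \<delta>"
          "dist y \<zeta> \<le> 2 * \<Lambda> * ?d y + r / 4" "y = z1 \<or> 2 * r \<le> \<Lambda> * ?d y"
          using big[OF \<zeta> r(1)] by blast
        obtain v where v: "\<Lambda> * ?d v \<le> r / 8" "dist v \<zeta> \<le> r / 2" "v = z1 \<or> \<delta> * r / 16 \<le> \<Lambda> * ?d v"
          using near[OF \<zeta> r(1)] by blast
        have z1r: "r / 12 \<le> \<Lambda> * ?d z1"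
        proof -
          have "r / 12 \<le> \<Lambda> * (d / (4 * \<Lambda>))" using r(2) \<Lambda> by simp
          also have "\<dots> \<le> \<Lambda> * ?d z1" using d1(1) \<Lambda> by (intro mult_left_mono) auto
          finally show ?thesis .
        qed
        have yr: "r / 12 \<le> \<Lambda> * ?d y" using y(4) z1r r(1) by auto
        have "\<delta> * r / 16 \<le> r / 12" using \<delta>2 r(1) mult_right_mono[OF \<delta>2, of r] by simp
        then have vr: "\<delta> * r / 16 \<le> \<Lambda> * ?d v" using v(3) z1r by auto
        have vpos: "0 < ?d v"
          using vr mult_pos_pos[OF \<delta> r(1)] \<Lambda> by (simp add: zero_less_mult_iff flip: not_le) (smt (verit) mult_nonneg_nonpos)
        have "?d v \<le> r / 2"
        proof -
          have "1 * ?d v \<le> \<Lambda> * ?d v" using \<Lambda> by (intro mult_right_mono) auto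
          then show ?thesis using v(1) r(1) by simp
        qed
        then have sub: "ball v (?d v) \<subseteq> ball \<zeta> r \<inter> \<Omega>"
          using ball_subset_ballI[of \<zeta> v "?d v" r] v(2) ball_compl_dist_subset[of v \<Omega>] by (simp add: dist_commute)
        have "ball \<zeta> r \<inter> \<Omega> \<in> fmeasurable M"
          using \<Omega>(1) sets_M by (intro fmeasurable_Int_fmeasurable ball_fmeasurable) auto
        then have vM: "measure M (ball v (?d v)) \<le> measure M (ball \<zeta> r \<inter> \<Omega>)"
          using sub by (intro measure_mono_fmeasurable) auto
        have "dist v y + ?d y \<le> (1 + 12 / \<delta>) * r"
        proof -
          have "1 * ?d y \<le> \<Lambda> * ?d y" using \<Lambda> by (intro mult_right_mono) auto
          then have "dist v y + ?d y \<le> r / 2 + (r / 4 + 3 * (4 * r / \<delta>))"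
            using v(2) y(2,3) dist_triangle2[of v y \<zeta>] by linarith
          also have "\<dots> \<le> (1 + 12 / \<delta>) * r" using r(1) by (simp add: algebra_simps)
          finally show ?thesis .
        qed
        also have "\<dots> = (1 + 12 / \<delta>) * (16 * \<Lambda> / \<delta>) * (\<delta> * r / 16 / \<Lambda>)" using \<delta> \<Lambda> by simp
        also have "\<dots> \<le> 2 ^ n * ?d v"
          using n vr \<delta> \<Lambda> r(1) by (intro mult_mono) (auto simp: divide_le_eq mult_ac)
        finally have yM: "measure M (ball y (?d y)) \<le> D ^ n * measure M (ball v (?d v))"
          using vpos by (intro measure_ball_compare)
        have rp: "(r / (12 * \<Lambda>)) powr p \<le> ?d y powr p"
          using yr \<Lambda> r(1) p_gt_1 by (intro powr_mono2) (auto simp: field_simps)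
        have "q y \<le> (D ^ n * measure M (ball \<zeta> r \<inter> \<Omega>)) / (r / (12 * \<Lambda>)) powr p"
          unfolding q_def
        proof (rule frac_le)
          show "measure M (ball y (?d y)) \<le> D ^ n * measure M (ball \<zeta> r \<inter> \<Omega>)"
            by (rule order_trans[OF yM mult_left_mono[OF vM]]) (use D_ge_1 in simp)
        qed (use rp r \<Lambda> D_ge_1 in auto)
        also have "\<dots> = D ^ n * (12 * \<Lambda>) powr p * measure M (ball \<zeta> r \<inter> \<Omega>) / r powr p"
          using r(1) \<Lambda> by (simp add: powr_divide)
        finally have qy: "q y \<le> D ^ n * (12 * \<Lambda>) powr p * measure M (ball \<zeta> r \<inter> \<Omega>) / r powr p" .
        have "q y / q z1 \<le> (D ^ n * (12 * \<Lambda>) powr p * measure M (ball \<zeta> r \<inter> \<Omega>) / r powr p) / (q z0 / D ^ n1)"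
          using qy qz1 qpos[OF z0] D_ge_1 by (intro frac_le) auto
        also have "\<dots> = c2 * measure M (ball \<zeta> r \<inter> \<Omega>) / r powr p"
          by (simp add: c2_def K_def mult_ac)
        finally show ?thesis using y(1) by (meson ennreal_leI order_trans)
      qed
      have "emeasure \<nu> (ball \<zeta> r) \<le> ennreal c2 * emeasure M (ball \<zeta> r \<inter> \<Omega>) / ennreal (r powr p)"
        if \<zeta>: "\<zeta> \<in> P" and r: "0 < r" "r < 3 * d" for \<zeta> r
      proof -
        have "ball \<zeta> r \<inter> \<Omega> \<in> fmeasurable M"
          using \<Omega>(1) sets_M by (intro fmeasurable_Int_fmeasurable ball_fmeasurable) auto
        then have "emeasure M (ball \<zeta> r \<inter> \<Omega>) = ennreal (measure M (ball \<zeta> r \<inter> \<Omega>))"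
          by (rule emeasure_eq_measure2)
        then show ?thesis
          using frostman[OF that] c2 r(1) by (simp add: divide_ennreal flip: ennreal_mult)
      qed
      moreover have "ennreal (1 / (K * D ^ 2)) * emeasure M (ball z0 d) / ennreal (d powr p) \<le> codim_content M p d F"
      proof -
        have "ennreal (1 / (c2 * D ^ 2)) \<le> codim_content M p d F"
        proof (rule mass_distribution[OF P(3,2,4) PF compact_imp_closed[OF P(1)] c2])
          fix \<zeta> r assume \<zeta>: "\<zeta> \<in> P" and r: "0 < r" "r \<le> 2 * d"
          have "emeasure \<nu> (ball \<zeta> r) \<le> ennreal (c2 * measure M (ball \<zeta> r \<inter> \<Omega>) / r powr p)"
            using \<zeta> r d by (intro frostman) auto
          also have "\<dots> \<le> ennreal (c2 * measure M (ball \<zeta> r) / r powr p)"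
            using c2 \<Omega>(1) sets_M
            by (intro ennreal_leI divide_right_mono mult_left_mono measure_mono_fmeasurable ball_fmeasurable) auto
          finally show "emeasure \<nu> (ball \<zeta> r) \<le> ennreal (c2 * measure M (ball \<zeta> r) / r powr p)" .
        qed (use p_gt_1 in simp)
        moreover have "ennreal (1 / (K * D ^ 2)) * emeasure M (ball z0 d) / ennreal (d powr p)
            = ennreal (1 / (K * D ^ 2) * measure M (ball z0 d) / d powr p)"
          using K d by (simp add: emeasure_ball divide_ennreal flip: ennreal_mult)
        moreover have "1 / (K * D ^ 2) * measure M (ball z0 d) / d powr p = 1 / (c2 * D ^ 2)"
          by (simp add: c2_def q_def d_def)
        ultimately show ?thesis by simp
      qed
      ultimately show "let d = compl_dist \<Omega> z0;
           F = ball z0 (3 * d) \<inter> frontier (john_part \<Omega> z0 (3 * cc + 1)) \<inter> frontier \<Omega>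
       in
         (\<exists>P \<nu> c2. compact P \<and> P \<subseteq> F \<and> sets \<nu> = sets borel \<and> prob_space \<nu> \<and>
            emeasure \<nu> (- P) = 0 \<and> 0 < c2 \<and>
            (\<forall>\<zeta>\<in>P. \<forall>r. 0 < r \<longrightarrow> r < 3 * d \<longrightarrow>
               emeasure \<nu> (ball \<zeta> r) \<le> ennreal c2 * emeasure M (ball \<zeta> r \<inter> \<Omega>) / ennreal (r powr p))) \<and>
         codim_content M p d F \<ge> ennreal (1 / (K * D ^ 2)) * emeasure M (ball z0 d) / ennreal (d powr p)"
        using P PF c2 unfolding Let_def d_def F_def by blast
    qed
  qed
qed

end
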